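(* Let $\boldsymbol\theta=(\theta_0,\theta_1,\theta_t,\theta_\infty)\in\mathbb{C}^4$ with $\theta_\infty\neq0$. Let $\boldsymbol\Theta(q)=(\Theta_0,\Theta_1,\Theta_t,\Theta_\infty)(q)$ and $\overline{\boldsymbol\Theta}(q)=(\overline\Theta_0,\overline\Theta_1,\overline\Theta_t,\overline\Theta_\infty)(q)$ be two quadruples of elements of $\mathbb{C}(q)$ such that $\Theta_\infty\ne\overline\Theta_\infty$ and such that $\Theta_0\overline\Theta_0=\Theta_\infty\overline\Theta_\infty\Theta_t\overline\Theta_t\Theta_1\overline\Theta_1$. Let $\mathfrak{A}\in\mathrm{M}_2(\mathbb{C}(x,\lambda,y,Z,t,q))$ and $A\in\mathfrak{sl}_2(\mathbb{C}(x,\lambda,y,Z,t))$ be the matrices with rational function entries defined by the formulas in the context. Denote $\widetilde{\mathfrak{A}}=\frac{\mathfrak{A}-I_2}{(q-1)x}$. The following are equivalent. (1) The divisor $\{q=1\}$ in $\mathbb{C}^6_{x,\lambda,y,Z,t,q}$ is not an irreducible component of the polar divisor of $\widetilde{\mathfrak{A}}$, and the therefore well-defined rational matrix function $\widetilde{\mathfrak{A}}|_{q=1}$ equals $A(x,\lambda,y,Z,t)$. In other words, $\lim_{q\to1}\widetilde{\mathfrak{A}}(x,\lambda,y,Z,t,q)=A(x,\lambda,y,Z,t)$. (2) Up to permuting the roles of $\Theta_i$ and $\overline\Theta_i$ for $i\in\{0,1,t\}$, the following holds as $q\to1$, for all $i\in\{0,1,t,\infty\}$: $$\Theta_i(q)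=1+(q-1)\frac{\theta_i}{2}+O((q-1)^2),\qquad\overline\Theta_i(q)=1-(q-1)\frac{\theta_i}{2}+O((q-1)^2).$$
   Context: $I_2$ is the $2\times2$ identity matrix. Definition of $\mathfrak{A}$. Put $\mathfrak{p}(x)=(x-t\Theta_t)(x-t\overline\Theta_t)(x-\Theta_1)(x-\overline\Theta_1)$. Then $$\mathfrak{A}=\frac{1}{(x-1)(x-t)}\begin{pmatrix}\overline\Theta_\infty((x-y)(x-\alpha)+z_1)&(q-1)\lambda(x-y)\\ \Theta_\infty\overline\Theta_\infty\frac{\gamma x+\delta}{(q-1)\lambda}&\Theta_\infty((x-y)(x-\beta)+z_2)\end{pmatrix}$$ with $$z_1=\frac{(y-1)(y-t)(1+(q-1)yZ)}{\overline\Theta_\infty},\qquad z_2=\frac{\mathfrak{p}(y)}{z_1},$$ $$\beta=-(\alpha-1)-(y-t)+\frac{\mathfrak{p}(0)-\mathfrak{p}(y)}{ty}+\frac{\mathfrak{p}(t)-\mathfrak{p}(y)}{t(t-1)(y-t)}-\frac{\mathfrak{p}(1)-\mathfrak{p}(y)}{(t-1)(y-1)},$$ $$\gamma=z_1+z_2+\alpha\beta+(\alpha-1+\beta)(y-1)-\frac{\mathfrak{p}(0)-\mathfrak{p}(y)}{y}+\frac{\mathfrak{p}(1)-\mathfrak{p}(y)}{y-1},\qquad\delta=\frac{\mathfrak{p}(0)-(\alpha y+z_1)(\beta y+z_2)}{y},$$ $$\alpha=-\frac{t(\Theta_0+\overline\Theta_0)-(\overline\Theta_\infty z_1+\Theta_\infty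 z_2)}{(\Theta_\infty-\overline\Theta_\infty)y}+\frac{\Theta_\infty}{\Theta_\infty-\overline\Theta_\infty}\left(1+t-y+\frac{\mathfrak{p}(0)-\mathfrak{p}(y)}{ty}+\frac{\mathfrak{p}(t)-\mathfrak{p}(y)}{t(t-1)(y-t)}-\frac{\mathfrak{p}(1)-\mathfrak{p}(y)}{(t-1)(y-1)}\right).$$ Definition of $A$. Put $a=\frac{t\theta_0^2}{y}-\frac{(t-1)\theta_1^2}{y-1}+\frac{t(t-1)\theta_t^2}{y-t}$. Then $A^{(2,2)}=-A^{(1,1)}$ and $$A^{(1,1)}=\frac{y-x}{4\theta_\infty x(x-1)(x-t)}\left[y(y-1)(y-t)\left(2Z+\frac{\theta_\infty}{y-x}\right)^2-a\right]-\frac{\theta_\infty}{4}\left(\frac1x+\frac1{x-1}+\frac1{x-t}+\frac1{y-x}\right),$$ $$A^{(1,2)}=\frac{\lambda(x-y)}{x(x-1)(x-t)},\qquad A^{(2,1)}=\frac1\lambda\left(\frac{c_0}{x}+\frac{c_1}{x-1}-\frac{c_0+c_1}{x-t}\right),$$ $$c_0=\frac{y}{t\theta_\infty^2}\left((y-1)(y-t)(yZ+\theta_\infty)Z+\frac{(y-1-t)\theta_\infty^2-a}{4}\right)^2-\frac{t\theta_0^2}{4y},$$ $$c_1=\frac{y-1}{(1-t)\theta_\infty^2}\left(y(y-t)((y-1)Z+\theta_\infty)Z+\frac{(y+1-t)\theta_\infty^2-a}{4}\right)^2-\frac{(1-t)\theta_1^2}{4(y-1)}.$$ *)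

theory Defs
  imports
    "HOL-Analysis.Analysis"
    "HOL-Computational_Algebra.Computational_Algebra"
    "HOL-Computational_Algebra.Field_as_Ring"
    "HOL-Library.Landau_Symbols"
begin

datatype puncture = P0 | P1 | Pt | Pinf

section \<open>The two matrices, over an arbitrary field\<close>

context
  fixes \<Theta> \<Theta>' :: "puncture \<Rightarrow> 'a::field"  \<comment> \<open>\<open>\<Theta>'\<close> is the barred quadruple\<close>
    and l y Z t q :: 'a
begin

definition pfrak :: "'a \<Rightarrow> 'a" where
  "pfrak x = (x - t * \<Theta> Pt) * (x - t * \<Theta>' Pt) * (x - \<Theta> P1) * (x - \<Theta>' P1)"

definition qz1 :: 'a where
  "qz1 = (y - 1) * (y - t) * (1 + (q - 1) * y * Z) / \<Theta>' Pinf"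

definition qz2 :: 'a where
  "qz2 = pfrak y / qz1"

definition qsum :: 'a  \<comment> \<open>the combination of difference quotients common to \<open>qalpha\<close> and \<open>qbeta\<close>\<close> where
  "qsum = (pfrak 0 - pfrak y) / (t * y)
        + (pfrak t - pfrak y) / (t * (t - 1) * (y - t))
        - (pfrak 1 - pfrak y) / ((t - 1) * (y - 1))"

definition qalpha :: 'a where
  "qalpha =
     - ((t * (\<Theta> P0 + \<Theta>' P0) - (\<Theta>' Pinf * qz1 + \<Theta> Pinf * qz2)) / ((\<Theta> Pinf - \<Theta>' Pinf) * y))
     + \<Theta> Pinf / (\<Theta> Pinf - \<Theta>' Pinf) * (1 + t - y + qsum)"

definition qbeta :: 'a where
  "qbeta = - (qalpha - 1) - (y - t) + qsum"

definition qgamma :: 'a where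
  "qgamma = qz1 + qz2 + qalpha * qbeta + (qalpha - 1 + qbeta) * (y - 1)
     - (pfrak 0 - pfrak y) / y + (pfrak 1 - pfrak y) / (y - 1)"

definition qdelta :: 'a where
  "qdelta = (pfrak 0 - (qalpha * y + qz1) * (qbeta * y + qz2)) / y"

definition Afrak :: "'a \<Rightarrow> 'a^2^2" where
  "Afrak x = (\<chi> i j. 1 / ((x - 1) * (x - t)) *
     (vector
       [vector [\<Theta>' Pinf * ((x - y) * (x - qalpha) + qz1), (q - 1) * l * (x - y)],
        vector [\<Theta> Pinf * \<Theta>' Pinf * ((qgamma * x + qdelta) / ((q - 1) * l)),
                \<Theta> Pinf * ((x - y) * (x - qbeta) + qz2)]] :: 'a^2^2) $ i $ j)"

definition Afrak_tilde :: "'a \<Rightarrow> 'a^2^2" where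
  "Afrak_tilde x = (\<chi> i j. (Afrak x - mat 1) $ i $ j / ((q - 1) * x))"

end

context
  fixes \<theta> :: "puncture \<Rightarrow> 'a::field" and l y Z t :: 'a
begin

definition da :: 'a where
  "da = t * (\<theta> P0)^2 / y - (t - 1) * (\<theta> P1)^2 / (y - 1) + t * (t - 1) * (\<theta> Pt)^2 / (y - t)"

definition dc0 :: 'a where
  "dc0 = y / (t * (\<theta> Pinf)^2)
           * ((y - 1) * (y - t) * (y * Z + \<theta> Pinf) * Z + ((y - 1 - t) * (\<theta> Pinf)^2 - da) / 4)^2
         - t * (\<theta> P0)^2 / (4 * y)"

definition dc1 :: 'a where
  "dc1 = (y - 1) / ((1 - t) * (\<theta> Pinf)^2)
           * (y * (y - t) * ((y - 1) * Z + \<theta> Pinf) * Z + ((y + 1 - t) * (\<theta> Pinf)^2 - da) / 4)^2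
         - (1 - t) * (\<theta> P1)^2 / (4 * (y - 1))"

definition A11 :: "'a \<Rightarrow> 'a" where
  "A11 x = (y - x) / (4 * \<theta> Pinf * x * (x - 1) * (x - t))
             * (y * (y - 1) * (y - t) * (2 * Z + \<theta> Pinf / (y - x))^2 - da)
           - \<theta> Pinf / 4 * (1 / x + 1 / (x - 1) + 1 / (x - t) + 1 / (y - x))"

definition Amat :: "'a \<Rightarrow> 'a^2^2" where
  "Amat x = vector
     [vector [A11 x, l * (x - y) / (x * (x - 1) * (x - t))],
      vector [1 / l * (dc0 / x + dc1 / (x - 1) - (dc0 + dc1) / (x - t)), - A11 x]]"

end

section \<open>Rational function fields\<close>

text \<open>
  \<open>R5\<close> is the ring of polynomials over the complex numbers in \<open>x, \<lambda>, y, Z, t\<close>, from the innermost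
  to the outermost variable, so \<open>R5 fract\<close> is the field of rational functions in
  \<open>x, \<lambda>, y, Z, t\<close>. In \<open>R5 poly fract\<close> the additional, outermost variable is \<open>q\<close>.
  The field of rational functions in \<open>q\<close> alone is \<open>complex poly fract\<close>.
\<close>

type_synonym R5 = "complex poly poly poly poly poly"

definition const5 :: "complex \<Rightarrow> R5" where "const5 c = [:[:[:[:[:c:]:]:]:]:]"

definition x5 :: R5 where "x5 = [:[:[:[:[:0, 1:]:]:]:]:]"
definition l5 :: R5 where "l5 = [:[:[:[:0, 1:]:]:]:]"
definition y5 :: R5 where "y5 = [:[:[:0, 1:]:]:]"
definition Z5 :: R5 where "Z5 = [:[:0, 1:]:]"
definition t5 :: R5 where "t5 = [:0, 1:]"

definition emb6 :: "R5 \<Rightarrow> R5 poly fract" where "emb6 p = to_fract [:p:]"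

definition q6 :: "R5 poly fract" where "q6 = to_fract [:0, 1:]"

text \<open>The inclusion of the field of rational functions in \<open>q\<close> into \<open>R5 poly fract\<close>.\<close>

definition of_ratfun_q :: "complex poly fract \<Rightarrow> R5 poly fract" where
  "of_ratfun_q f =
     to_fract (map_poly const5 (fst (quot_of_fract f)))
     / to_fract (map_poly const5 (snd (quot_of_fract f)))"

definition Afrak_tilde_gen ::
  "(puncture \<Rightarrow> complex poly fract) \<Rightarrow> (puncture \<Rightarrow> complex poly fract) \<Rightarrow> R5 poly fract ^ 2 ^ 2" where
  "Afrak_tilde_gen \<Theta> \<Theta>' =
     Afrak_tilde (\<lambda>i. of_ratfun_q (\<Theta> i)) (\<lambda>i. of_ratfun_q (\<Theta>' i))
       (emb6 l5) (emb6 y5) (emb6 Z5) (emb6 t5) q6 (emb6 x5)"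

definition Amat_gen :: "(puncture \<Rightarrow> complex) \<Rightarrow> R5 fract ^ 2 ^ 2" where
  "Amat_gen \<theta> =
     Amat (\<lambda>i. to_fract (const5 (\<theta> i)))
       (to_fract l5) (to_fract y5) (to_fract Z5) (to_fract t5) (to_fract x5)"

section \<open>Polar divisor, restriction to \<open>q = 1\<close>, evaluation\<close>

text \<open>
  \<open>quot_of_fract\<close> yields the coprime numerator and denominator. The polar divisor of a rational
  function is the zero divisor of its reduced denominator, and an irreducible \<open>p\<close> defines a component
  of the polar divisor of a matrix iff it divides the reduced denominator of some entry.
\<close>

definition polar_component :: "R5 poly \<Rightarrow> R5 poly fract ^ 2 ^ 2 \<Rightarrow> bool" where
  "polar_component p M \<longleftrightarrow> (\<exists>i j. p dvd snd (quot_of_fract (M $ i $ j)))"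

text \<open>Only meaningful if \<open>q - 1\<close> does not divide the reduced denominator of \<open>f\<close>.\<close>

definition restrict_q1 :: "R5 poly fract \<Rightarrow> R5 fract" where
  "restrict_q1 f =
     to_fract (poly (fst (quot_of_fract f)) 1) / to_fract (poly (snd (quot_of_fract f)) 1)"

definition eval_ratfun :: "complex poly fract \<Rightarrow> complex \<Rightarrow> complex" where
  "eval_ratfun f z = poly (fst (quot_of_fract f)) z / poly (snd (quot_of_fract f)) z"

end

theory Submission
  imports Defs
begin

text \<open>
  A rational function that is regular along \<open>q = 1\<close> restricts to a given one iff, after specialising the remaining
  variables to generic complex numbers, it converges to it as \<open>q\<close> tends to 1. So condition (1) is about limits
  for generic numbers \<open>x\<close>, \<open>l\<close>, \<open>y\<close>, \<open>Z\<close>, \<open>t\<close>. Multiplied by \<open>x (x - 1) (x - t)\<close>, the entries of both matrices are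
  quadratic in \<open>x\<close>, so convergence at three values of \<open>x\<close> means convergence of the coefficients.

  The leading coefficients determine the expansions of \<open>\<Theta>\<close> and \<open>\<Theta>'\<close> at \<open>Pinf\<close>. The trace at \<open>x = 0\<close> gives
  \<open>\<Theta> P0 + \<Theta>' P0 = 2 + o(q - 1)\<close>. As \<open>det Afrak\<close> is a multiple of \<open>pfrak\<close>, two values of \<open>t\<close> give
  the same for \<open>P1\<close> and \<open>Pt\<close>. Finally \<open>det Amat\<close> has the leading coefficient \<open>- \<theta>\<^sup>2 / 4\<close> at each of the double poles 0, 1, \<open>t\<close>, while
  that of the determinant of \<open>Afrak_tilde\<close> is \<open>(\<Theta> - 1) (\<Theta>' - 1) / (q - 1)\<^sup>2\<close> up to factors tending to 1. So
  \<open>((\<Theta> - \<Theta>') / (q - 1))\<^sup>2\<close> tends to \<open>\<theta>\<^sup>2\<close>, and a rational function whose square converges to \<open>\<theta>\<^sup>2\<close> converges to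
  \<open>\<theta>\<close> or \<open>- \<theta>\<close>.

  Conversely, only the value of the entry \<open>(1,1)\<close> at \<open>x = 0\<close> involves a division by \<open>\<Theta> Pinf - \<Theta>' Pinf\<close>. It is expanded to second
  order; the other entries follow from the trace and from the determinant at \<open>x = 0\<close> and \<open>x = 1\<close>.
\<close>

section \<open>Generic evaluation of rational functions\<close>

text \<open>An iterated quantifier rather than the product filter, since the set of good
  \<open>b\<close> may depend on \<open>a\<close>. For two cofinite filters on the complex numbers
  the pairs with \<open>a \<noteq> b\<close> are large in this sense, although they contain no
  product of two cofinite sets.\<close>

definition nested :: "'a filter \<Rightarrow> 'b filter \<Rightarrow> ('a \<times> 'b) filter" where
  "nested F G = Abs_filter (\<lambda>P. \<forall>\<^sub>F a in F. \<forall>\<^sub>F b in G. P (a, b))"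

lemma eventually_nested: "eventually P (nested F G) \<longleftrightarrow> (\<forall>\<^sub>F a in F. \<forall>\<^sub>F b in G. P (a, b))"
  unfolding nested_def
proof (rule eventually_Abs_filter, unfold_locales)
  fix P Q :: "'a \<times> 'b \<Rightarrow> bool"
  assume "\<forall>\<^sub>F a in F. \<forall>\<^sub>F b in G. P (a, b)" "\<forall>\<^sub>F a in F. \<forall>\<^sub>F b in G. Q (a, b)"
  then show "\<forall>\<^sub>F a in F. \<forall>\<^sub>F b in G. P (a, b) \<and> Q (a, b)"
    by eventually_elim (rule eventually_conj)
next
  fix P Q :: "'a \<times> 'b \<Rightarrow> bool"
  assume "\<forall>x. P x \<longrightarrow> Q x" "\<forall>\<^sub>F a in F. \<forall>\<^sub>F b in G. P (a, b)"
  then show "\<forall>\<^sub>F a in F. \<forall>\<^sub>F b in G. Q (a, b)"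
    by (auto elim!: eventually_mono)
qed simp

lemma nested_neq_bot: "F \<noteq> bot \<Longrightarrow> G \<noteq> bot \<Longrightarrow> nested F G \<noteq> bot"
  by (simp add: trivial_limit_def eventually_nested)

text \<open>The reduced representation makes this a function of \<open>f\<close>. Where the
  denominator evaluates to 0 the value is 0 by convention, so identities between such values can be
  expected at generic points only.\<close>

definition eval_frac :: "('r \<Rightarrow> complex) \<Rightarrow> 'r::{ring_gcd,idom_divide,semiring_gcd_mult_normalize} fract \<Rightarrow> complex"
  where "eval_frac e f = e (fst (quot_of_fract f)) / e (snd (quot_of_fract f))"

text \<open>Every \<open>w\<close> gives a ring homomorphism, and each nonzero element has its own
  negligible set of zeros. No single \<open>w\<close> has to be good for all elements at
  once.\<close>

locale generic_eval =
  fixes ev :: "'w \<Rightarrow> 'r::{ring_gcd,idom_divide,semiring_gcd_mult_normalize} \<Rightarrow> complex"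
    and F :: "'w filter"
  assumes ev_0 [simp]: "ev w 0 = 0"
    and ev_1 [simp]: "ev w 1 = 1"
    and ev_add [simp]: "ev w (a + b) = ev w a + ev w b"
    and ev_mult [simp]: "ev w (a * b) = ev w a * ev w b"
    and ev_nonzero: "a \<noteq> 0 \<Longrightarrow> \<forall>\<^sub>F w in F. ev w a \<noteq> 0"
begin

lemma ev_uminus [simp]: "ev w (- a) = - ev w a"
  using ev_add[of w a "- a"] by (simp add: eq_neg_iff_add_eq_0 add.commute)

lemma ev_sum: "ev w (sum f A) = (\<Sum>i\<in>A. ev w (f i))"
  by (induction A rule: infinite_finite_induct) auto

text \<open>Equality at generic points is compatible with all field operations, because each
  operation brings in only finitely many new denominators that must not vanish.\<close>

definition represents :: "'r fract \<Rightarrow> ('w \<Rightarrow> complex) \<Rightarrow> bool" where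
  "represents f \<phi> \<longleftrightarrow> (\<forall>\<^sub>F w in F. eval_frac (ev w) f = \<phi> w)"

text \<open>Cross-multiplication with the reduced fraction gives an identity in the ring, which
  every homomorphism preserves. Dividing back only requires two denominators not to vanish.\<close>

lemma represents_quotient:
  assumes "d \<noteq> 0"
  shows "represents (to_fract n / to_fract d) (\<lambda>w. ev w n / ev w d)"
proof -
  define f where "f = to_fract n / to_fract d"
  define n' d' where "n' = fst (quot_of_fract f)" and "d' = snd (quot_of_fract f)"
  have d': "d' \<noteq> 0" by (simp add: d'_def)
  have "to_fract n' / to_fract d' = f"
    by (simp add: n'_def d'_def flip: Fract_conv_to_fract)
  then have "to_fract (n' * d) = to_fract (n * d')"
    using assms d' by (simp add: f_def frac_eq_eq)
  then have "n' * d = n * d'" by (simp only: to_fract_eq_iff)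
  then have eq: "ev w n' * ev w d = ev w n * ev w d'" for w by (metis ev_mult)
  show ?thesis
    using ev_nonzero[OF assms] ev_nonzero[OF d'] unfolding represents_def f_def[symmetric]
    by eventually_elim (use eq in \<open>simp add: eval_frac_def frac_eq_eq flip: n'_def d'_def\<close>)
qed

lemma quotient_cases:
  obtains d n where "d \<noteq> 0" "f = to_fract n / to_fract d"
    "\<And>w. eval_frac (ev w) f = ev w n / ev w d"
proof
  show "snd (quot_of_fract f) \<noteq> 0" by simp
  show "f = to_fract (fst (quot_of_fract f)) / to_fract (snd (quot_of_fract f))"
    by (simp flip: Fract_conv_to_fract)
qed (simp add: eval_frac_def)

lemma represents_eval: "represents f (\<lambda>w. eval_frac (ev w) f)"
  by (simp add: represents_def)

lemma represents_to_fract: "represents (to_fract a) (\<lambda>w. ev w a)"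
  using represents_quotient[of 1 a] by simp

lemma represents_0: "represents 0 (\<lambda>w. 0)"
  using represents_to_fract[of 0] by simp

lemma represents_1: "represents 1 (\<lambda>w. 1)"
  using represents_to_fract[of 1] by simp

lemma represents_add:
  assumes "represents f \<phi>" "represents g \<psi>"
  shows "represents (f + g) (\<lambda>w. \<phi> w + \<psi> w)"
proof -
  obtain n d where f: "d \<noteq> 0" "f = to_fract n / to_fract d" "\<And>w. eval_frac (ev w) f = ev w n / ev w d"
    using quotient_cases[of "f"] by metis
  obtain m e where g: "e \<noteq> 0" "g = to_fract m / to_fract e" "\<And>w. eval_frac (ev w) g = ev w m / ev w e"
    using quotient_cases[of "g"] by metis
  have "f + g = to_fract (n * e + m * d) / to_fract (d * e)"
    using f g by (simp add: field_simps)
  then have "represents (f + g) (\<lambda>w. ev w (n * e + m * d) / ev w (d * e))"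
    using represents_quotient[of "d * e" "n * e + m * d"] f(1) g(1) by simp
  with assms ev_nonzero[OF f(1)] ev_nonzero[OF g(1)] show ?thesis
    unfolding represents_def f(3) g(3)
  proof eventually_elim
    case (elim w)
    have "\<phi> w + \<psi> w = ev w n / ev w d + ev w m / ev w e" by (simp add: elim)
    also have "\<dots> = ev w (n * e + m * d) / ev w (d * e)" using elim by (simp add: field_simps)
    finally show ?case using elim by simp
  qed
qed

lemma represents_uminus:
  assumes "represents f \<phi>" shows "represents (- f) (\<lambda>w. - \<phi> w)"
proof -
  obtain n d where f: "d \<noteq> 0" "f = to_fract n / to_fract d" "\<And>w. eval_frac (ev w) f = ev w n / ev w d"
    using quotient_cases[of "f"] by metis
  have "represents (- f) (\<lambda>w. ev w (- n) / ev w d)"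
    using represents_quotient[of d "- n"] f by simp
  with assms show ?thesis unfolding represents_def f(3) by eventually_elim auto
qed

lemma represents_diff:
  "represents f \<phi> \<Longrightarrow> represents g \<psi> \<Longrightarrow> represents (f - g) (\<lambda>w. \<phi> w - \<psi> w)"
  using represents_add[of f \<phi> "- g" "\<lambda>w. - \<psi> w"] represents_uminus[of g \<psi>] by simp

lemma represents_mult:
  assumes "represents f \<phi>" "represents g \<psi>"
  shows "represents (f * g) (\<lambda>w. \<phi> w * \<psi> w)"
proof -
  obtain n d where f: "d \<noteq> 0" "f = to_fract n / to_fract d" "\<And>w. eval_frac (ev w) f = ev w n / ev w d"
    using quotient_cases[of "f"] by metis
  obtain m e where g: "e \<noteq> 0" "g = to_fract m / to_fract e" "\<And>w. eval_frac (ev w) g = ev w m / ev w e"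
    using quotient_cases[of "g"] by metis
  have "represents (f * g) (\<lambda>w. ev w (n * m) / ev w (d * e))"
    using represents_quotient[of "d * e" "n * m"] f g by simp
  with assms show ?thesis unfolding represents_def f(3) g(3)
    by eventually_elim (metis ev_mult times_divide_times_eq)
qed

lemma represents_inverse:
  assumes "represents f \<phi>"
  shows "represents (inverse f) (\<lambda>w. inverse (\<phi> w))"
proof -
  obtain n d where f: "d \<noteq> 0" "f = to_fract n / to_fract d" "\<And>w. eval_frac (ev w) f = ev w n / ev w d"
    using quotient_cases[of "f"] by metis
  show ?thesis
  proof (cases "n = 0")
    case True
    \<comment> \<open>The zero case fits because \<open>inverse 0 = 0\<close> both in the field of
      fractions and in the complex numbers.\<close>
    then have "f = 0" using f by simp
    then show ?thesis using assms by (simp add: represents_def eval_frac_def)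
  next
    case False
    have "represents (inverse f) (\<lambda>w. ev w d / ev w n)"
      using represents_quotient[of n d] f False by simp
    with assms show ?thesis unfolding represents_def f(3) by eventually_elim (metis inverse_divide)
  qed
qed

lemma represents_divide:
  "represents f \<phi> \<Longrightarrow> represents g \<psi> \<Longrightarrow> represents (f / g) (\<lambda>w. \<phi> w / \<psi> w)"
  unfolding divide_inverse by (intro represents_mult represents_inverse)

lemma represents_power: "represents f \<phi> \<Longrightarrow> represents (f ^ k) (\<lambda>w. \<phi> w ^ k)"
  by (induction k) (simp_all add: represents_1 represents_mult)

lemma represents_of_nat: "represents (of_nat k) (\<lambda>w. of_nat k)"
  by (induction k) (simp_all add: represents_0 represents_1 represents_add)

lemma represents_numeral: "represents (numeral k) (\<lambda>w. numeral k)"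
  using represents_of_nat[of "numeral k"] by simp

lemmas represents_arith = represents_0 represents_1 represents_numeral represents_add represents_uminus
  represents_diff represents_mult represents_divide represents_power

text \<open>Identity principle: a nonzero numerator of \<open>f - g\<close> would not vanish at
  generic points, and such points exist because \<open>F\<close> is not \<open>bot\<close>.\<close>

lemma represents_eq:
  assumes "F \<noteq> bot" "represents f \<phi>" "represents g \<phi>" shows "f = g"
proof (rule ccontr)
  assume "f \<noteq> g"
  have "represents (f - g) (\<lambda>w. \<phi> w - \<phi> w)" by (intro represents_diff assms)
  then have *: "\<forall>\<^sub>F w in F. eval_frac (ev w) (f - g) = 0" by (simp add: represents_def)
  obtain n d where fg: "d \<noteq> 0" "f - g = to_fract n / to_fract d"
    "\<And>w. eval_frac (ev w) (f - g) = ev w n / ev w d"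
    using quotient_cases[of "f - g"] by metis
  from fg \<open>f \<noteq> g\<close> have "n \<noteq> 0" by auto
  have "\<forall>\<^sub>F w in F. False"
    using *  ev_nonzero[OF \<open>n \<noteq> 0\<close>] ev_nonzero[OF fg(1)] by eventually_elim (simp add: fg(3))
  then show False using assms(1) by (simp add: trivial_limit_def)
qed

end

section \<open>Adjoining one more variable and restricting it to 1\<close>

abbreviation eval_outer :: "('w \<Rightarrow> 'r::zero \<Rightarrow> complex) \<Rightarrow> 'w \<times> complex \<Rightarrow> 'r poly \<Rightarrow> complex" where
  "eval_outer ev \<equiv> \<lambda>(w, c) p. poly (map_poly (ev w) p) c"

context generic_eval
begin

lemma map_poly_ev_add: "map_poly (ev w) (a + b) = map_poly (ev w) a + map_poly (ev w) b"
  by (intro poly_eqI) (simp add: coeff_map_poly)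

lemma map_poly_ev_mult: "map_poly (ev w) (a * b) = map_poly (ev w) a * map_poly (ev w) b"
  by (intro poly_eqI) (simp add: coeff_map_poly coeff_mult ev_sum)

text \<open>It is enough that the leading coefficient of \<open>p\<close> survives the
  evaluation.\<close>

lemma eventually_map_poly_ev_nonzero:
  assumes "p \<noteq> 0" shows "\<forall>\<^sub>F w in F. map_poly (ev w) p \<noteq> 0"
proof -
  have "\<forall>\<^sub>F w in F. ev w (lead_coeff p) \<noteq> 0" using assms by (intro ev_nonzero) simp
  then show ?thesis
    by eventually_elim (metis coeff_0 coeff_map_poly ev_0)
qed

end

lemma eventually_poly_nonzero:
  fixes p :: "complex poly"
  assumes "p \<noteq> 0"
  shows "\<forall>\<^sub>F c in cofinite. poly p c \<noteq> 0" "\<forall>\<^sub>F c in at a. poly p c \<noteq> 0"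
proof -
  show *: "\<forall>\<^sub>F c in cofinite. poly p c \<noteq> 0"
    using poly_roots_finite[OF assms] by (simp add: eventually_cofinite)
  have "closed ({c. poly p c = 0} - {a})"
    using poly_roots_finite[OF assms] by (intro finite_imp_closed) simp
  then have "\<forall>\<^sub>F c in at a. c \<in> - ({c. poly p c = 0} - {a})"
    by (intro eventually_at_in_open') (use open_Compl in blast)+
  moreover have "\<forall>\<^sub>F c in at a. c \<noteq> a" by (simp add: eventually_neq_at_within)
  ultimately show "\<forall>\<^sub>F c in at a. poly p c \<noteq> 0" by eventually_elim auto
qed

text \<open>For generic \<open>w\<close> the coefficients of a nonzero polynomial specialise to
  those of a nonzero polynomial in one variable, and \<open>G\<close> only has to avoid its roots.
  Iteration handles any number of variables.\<close>

lemma generic_eval_outer: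
  fixes ev :: "'w \<Rightarrow> 'r::{factorial_ring_gcd,semiring_gcd_mult_normalize} \<Rightarrow> complex"
  assumes "generic_eval ev F" and G: "\<And>p :: complex poly. p \<noteq> 0 \<Longrightarrow> \<forall>\<^sub>F c in G. poly p c \<noteq> 0"
  shows "generic_eval (eval_outer ev) (nested F G)"
proof -
  interpret generic_eval ev F by fact
  show ?thesis
  proof
    fix p :: "'r poly" assume "p \<noteq> 0"
    then show "\<forall>\<^sub>F w in nested F G. eval_outer ev w p \<noteq> 0"
      using eventually_map_poly_ev_nonzero[of p] unfolding eventually_nested
      by (auto elim!: eventually_mono intro: G)
  qed (auto simp: map_poly_ev_add map_poly_ev_mult)
qed

lemma generic_eval_poly:
  assumes "\<And>p :: complex poly. p \<noteq> 0 \<Longrightarrow> \<forall>\<^sub>F c in G. poly p c \<noteq> 0"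
  shows "generic_eval (\<lambda>c p. poly p c) G"
  by standard (use assms in auto)

text \<open>At a fixed generic \<open>w\<close>, \<open>f\<close> becomes a quotient of two
  polynomials in \<open>q\<close>, whose values at 1 are the specialised restrictions of numerator
  and denominator. A pole along \<open>q = 1\<close> cannot hide behind finite limits, since the
  reduced numerator and denominator do not both vanish there.\<close>

lemma restriction_iff_generic_limit:
  fixes ev :: "'w \<Rightarrow> 'r::{factorial_ring_gcd,semiring_gcd_mult_normalize} \<Rightarrow> complex"
    and f :: "'r poly fract" and a :: "'r fract"
  assumes gen: "generic_eval ev F" and "F \<noteq> bot"
  shows "\<not> [:- 1, 1:] dvd snd (quot_of_fract f) \<and>
         to_fract (poly (fst (quot_of_fract f)) 1) / to_fract (poly (snd (quot_of_fract f)) 1) = a \<longleftrightarrow>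
         (\<forall>\<^sub>F w in F. ((\<lambda>q. eval_frac (eval_outer ev (w, q)) f) \<longlongrightarrow> eval_frac (ev w) a) (at 1))"
    (is "_ \<and> ?r = a \<longleftrightarrow> ?lim")
proof -
  interpret generic_eval ev F by fact
  define n d where "n = fst (quot_of_fract f)" and "d = snd (quot_of_fract f)"
  have f: "eval_frac (eval_outer ev (w, q)) f = poly (map_poly (ev w) n) q / poly (map_poly (ev w) d) q" for w q
    by (simp add: eval_frac_def n_def d_def)
  have poly1: "poly (map_poly (ev w) p) 1 = ev w (poly p 1)" for w and p :: "'r poly"
    by (induction p) (simp_all add: map_poly_pCons)
  have dvd: "[:- 1, 1:] dvd p \<longleftrightarrow> poly p 1 = 0" for p :: "'r poly"
    by (simp add: poly_eq_0_iff_dvd)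
  have lim: "((\<lambda>q. poly (map_poly (ev w) p) q) \<longlongrightarrow> ev w (poly p 1)) (at 1)" for w and p :: "'r poly"
    unfolding poly1[symmetric] by (intro tendsto_intros)
  have gen_ne: "\<forall>\<^sub>F q in at 1. poly (map_poly (ev w) d) q \<noteq> 0" if "map_poly (ev w) d \<noteq> 0" for w
    using eventually_poly_nonzero(2)[OF that] .
  have d0: "d \<noteq> 0" by (simp add: d_def)
  \<comment> \<open>After multiplication by the denominator the statement makes sense before
    \<open>poly d 1\<close> is known to be nonzero.\<close>
  have num: "\<forall>\<^sub>F w in F. ev w (poly n 1) = eval_frac (ev w) a * ev w (poly d 1)" if ?lim
    using that eventually_map_poly_ev_nonzero[OF d0]
  proof eventually_elim
    case (elim w)
    have "\<forall>\<^sub>F q in at 1. eval_frac (eval_outer ev (w, q)) f * poly (map_poly (ev w) d) q = poly (map_poly (ev w) n) q"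
      using gen_ne[OF elim(2)] by eventually_elim (simp only: f nonzero_eq_divide_eq, simp)
    then have "((\<lambda>q. poly (map_poly (ev w) n) q) \<longlongrightarrow> eval_frac (ev w) a * ev w (poly d 1)) (at 1)"
      by (rule Lim_transform_eventually[rotated]) (intro tendsto_mult elim(1) lim)
    with lim[of w n] show ?case using LIM_unique by blast
  qed
  have "poly d 1 \<noteq> 0 \<and> to_fract (poly n 1) / to_fract (poly d 1) = a \<longleftrightarrow> ?lim"
  proof (intro iffI conjI)
    assume *: "poly d 1 \<noteq> 0 \<and> to_fract (poly n 1) / to_fract (poly d 1) = a"
    then have d1: "poly d 1 \<noteq> 0" and a: "a = to_fract (poly n 1) / to_fract (poly d 1)" by auto
    show ?lim
      using represents_quotient[OF d1, of "poly n 1"] ev_nonzero[OF d1] unfolding represents_def a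
      by eventually_elim (simp only: f, intro tendsto_divide lim)
  next
    assume l: ?lim
    show d1: "poly d 1 \<noteq> 0"
    proof
      assume d1: "poly d 1 = 0"
      have "poly n 1 = 0"
      proof (rule ccontr)
        assume "poly n 1 \<noteq> 0"
        from ev_nonzero[OF this] num[OF l] have "\<forall>\<^sub>F w in F. False"
          by eventually_elim (simp add: d1)
        with \<open>F \<noteq> bot\<close> show False by (simp add: trivial_limit_def)
      qed
      \<comment> \<open>Numerator and denominator would both be divisible by \<open>q - 1\<close>,
        against coprimality.\<close>
      with d1 have "is_unit [:- 1, 1 :: 'r:]"
        using coprime_quot_of_fract[of f] dvd unfolding n_def d_def by (meson coprime_common_divisor)
      then show False by (simp add: is_unit_poly_iff)
    qed
    show "to_fract (poly n 1) / to_fract (poly d 1) = a"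
    proof (rule represents_eq[OF \<open>F \<noteq> bot\<close>])
      show "represents a (\<lambda>w. eval_frac (ev w) a)" by (rule represents_eval)
      show "represents (to_fract (poly n 1) / to_fract (poly d 1)) (\<lambda>w. eval_frac (ev w) a)"
        using represents_quotient[OF d1, of "poly n 1"] ev_nonzero[OF d1] num[OF l] unfolding represents_def
        by eventually_elim simp
    qed
  qed
  then show ?thesis by (simp add: dvd n_def d_def)
qed

section \<open>Determinant and trace\<close>

text \<open>Of the coefficients only the sum \<open>s\<close> of the four roots has to be known
  explicitly. The second equation serves to remove the denominators of the difference
  quotients.\<close>

lemma pfrak_quartic:
  fixes \<Theta> \<Theta>' :: "puncture \<Rightarrow> 'a::field" and t :: 'a
  defines "s \<equiv> t * (\<Theta> Pt + \<Theta>' Pt) + \<Theta> P1 + \<Theta>' P1"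
  shows "\<exists>p2 p1 p0. \<forall>u. pfrak \<Theta> \<Theta>' t u = u^4 - s * u^3 + p2 * u^2 + p1 * u + p0 \<and>
    pfrak \<Theta> \<Theta>' t u - pfrak \<Theta> \<Theta>' t y = (u - y) * ((u^3 + u^2*y + u*y^2 + y^3) -
       s * (u^2 + u*y + y^2) + p2 * (u + y) + p1)"
proof -
  let ?a = "t * \<Theta> Pt" and ?b = "t * \<Theta>' Pt" and ?c = "\<Theta> P1" and ?d = "\<Theta>' P1"
  define p2 p1 p0 where "p2 = ?a*?b+?a*?c+?a*?d+?b*?c+?b*?d+?c*?d"
    and "p1 = - (?a*?b*?c+?a*?b*?d+?a*?c*?d+?b*?c*?d)" and "p0 = ?a*?b*?c*?d"
  have p: "pfrak \<Theta> \<Theta>' t u = u^4 - s * u^3 + p2 * u^2 + p1 * u + p0" for u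
    unfolding pfrak_def s_def p2_def p1_def p0_def by algebra
  moreover have "pfrak \<Theta> \<Theta>' t u - pfrak \<Theta> \<Theta>' t y = (u - y) * ((u^3 + u^2*y + u*y^2 + y^3) -
       s * (u^2 + u*y + y^2) + p2 * (u + y) + p1)" for u
    unfolding p by algebra
  ultimately show ?thesis by blast
qed

text \<open>\<open>qsum\<close> is minus the divided difference of \<open>pfrak\<close> at the nodes
  0, 1, \<open>t\<close>, \<open>y\<close>. For a monic quartic whose roots have sum
  \<open>s\<close> this divided difference is \<open>0 + 1 + t + y - s\<close>.\<close>

lemma qsum_eq:
  fixes \<Theta> \<Theta>' :: "puncture \<Rightarrow> 'a::field"
  assumes "y \<noteq> 0" "y \<noteq> 1" "y \<noteq> t" "t \<noteq> 0" "t \<noteq> 1"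
  shows "qsum \<Theta> \<Theta>' y t = t * (\<Theta> Pt + \<Theta>' Pt) + \<Theta> P1 + \<Theta>' P1 - 1 - t - y"
proof -
  define s where "s = t * (\<Theta> Pt + \<Theta>' Pt) + \<Theta> P1 + \<Theta>' P1"
  obtain p2 p1 p0 where p:
    "\<And>u. pfrak \<Theta> \<Theta>' t u - pfrak \<Theta> \<Theta>' t y = (u - y) * ((u^3 + u^2*y + u*y^2 + y^3) -
       s * (u^2 + u*y + y^2) + p2 * (u + y) + p1)"
    using pfrak_quartic[where y = y] unfolding s_def by metis
  have 0: "(pfrak \<Theta> \<Theta>' t 0 - pfrak \<Theta> \<Theta>' t y) / (t * y) = - (y^3 - s * y^2 + p2 * y + p1) / t"
    unfolding p using assms by (simp add: divide_simps)
  have 1: "(pfrak \<Theta> \<Theta>' t t - pfrak \<Theta> \<Theta>' t y) / (t * (t - 1) * (y - t)) =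
    - ((t^3 + t^2*y + t*y^2 + y^3) - s * (t^2 + t*y + y^2) + p2 * (t + y) + p1) / (t * (t - 1))"
    unfolding p using assms by (simp add: divide_simps) (simp add: algebra_simps)
  have 2: "(pfrak \<Theta> \<Theta>' t 1 - pfrak \<Theta> \<Theta>' t y) / ((t - 1) * (y - 1)) =
    - ((1 + y + y^2 + y^3) - s * (1 + y + y^2) + p2 * (1 + y) + p1) / (t - 1)"
    unfolding p using assms by (simp add: divide_simps) (simp add: algebra_simps)
  have "qsum \<Theta> \<Theta>' y t = s - 1 - t - y"
  proof -
    define E0 E1 E2 where "E0 = y^3 - s * y^2 + p2 * y + p1"
      and "E1 = (t^3 + t^2*y + t*y^2 + y^3) - s * (t^2 + t*y + y^2) + p2 * (t + y) + p1"
      and "E2 = (1 + y + y^2 + y^3) - s * (1 + y + y^2) + p2 * (1 + y) + p1"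
    have E: "- ((t - 1) * E0) - E1 + t * E2 = t * (t - 1) * (s - 1 - t - y)"
      unfolding E0_def E1_def E2_def by algebra
    have "qsum \<Theta> \<Theta>' y t = - E0 / t + - E1 / (t * (t - 1)) - - E2 / (t - 1)"
      unfolding qsum_def 0 1 2 E0_def E1_def E2_def ..
    also have "\<dots> = (- ((t - 1) * E0) - E1 + t * E2) / (t * (t - 1))"
      using assms by (simp add: divide_simps)
    also have "\<dots> = s - 1 - t - y" unfolding E using assms by simp
    finally show ?thesis .
  qed
  then show ?thesis by (simp add: s_def)
qed

text \<open>The quotients by \<open>\<Theta> Pinf - \<Theta>' Pinf\<close> cancel in this sum. Its
  value makes the cubic coefficient of the determinant agree with that of
  \<open>pfrak\<close>.\<close>

lemma qalpha_qbeta_sum: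
  fixes \<Theta> \<Theta>' :: "puncture \<Rightarrow> 'a::field"
  assumes "y \<noteq> 0" "y \<noteq> 1" "y \<noteq> t" "t \<noteq> 0" "t \<noteq> 1"
  shows "qalpha \<Theta> \<Theta>' y Z t q + qbeta \<Theta> \<Theta>' y Z t q = t * (\<Theta> Pt + \<Theta>' Pt) + \<Theta> P1 + \<Theta>' P1 - 2 * y"
  unfolding qbeta_def qsum_eq[OF assms] by (simp add: algebra_simps)

lemma qz_mult:
  fixes \<Theta> \<Theta>' :: "puncture \<Rightarrow> 'a::field"
  assumes "y \<noteq> 1" "y \<noteq> t" "\<Theta>' Pinf \<noteq> 0" "1 + (q - 1) * y * Z \<noteq> 0"
  shows "qz1 \<Theta>' y Z t q * qz2 \<Theta> \<Theta>' y Z t q = pfrak \<Theta> \<Theta>' t y"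
    "\<Theta>' Pinf * qz1 \<Theta>' y Z t q = (y - 1) * (y - t) * (1 + (q - 1) * y * Z)"
    "\<Theta> Pinf * qz2 \<Theta> \<Theta>' y Z t q = \<Theta> Pinf * \<Theta>' Pinf * pfrak \<Theta> \<Theta>' t y / ((y - 1) * (y - t) * (1 + (q - 1) * y * Z))"
  using assms by (simp_all add: qz1_def qz2_def)

text \<open>Up to the factor \<open>\<Theta> Pinf * \<Theta>' Pinf / ((x - 1) * (x - t))^2\<close>
  the left side is the determinant of \<open>Afrak\<close>. Both sides are monic quartics in
  \<open>x\<close>: the sum of \<open>qalpha\<close> and \<open>qbeta\<close> matches the cubic
  coefficients, \<open>qgamma\<close> the quadratic ones, \<open>qdelta\<close> the values at 0, and
  \<open>qz1 * qz2\<close> the values at \<open>y\<close>.\<close>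

lemma Afrak_det_aux:
  fixes \<Theta> \<Theta>' :: "puncture \<Rightarrow> 'a::field"
  assumes nz: "y \<noteq> 0" "y \<noteq> 1" "y \<noteq> t" "t \<noteq> 0" "t \<noteq> 1" and "\<Theta>' Pinf \<noteq> 0" "1 + (q - 1) * y * Z \<noteq> 0"
  shows "((x - y) * (x - qalpha \<Theta> \<Theta>' y Z t q) + qz1 \<Theta>' y Z t q)
       * ((x - y) * (x - qbeta \<Theta> \<Theta>' y Z t q) + qz2 \<Theta> \<Theta>' y Z t q)
       - (x - y) * (qgamma \<Theta> \<Theta>' y Z t q * x + qdelta \<Theta> \<Theta>' y Z t q) = pfrak \<Theta> \<Theta>' t x"
proof -
  define a b z1 z2 where "a = qalpha \<Theta> \<Theta>' y Z t q" and "b = qbeta \<Theta> \<Theta>' y Z t q"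
    and "z1 = qz1 \<Theta>' y Z t q" and "z2 = qz2 \<Theta> \<Theta>' y Z t q"
  define g d where "g = qgamma \<Theta> \<Theta>' y Z t q" and "d = qdelta \<Theta> \<Theta>' y Z t q"
  define s where "s = t * (\<Theta> Pt + \<Theta>' Pt) + \<Theta> P1 + \<Theta>' P1"
  obtain p2 p1 p0 where p: "\<And>u. pfrak \<Theta> \<Theta>' t u = u^4 - s * u^3 + p2 * u^2 + p1 * u + p0"
    and pd: "\<And>u. pfrak \<Theta> \<Theta>' t u - pfrak \<Theta> \<Theta>' t y = (u - y) * ((u^3 + u^2*y + u*y^2 + y^3) -
       s * (u^2 + u*y + y^2) + p2 * (u + y) + p1)"
    using pfrak_quartic[where y = y] unfolding s_def by metis
  have ab: "a + b = s - 2 * y"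
    using qalpha_qbeta_sum[OF nz, of \<Theta> \<Theta>'] by (simp add: a_def b_def s_def)
  have zz: "z1 * z2 = y^4 - s * y^3 + p2 * y^2 + p1 * y + p0"
    using qz_mult(1)[of y t \<Theta>' q Z \<Theta>] assms p by (simp add: z1_def z2_def)
  have q0: "(pfrak \<Theta> \<Theta>' t 0 - pfrak \<Theta> \<Theta>' t y) / y = - (y^3 - s * y^2 + p2 * y + p1)"
    unfolding pd using nz by (simp add: divide_simps)
  have q1: "(pfrak \<Theta> \<Theta>' t 1 - pfrak \<Theta> \<Theta>' t y) / (y - 1) =
      - ((1 + y + y^2 + y^3) - s * (1 + y + y^2) + p2 * (1 + y) + p1)"
    unfolding pd using nz by (simp add: divide_simps) (simp add: algebra_simps)
  have g: "g = z1 + z2 + a * b + (a - 1 + b) * (y - 1) + (y^3 - s * y^2 + p2 * y + p1)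
     - ((1 + y + y^2 + y^3) - s * (1 + y + y^2) + p2 * (1 + y) + p1)"
    unfolding g_def qgamma_def q0 q1 a_def b_def z1_def z2_def by simp
  have d: "d * y = p0 - (a * y + z1) * (b * y + z2)"
    using nz unfolding d_def qdelta_def p a_def b_def z1_def z2_def by simp
  have s: "s = a + b + 2 * y" using ab by simp
  have p2: "p2 = z1 + z2 + a * b + (a + b - 1) * (y - 1) - 1 - y - y^2 + s * (1 + y) - g"
    unfolding g by algebra
  have p0: "p0 = d * y + (a * y + z1) * (b * y + z2)" unfolding d by simp
  \<comment> \<open>The values at \<open>y\<close> agree by \<open>zz\<close>. As the constant terms
    agree too, the difference is divisible by \<open>y\<close>, and the cofactor determines
    \<open>p1\<close>.\<close>
  have "y * (y^3 - s * y^2 + p2 * y + p1 + d + a * b * y + a * z2 + b * z1) = 0"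
    using zz unfolding p0 by algebra
  then have "y^3 - s * y^2 + p2 * y + p1 + d + a * b * y + a * z2 + b * z1 = 0"
    using nz by simp
  then have p1: "p1 = - (y^3 - s * y^2 + p2 * y + d + a * b * y + a * z2 + b * z1)"
    by algebra
  have "((x - y) * (x - a) + z1) * ((x - y) * (x - b) + z2) - (x - y) * (g * x + d)
      = x^4 - s * x^3 + p2 * x^2 + p1 * x + p0"
    unfolding p1 p0 p2 s by algebra
  then show ?thesis unfolding p a_def b_def z1_def z2_def g_def d_def .
qed

text \<open>
  \<open>n11\<close>, \<open>n22\<close>, \<open>n21\<close> are the entries of \<open>Afrak_tilde\<close> multiplied by \<open>x (x - 1) (x - t)\<close>, which makes
  them polynomials of degree at most 2 in \<open>x\<close>; the entry \<open>(1,2)\<close> becomes \<open>l (x - y)\<close>. Likewise \<open>m11\<close>, \<open>m21\<close>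
  below come from \<open>Amat\<close>, whose entry \<open>(2,2)\<close> is minus the entry \<open>(1,1)\<close>.
\<close>

definition n11 :: "(puncture \<Rightarrow> 'a::field) \<Rightarrow> (puncture \<Rightarrow> 'a) \<Rightarrow> 'a \<Rightarrow> 'a \<Rightarrow> 'a \<Rightarrow> 'a \<Rightarrow> 'a \<Rightarrow> 'a" where
  "n11 \<Theta> \<Theta>' y Z t q x = (\<Theta>' Pinf * ((x - y) * (x - qalpha \<Theta> \<Theta>' y Z t q) + qz1 \<Theta>' y Z t q) - (x - 1) * (x - t)) / (q - 1)"

definition n22 :: "(puncture \<Rightarrow> 'a::field) \<Rightarrow> (puncture \<Rightarrow> 'a) \<Rightarrow> 'a \<Rightarrow> 'a \<Rightarrow> 'a \<Rightarrow> 'a \<Rightarrow> 'a \<Rightarrow> 'a" where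
  "n22 \<Theta> \<Theta>' y Z t q x = (\<Theta> Pinf * ((x - y) * (x - qbeta \<Theta> \<Theta>' y Z t q) + qz2 \<Theta> \<Theta>' y Z t q) - (x - 1) * (x - t)) / (q - 1)"

definition n21 :: "(puncture \<Rightarrow> 'a::field) \<Rightarrow> (puncture \<Rightarrow> 'a) \<Rightarrow> 'a \<Rightarrow> 'a \<Rightarrow> 'a \<Rightarrow> 'a \<Rightarrow> 'a \<Rightarrow> 'a \<Rightarrow> 'a" where
  "n21 \<Theta> \<Theta>' l y Z t q x = \<Theta> Pinf * \<Theta>' Pinf * (qgamma \<Theta> \<Theta>' y Z t q * x + qdelta \<Theta> \<Theta>' y Z t q) / ((q - 1)^2 * l)"

lemma Afrak_tilde_entries:
  fixes x :: "'a::field"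
  assumes "x \<noteq> 0" "x \<noteq> 1" "x \<noteq> t" "q \<noteq> 1"
  shows "Afrak_tilde \<Theta> \<Theta>' l y Z t q x $ 1 $ 1 = n11 \<Theta> \<Theta>' y Z t q x / (x * (x - 1) * (x - t))"
    "Afrak_tilde \<Theta> \<Theta>' l y Z t q x $ 1 $ 2 = l * (x - y) / (x * (x - 1) * (x - t))"
    "Afrak_tilde \<Theta> \<Theta>' l y Z t q x $ 2 $ 1 = n21 \<Theta> \<Theta>' l y Z t q x / (x * (x - 1) * (x - t))"
    "Afrak_tilde \<Theta> \<Theta>' l y Z t q x $ 2 $ 2 = n22 \<Theta> \<Theta>' y Z t q x / (x * (x - 1) * (x - t))"
  using assms
  by (simp_all add: Afrak_tilde_def Afrak_def mat_def vector_2 n11_def n21_def n22_def power2_eq_square divide_simps)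

text \<open>For a 2 by 2 matrix \<open>M\<close> the determinant of \<open>1 + c M\<close> is
  \<open>1 + c tr M + c^2 det M\<close>. Here \<open>M\<close> is \<open>Afrak_tilde\<close> and
  \<open>c = (q - 1) * x\<close>, so that \<open>1 + c M\<close> is \<open>Afrak\<close>, with
  determinant known from \<open>Afrak_det_aux\<close>.\<close>

lemma n_det:
  fixes y :: "'a::field"
  assumes nz: "y \<noteq> 0" "y \<noteq> 1" "y \<noteq> t" "t \<noteq> 0" "t \<noteq> 1" and "\<Theta>' Pinf \<noteq> 0" "1 + (q - 1) * y * Z \<noteq> 0"
    and q: "q \<noteq> 1" and "l \<noteq> 0"
  shows "n11 \<Theta> \<Theta>' y Z t q x * n22 \<Theta> \<Theta>' y Z t q x - l * (x - y) * n21 \<Theta> \<Theta>' l y Z t q x =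
    (\<Theta> Pinf * \<Theta>' Pinf * pfrak \<Theta> \<Theta>' t x - ((x - 1) * (x - t))^2) / (q - 1)^2
    - (x - 1) * (x - t) * (n11 \<Theta> \<Theta>' y Z t q x + n22 \<Theta> \<Theta>' y Z t q x) / (q - 1)"
proof -
  define f g h where "f = (x - y) * (x - qalpha \<Theta> \<Theta>' y Z t q) + qz1 \<Theta>' y Z t q"
    and "g = (x - y) * (x - qbeta \<Theta> \<Theta>' y Z t q) + qz2 \<Theta> \<Theta>' y Z t q"
    and "h = qgamma \<Theta> \<Theta>' y Z t q * x + qdelta \<Theta> \<Theta>' y Z t q"
  have p: "pfrak \<Theta> \<Theta>' t x = f * g - (x - y) * h"
    using Afrak_det_aux[where x = x and \<Theta> = \<Theta> and \<Theta>' = \<Theta>' and q = q and Z = Z and y = y and t = t] assms by (simp add: f_def g_def h_def)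
  show ?thesis
    unfolding n11_def n22_def n21_def f_def[symmetric] g_def[symmetric] h_def[symmetric] p
    using q \<open>l \<noteq> 0\<close> by (simp add: divide_simps) algebra
qed

text \<open>\<open>qalpha\<close> is defined as the solution of this equation. Once
  \<open>qbeta\<close> is eliminated, the equation is linear in \<open>qalpha\<close> with a
  coefficient proportional to \<open>(\<Theta> Pinf - \<Theta>' Pinf) * y\<close>.\<close>

lemma n_trace_0:
  fixes y :: "'a::field"
  assumes nz: "y \<noteq> 0" "y \<noteq> 1" "y \<noteq> t" "t \<noteq> 0" "t \<noteq> 1"
    and T: "\<Theta> Pinf \<noteq> \<Theta>' Pinf" and q: "q \<noteq> 1"
  shows "n11 \<Theta> \<Theta>' y Z t q 0 + n22 \<Theta> \<Theta>' y Z t q 0 = t * (\<Theta> P0 + \<Theta>' P0 - 2) / (q - 1)"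
proof -
  define z1 z2 a b where "z1 = qz1 \<Theta>' y Z t q" and "z2 = qz2 \<Theta> \<Theta>' y Z t q"
    and "a = qalpha \<Theta> \<Theta>' y Z t q" and "b = qbeta \<Theta> \<Theta>' y Z t q"
  have a: "a = - ((t * (\<Theta> P0 + \<Theta>' P0) - (\<Theta>' Pinf * z1 + \<Theta> Pinf * z2)) / ((\<Theta> Pinf - \<Theta>' Pinf) * y))
     + \<Theta> Pinf / (\<Theta> Pinf - \<Theta>' Pinf) * (1 + t - y + qsum \<Theta> \<Theta>' y t)"
    unfolding a_def z1_def z2_def qalpha_def ..
  then have a': "a * ((\<Theta> Pinf - \<Theta>' Pinf) * y) = - (t * (\<Theta> P0 + \<Theta>' P0) - (\<Theta>' Pinf * z1 + \<Theta> Pinf * z2))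
     + \<Theta> Pinf * y * (1 + t - y + qsum \<Theta> \<Theta>' y t)"
    using T nz by (simp add: divide_simps) algebra
  have b: "b = - (a - 1) - (y - t) + qsum \<Theta> \<Theta>' y t"
    unfolding b_def a_def qbeta_def ..
  have "\<Theta>' Pinf * (y * a + z1) + \<Theta> Pinf * (y * b + z2) = t * (\<Theta> P0 + \<Theta>' P0)"
    using a' b by algebra
  then show ?thesis
    unfolding n11_def n22_def z1_def[symmetric] z2_def[symmetric] a_def[symmetric] b_def[symmetric]
    by (simp add: add_divide_distrib[symmetric] algebra_simps)
qed

text \<open>At \<open>x = y\<close> the term with \<open>qalpha\<close> disappears and the value
  does not depend on \<open>q\<close>, which makes \<open>y\<close> a convenient node for
  interpolation.\<close>

lemma n11_at_y: "\<Theta>' Pinf \<noteq> 0 \<Longrightarrow> q \<noteq> 1 \<Longrightarrow> n11 \<Theta> \<Theta>' y Z t q y = y * (y - 1) * (y - t) * Z"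
  by (simp add: n11_def qz1_def divide_simps) (simp add: algebra_simps)

section \<open>Entries and determinant of \<open>Amat\<close>\<close>

definition m11 :: "(puncture \<Rightarrow> 'a::field) \<Rightarrow> 'a \<Rightarrow> 'a \<Rightarrow> 'a \<Rightarrow> 'a \<Rightarrow> 'a" where
  "m11 \<theta> y Z t x = (y - x) / 4 * ((4 * Z^2 * y * (y - 1) * (y - t) - da \<theta> y t) / \<theta> Pinf
      + \<theta> Pinf * (y + 2 * x - 1 - t)) + y * (y - 1) * (y - t) * Z"

definition m21 :: "(puncture \<Rightarrow> 'a::field) \<Rightarrow> 'a \<Rightarrow> 'a \<Rightarrow> 'a \<Rightarrow> 'a \<Rightarrow> 'a \<Rightarrow> 'a" where
  "m21 \<theta> l y Z t x = (dc0 \<theta> y Z t * (x - 1) * (x - t) + dc1 \<theta> y Z t * x * (x - t)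
     - (dc0 \<theta> y Z t + dc1 \<theta> y Z t) * x * (x - 1)) / l"

text \<open>The apparent pole of \<open>A11\<close> at \<open>x = y\<close> cancels: the terms with
  \<open>1 / (y - x)\<close> combine to a multiple of \<open>(D - X) / (y - x)\<close>, and
  \<open>D\<close>, \<open>X\<close> are the values of one cubic polynomial at \<open>y\<close> and
  at \<open>x\<close>.\<close>

lemma Amat_entries:
  fixes x :: "'a::field_char_0"
  assumes "x \<noteq> 0" "x \<noteq> 1" "x \<noteq> t" "x \<noteq> y" "\<theta> Pinf \<noteq> 0"
  shows "Amat \<theta> l y Z t x $ 1 $ 1 = m11 \<theta> y Z t x / (x * (x - 1) * (x - t))"
    "Amat \<theta> l y Z t x $ 1 $ 2 = l * (x - y) / (x * (x - 1) * (x - t))"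
    "Amat \<theta> l y Z t x $ 2 $ 1 = m21 \<theta> l y Z t x / (x * (x - 1) * (x - t))"
    "Amat \<theta> l y Z t x $ 2 $ 2 = - m11 \<theta> y Z t x / (x * (x - 1) * (x - t))"
proof -
  \<comment> \<open>\<open>X'\<close> is the derivative of \<open>X\<close> with respect to
    \<open>x\<close>, and \<open>K\<close> is the divided difference
    \<open>(D - X) / (y - x)\<close>.\<close>
  define a D X K X' u where "a = da \<theta> y t" and "D = y * (y - 1) * (y - t)" and "X = x * (x - 1) * (x - t)"
    and "K = y^2 + x * y + x^2 - (1 + t) * (x + y) + t" and "X' = (x - 1) * (x - t) + x * (x - t) + x * (x - 1)"
    and "u = y - x"
  have nz: "X \<noteq> 0" "u \<noteq> 0" using assms by (auto simp: X_def u_def)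
  have DX: "D = X + u * K" unfolding D_def X_def K_def u_def by algebra
  have inv: "1 / x + 1 / (x - 1) + 1 / (x - t) = X' / X"
    using assms unfolding X_def X'_def by (simp add: divide_simps) (simp add: algebra_simps)
  have "A11 \<theta> y Z t x = u / (4 * \<theta> Pinf * X) * (D * (2 * Z + \<theta> Pinf / u)^2 - a) - \<theta> Pinf / 4 * (X' / X + 1 / u)"
    unfolding A11_def inv X_def D_def a_def u_def by (simp add: mult.assoc)
  also have "\<dots> = (u * (4 * Z^2 * D - a) / (4 * \<theta> Pinf) + D * Z + \<theta> Pinf / 4 * ((D - X) / u - X')) / X"
    by (simp add: nz assms(5) divide_simps) (simp add: algebra_simps power2_eq_square)
  also have "(D - X) / u - X' = u * (y + 2 * x - 1 - t)"
  proof -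
    have "(D - X) / u = K" unfolding DX using nz by simp
    moreover have "K - X' = u * (y + 2 * x - 1 - t)"
      unfolding K_def X'_def u_def by algebra
    ultimately show ?thesis by simp
  qed
  also have "u * (4 * Z^2 * D - a) / (4 * \<theta> Pinf) + D * Z + \<theta> Pinf / 4 * (u * (y + 2 * x - 1 - t)) = m11 \<theta> y Z t x"
    unfolding m11_def a_def D_def u_def by (simp add: assms(5) divide_simps) (simp add: algebra_simps power2_eq_square)
  finally have *: "A11 \<theta> y Z t x = m11 \<theta> y Z t x / (x * (x - 1) * (x - t))"
    by (simp add: X_def)
  show "Amat \<theta> l y Z t x $ 1 $ 1 = m11 \<theta> y Z t x / (x * (x - 1) * (x - t))"
    "Amat \<theta> l y Z t x $ 1 $ 2 = l * (x - y) / (x * (x - 1) * (x - t))"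
    "Amat \<theta> l y Z t x $ 2 $ 2 = - m11 \<theta> y Z t x / (x * (x - 1) * (x - t))"
    by (simp_all add: Amat_def *)
  show "Amat \<theta> l y Z t x $ 2 $ 1 = m21 \<theta> l y Z t x / (x * (x - 1) * (x - t))"
  proof -
    have "c / x + d / (x - 1) - (c + d) / (x - t) =
      (c * (x - 1) * (x - t) + d * x * (x - t) - (c + d) * x * (x - 1)) / (x * (x - 1) * (x - t))" for c d
      using assms by (simp add: divide_simps) (simp add: algebra_simps)
    then show ?thesis unfolding Amat_def m21_def by simp
  qed
qed

text \<open>The left sides are minus the determinant at the three poles, up to the cleared
  denominators. The formulas for \<open>dc0\<close> and \<open>dc1\<close> are the solutions of the
  equations at 0 and 1. At \<open>t\<close> nothing is left to choose, and the equation holds by the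
  form of \<open>da\<close>.\<close>

lemma m_det:
  fixes y :: "'a::field_char_0"
  assumes nz: "y \<noteq> 0" "y \<noteq> 1" "y \<noteq> t" "t \<noteq> 0" "t \<noteq> 1" "\<theta> Pinf \<noteq> 0" "l \<noteq> 0"
  shows "m11 \<theta> y Z t 0 * m11 \<theta> y Z t 0 + l * (0 - y) * m21 \<theta> l y Z t 0 = t^2 * (\<theta> P0)^2 / 4"
    "m11 \<theta> y Z t 1 * m11 \<theta> y Z t 1 + l * (1 - y) * m21 \<theta> l y Z t 1 = (1 - t)^2 * (\<theta> P1)^2 / 4"
    "m11 \<theta> y Z t t * m11 \<theta> y Z t t + l * (t - y) * m21 \<theta> l y Z t t = t^2 * (t - 1)^2 * (\<theta> Pt)^2 / 4"
proof -
  define a \<Theta> where "a = da \<theta> y t" and "\<Theta> = \<theta> Pinf"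
  \<comment> \<open>The values of \<open>m11\<close> at 0, 1, \<open>t\<close> are
    \<open>y * w0\<close>, \<open>(y - 1) * w1\<close>, \<open>(y - t) * wt\<close>, each divided by
    \<open>\<Theta>\<close>, which here stands for \<open>\<theta> Pinf\<close>.\<close>
  define w0 w1 wt where "w0 = (y - 1) * (y - t) * (y * Z + \<Theta>) * Z + ((y - 1 - t) * \<Theta>^2 - a) / 4"
    and "w1 = y * (y - t) * ((y - 1) * Z + \<Theta>) * Z + ((y + 1 - t) * \<Theta>^2 - a) / 4"
    and "wt = y * (y - 1) * ((y - t) * Z + \<Theta>) * Z + ((y + t - 1) * \<Theta>^2 - a) / 4"
  define c0 c1 where "c0 = dc0 \<theta> y Z t" and "c1 = dc1 \<theta> y Z t"
  have c0: "c0 = y / (t * \<Theta>^2) * w0^2 - t * (\<theta> P0)^2 / (4 * y)"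
    unfolding c0_def dc0_def w0_def a_def \<Theta>_def ..
  have c1: "c1 = (y - 1) / ((1 - t) * \<Theta>^2) * w1^2 - (1 - t) * (\<theta> P1)^2 / (4 * (y - 1))"
    unfolding c1_def dc1_def w1_def a_def \<Theta>_def ..
  have nz': "t - y \<noteq> 0" "1 - y \<noteq> 0" "1 - t \<noteq> 0" "y - t \<noteq> 0" "y - 1 \<noteq> 0" "t - 1 \<noteq> 0" using nz by auto
  have T: "\<Theta> \<noteq> 0" using nz by (simp add: \<Theta>_def)
  have m0: "m11 \<theta> y Z t 0 = y * w0 / \<Theta>"
    unfolding m11_def w0_def a_def[symmetric] \<Theta>_def[symmetric] by (simp add: T divide_simps) (simp add: algebra_simps power2_eq_square)
  have m1: "m11 \<theta> y Z t 1 = (y - 1) * w1 / \<Theta>"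
    unfolding m11_def w1_def a_def[symmetric] \<Theta>_def[symmetric] by (simp add: T divide_simps) (simp add: algebra_simps power2_eq_square)
  have mt: "m11 \<theta> y Z t t = (y - t) * wt / \<Theta>"
    unfolding m11_def wt_def a_def[symmetric] \<Theta>_def[symmetric] by (simp add: T divide_simps) (simp add: algebra_simps power2_eq_square)
  have n0: "l * m21 \<theta> l y Z t 0 = c0 * t" and n1: "l * m21 \<theta> l y Z t 1 = c1 * (1 - t)"
    and nt: "l * m21 \<theta> l y Z t t = - ((c0 + c1) * t * (t - 1))"
    using nz by (simp_all add: m21_def c0_def c1_def)
  have "y * w0 / \<Theta> * (y * w0 / \<Theta>) + (0 - y) * (c0 * t) = t^2 * (\<theta> P0)^2 / 4"
    unfolding c0 by (simp add: nz T nz' divide_simps) (simp add: algebra_simps power2_eq_square)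
  then show "m11 \<theta> y Z t 0 * m11 \<theta> y Z t 0 + l * (0 - y) * m21 \<theta> l y Z t 0 = t^2 * (\<theta> P0)^2 / 4"
    by (simp add: m0 mult.left_commute n0[symmetric] mult.assoc)
  have "(y - 1) * w1 / \<Theta> * ((y - 1) * w1 / \<Theta>) + (1 - y) * (c1 * (1 - t)) = (1 - t)^2 * (\<theta> P1)^2 / 4"
    unfolding c1 by (simp add: nz T nz' divide_simps) (simp add: algebra_simps power2_eq_square)
  then show "m11 \<theta> y Z t 1 * m11 \<theta> y Z t 1 + l * (1 - y) * m21 \<theta> l y Z t 1 = (1 - t)^2 * (\<theta> P1)^2 / 4"
    unfolding m1 n1[symmetric] by (simp add: ac_simps)
  \<comment> \<open>This identity ties the value at \<open>t\<close> to those at 0 and 1. It becomes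
    polynomial once the denominators 4 are cleared.\<close>
  have W: "(y - t) * wt^2 + (t - 1) * y * w0^2 - t * (y - 1) * w1^2 = t * (t - 1) * \<Theta>^2 * a / 4"
  proof -
    have e: "4 * wt = 4 * (y * (y - 1) * ((y - t) * Z + \<Theta>) * Z) + ((y + t - 1) * \<Theta>^2 - a)"
      "4 * w0 = 4 * ((y - 1) * (y - t) * (y * Z + \<Theta>) * Z) + ((y - 1 - t) * \<Theta>^2 - a)"
      "4 * w1 = 4 * (y * (y - t) * ((y - 1) * Z + \<Theta>) * Z) + ((y + 1 - t) * \<Theta>^2 - a)"
      by (simp_all add: wt_def w0_def w1_def)
    have "16 * ((y - t) * wt^2 + (t - 1) * y * w0^2 - t * (y - 1) * w1^2) =
        (y - t) * (4 * wt)^2 + (t - 1) * y * (4 * w0)^2 - t * (y - 1) * (4 * w1)^2"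
      by (simp add: algebra_simps)
    also have "\<dots> = 4 * (t * (t - 1) * \<Theta>^2 * a)"
      unfolding e by algebra
    also have "\<dots> = 16 * (t * (t - 1) * \<Theta>^2 * a / 4)" by simp
    finally show ?thesis by (simp only: mult_cancel_left) simp
  qed
  \<comment> \<open>The definition of \<open>da\<close> trades the terms with
    \<open>\<theta> P0\<close> and \<open>\<theta> P1\<close> for one with
    \<open>\<theta> Pt\<close>.\<close>
  have c01: "c0 + c1 = ((t - 1) * y * w0^2 - t * (y - 1) * w1^2) / (t * (t - 1) * \<Theta>^2) - (a - t * (t - 1) * (\<theta> Pt)^2 / (y - t)) / 4"
  proof -
    have "c0 = y / (t * \<Theta>^2) * w0^2 - t * (\<theta> P0)^2 / y / 4"
      unfolding c0 by (simp add: mult.commute)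
    moreover have "c1 = - ((y - 1) / ((t - 1) * \<Theta>^2) * w1^2 - (t - 1) * (\<theta> P1)^2 / (y - 1) / 4)"
      unfolding c1 by (simp add: nz nz' T divide_simps) (simp add: algebra_simps)
    ultimately have "c0 + c1 = (y / (t * \<Theta>^2) * w0^2 - (y - 1) / ((t - 1) * \<Theta>^2) * w1^2)
        - (t * (\<theta> P0)^2 / y - (t - 1) * (\<theta> P1)^2 / (y - 1)) / 4"
      by (simp only: diff_divide_distrib[of "t * (\<theta> P0)^2 / y"]) simp
    also have "y / (t * \<Theta>^2) * w0^2 - (y - 1) / ((t - 1) * \<Theta>^2) * w1^2 =
       ((t - 1) * y * w0^2 - t * (y - 1) * w1^2) / (t * (t - 1) * \<Theta>^2)"
      using nz T by (simp add: divide_simps)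
    also have "t * (\<theta> P0)^2 / y - (t - 1) * (\<theta> P1)^2 / (y - 1) = a - t * (t - 1) * (\<theta> Pt)^2 / (y - t)"
      by (simp add: a_def da_def)
    finally show ?thesis .
  qed
  have "(y - t) * wt / \<Theta> * ((y - t) * wt / \<Theta>) + (y - t) * ((c0 + c1) * t * (t - 1)) =
     (y - t) / \<Theta>^2 * ((y - t) * wt^2 + (t - 1) * y * w0^2 - t * (y - 1) * w1^2 - t * (t - 1) * \<Theta>^2 * a / 4)
     + t^2 * (t - 1)^2 * (\<theta> Pt)^2 / 4"
    unfolding c01 by (simp add: nz T nz' divide_simps) (simp add: algebra_simps power2_eq_square)
  also have "\<dots> = t^2 * (t - 1)^2 * (\<theta> Pt)^2 / 4" unfolding W by simp
  finally have "(y - t) * wt / \<Theta> * ((y - t) * wt / \<Theta>) + (t - y) * (l * m21 \<theta> l y Z t t) = t^2 * (t - 1)^2 * (\<theta> Pt)^2 / 4"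
    unfolding nt by (simp add: algebra_simps)
  then show "m11 \<theta> y Z t t * m11 \<theta> y Z t t + l * (t - y) * m21 \<theta> l y Z t t = t^2 * (t - 1)^2 * (\<theta> Pt)^2 / 4"
    unfolding mt by (simp add: ac_simps)
qed

section \<open>Second-order expansion\<close>

text \<open>\<open>qalpha\<close> divides by \<open>\<Theta> Pinf - \<Theta>' Pinf\<close>, which is
  small of order \<open>q - 1\<close>. After multiplication by \<open>\<eta>\<close> everything is
  written through \<open>\<eta>\<close> itself and quotients by \<open>(q - 1)^2\<close>, each of
  which has a limit of its own under the expansions. The cancellations of lower order are thus
  carried out exactly.\<close>

lemma n11_expansion_0:
  fixes y :: "'a::field"
  assumes nz: "y \<noteq> 0" "y \<noteq> 1" "y \<noteq> t" "t \<noteq> 0" "t \<noteq> 1" and T': "\<Theta>' Pinf \<noteq> 0"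
    and u: "1 + (q - 1) * y * Z \<noteq> 0" and q: "q \<noteq> 1" and T: "\<Theta> Pinf \<noteq> \<Theta>' Pinf"
  defines "w \<equiv> (y - 1) * (y - t)"
    and "s \<equiv> \<lambda>i. (\<Theta> i + \<Theta>' i - 2) / (q - 1)^2"
    and "P \<equiv> \<Theta> Pinf * \<Theta>' Pinf"
    and "\<eta> \<equiv> (\<Theta> Pinf - \<Theta>' Pinf) / (q - 1)"
  shows "n11 \<Theta> \<Theta>' y Z t q 0 * \<eta> =
      (s Pinf - 2 * ((P - 1) / (q - 1)^2)) * (w - t) + w * (y * Z) * \<eta>
    + \<Theta>' Pinf * w * ((y * Z)^2 + (P - 1) / (q - 1)^2) / (1 + (q - 1) * y * Z)
    + \<Theta>' Pinf * P * ((pfrak \<Theta> \<Theta>' t y - w^2) / (q - 1)^2) / (w * (1 + (q - 1) * y * Z))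
    + P * y * (t * s Pt + s P1) - \<Theta>' Pinf * t * s P0"
proof -
  define \<epsilon> v k where "\<epsilon> = q - 1" and "v = 1 / (1 + (q - 1) * y * Z)" and "k = 1 / w"
  define a b z1 z2 where "a = qalpha \<Theta> \<Theta>' y Z t q" and "b = qbeta \<Theta> \<Theta>' y Z t q"
    and "z1 = qz1 \<Theta>' y Z t q" and "z2 = qz2 \<Theta> \<Theta>' y Z t q"
  define p11 where "p11 = \<Theta>' Pinf * (y * a + z1)"
  define R where "R = pfrak \<Theta> \<Theta>' t y - w^2"
  define S where "S i = \<Theta> i + \<Theta>' i - 2" for i
  have e: "\<epsilon> \<noteq> 0" using q by (simp add: \<epsilon>_def)
  have w: "w \<noteq> 0" using nz by (simp add: w_def)
  have wk: "w * k = 1" using w by (simp add: k_def)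
  have "(1 + \<epsilon> * (y * Z)) * v = 1" using u by (simp add: v_def \<epsilon>_def mult.assoc)
  \<comment> \<open>The geometric series with its exact remainder: the terms of order 0 and 1 are
    absorbed into the other summands, while the remainder is of second order.\<close>
  then have v: "v = 1 - \<epsilon> * (y * Z) + (\<epsilon> * (y * Z))^2 * v" by algebra
  have tr: "p11 + \<Theta> Pinf * (y * b + z2) = t * (\<Theta> P0 + \<Theta>' P0)"
  proof -
    have "(\<Theta>' Pinf * (y * a + z1) - t + (\<Theta> Pinf * (y * b + z2) - t)) / (q - 1) = t * (\<Theta> P0 + \<Theta>' P0 - 2) / (q - 1)"
      using n_trace_0[where Z = Z and \<Theta> = \<Theta> and \<Theta>' = \<Theta>' and y = y and t = t and q = q] nz T q unfolding n11_def n22_def a_def b_def z1_def z2_def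
      by (simp add: add_divide_distrib[symmetric])
    then have "p11 - t + (\<Theta> Pinf * (y * b + z2) - t) = t * (\<Theta> P0 + \<Theta>' P0 - 2)"
      using q by (simp add: p11_def)
    then show ?thesis by algebra
  qed
  have ab: "a + b = t * (2 + S Pt) + (2 + S P1) - 2 * y"
    using qalpha_qbeta_sum[OF nz, of \<Theta> \<Theta>' Z q] by (simp add: a_def b_def S_def algebra_simps)
  have z1: "\<Theta>' Pinf * z1 = w * (1 + \<epsilon> * (y * Z))"
    and z2: "\<Theta> Pinf * z2 = P * (w^2 + R) * k * v"
    using qz_mult(2)[of y t \<Theta>' q Z] qz_mult(3)[of y t \<Theta>' q Z \<Theta>] nz T' u
    by (simp_all add: z1_def z2_def w_def \<epsilon>_def R_def k_def v_def P_def mult.assoc)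
  \<comment> \<open>\<open>b\<close> is eliminated between the trace \<open>tr\<close> and the sum
    \<open>ab\<close>.\<close>
  have "p11 * (\<Theta> Pinf - \<Theta>' Pinf) = P * y * (a + b) + \<Theta> Pinf * (\<Theta>' Pinf * z1) + \<Theta>' Pinf * (\<Theta> Pinf * z2)
      - \<Theta>' Pinf * (t * (\<Theta> P0 + \<Theta>' P0))"
    unfolding tr[symmetric] p11_def P_def by algebra
  also have "\<dots> = P * y * (t * (2 + S Pt) + (2 + S P1) - 2 * y) + \<Theta> Pinf * w * (1 + \<epsilon> * (y * Z))
      + \<Theta>' Pinf * P * (w^2 + R) * k * v - \<Theta>' Pinf * t * (2 + S P0)"
    unfolding ab z1 z2 S_def by algebra
  also have "\<Theta>' Pinf * P * (w^2 + R) * k * v = \<Theta>' Pinf * w * v + \<Theta>' Pinf * (P - 1) * w * v + \<Theta>' Pinf * P * R * k * v"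
    using wk by algebra
  also have "\<Theta>' Pinf * w * v = \<Theta>' Pinf * w * (1 - \<epsilon> * (y * Z)) + \<Theta>' Pinf * w * (\<epsilon> * (y * Z))^2 * v"
    by (subst v) algebra
  finally have p11: "(p11 - t) * (\<Theta> Pinf - \<Theta>' Pinf) =
      (S Pinf - 2 * (P - 1)) * (w - t) + w * (\<epsilon> * (y * Z)) * (\<Theta> Pinf - \<Theta>' Pinf)
    + \<Theta>' Pinf * w * (\<epsilon> * (y * Z))^2 * v + \<Theta>' Pinf * (P - 1) * w * v + \<Theta>' Pinf * P * R * k * v
    + P * y * (t * S Pt + S P1) - \<Theta>' Pinf * t * S P0"
    unfolding S_def w_def P_def by algebra
  have n: "n11 \<Theta> \<Theta>' y Z t q 0 = (p11 - t) / \<epsilon>"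
    by (simp add: n11_def p11_def a_def z1_def \<epsilon>_def algebra_simps)
  have "n11 \<Theta> \<Theta>' y Z t q 0 * \<eta> = (p11 - t) * (\<Theta> Pinf - \<Theta>' Pinf) / \<epsilon>^2"
    unfolding n \<eta>_def \<epsilon>_def by (simp add: power2_eq_square)
  also have "\<dots> = (S Pinf / \<epsilon>^2 - 2 * ((P - 1) / \<epsilon>^2)) * (w - t) + w * (y * Z) * ((\<Theta> Pinf - \<Theta>' Pinf) / \<epsilon>)
    + \<Theta>' Pinf * w * ((y * Z)^2 + (P - 1) / \<epsilon>^2) * v + \<Theta>' Pinf * P * (R / \<epsilon>^2) * (k * v)
    + P * y * (t * (S Pt / \<epsilon>^2) + S P1 / \<epsilon>^2) - \<Theta>' Pinf * t * (S P0 / \<epsilon>^2)"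
    unfolding p11 by (simp add: e divide_simps) algebra
  finally show ?thesis
    unfolding s_def \<eta>_def S_def v_def k_def R_def \<epsilon>_def by simp
qed

text \<open>\<open>pfrak\<close> is a product of two quadratics in \<open>y\<close>, each of which
  is a square plus \<open>(q - 1)^2\<close> times a correction linear in \<open>y\<close>.\<close>

lemma pfrak_second_order:
  fixes \<Theta> \<Theta>' :: "puncture \<Rightarrow> 'a::field" and q :: 'a
  assumes "q \<noteq> 1"
  defines "s \<equiv> \<lambda>i. (\<Theta> i + \<Theta>' i - 2) / (q - 1)^2"
    and "p \<equiv> \<lambda>i. (\<Theta> i * \<Theta>' i - 1) / (q - 1)^2"
  shows "(pfrak \<Theta> \<Theta>' t y - ((y - 1) * (y - t))^2) / (q - 1)^2 =
    (y - 1)^2 * (t * (t * p Pt - s Pt * y)) + (y - t)^2 * (p P1 - s P1 * y)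
    + (q - 1)^2 * (t * (t * p Pt - s Pt * y)) * (p P1 - s P1 * y)"
proof -
  have s: "\<Theta> i + \<Theta>' i = 2 + (q - 1)^2 * s i" and p: "\<Theta> i * \<Theta>' i = 1 + (q - 1)^2 * p i" for i
    using assms(1) by (simp_all add: s_def p_def)
  have "pfrak \<Theta> \<Theta>' t y = (y^2 - t * y * (\<Theta> Pt + \<Theta>' Pt) + t^2 * (\<Theta> Pt * \<Theta>' Pt))
      * (y^2 - y * (\<Theta> P1 + \<Theta>' P1) + \<Theta> P1 * \<Theta>' P1)"
    unfolding pfrak_def by algebra
  also have "\<dots> - ((y - 1) * (y - t))^2 = (q - 1)^2 * ((y - 1)^2 * (t * (t * p Pt - s Pt * y)) + (y - t)^2 * (p P1 - s P1 * y)
    + (q - 1)^2 * (t * (t * p Pt - s Pt * y)) * (p P1 - s P1 * y))"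
    unfolding s p by algebra
  finally show ?thesis using assms(1) by simp
qed

text \<open>The counterpart of \<open>n11_at_y\<close>: the term with \<open>qbeta\<close>
  disappears, and the deviation from the expected value carries a factor
  \<open>q - 1\<close>.\<close>

lemma n22_at_y:
  fixes y :: "'a::field"
  assumes nz: "y \<noteq> 1" "y \<noteq> t" and T': "\<Theta>' Pinf \<noteq> 0" and u: "1 + (q - 1) * y * Z \<noteq> 0" and q: "q \<noteq> 1"
  defines "w \<equiv> (y - 1) * (y - t)"
  shows "n22 \<Theta> \<Theta>' y Z t q y = - (w * (y * Z)) / (1 + (q - 1) * y * Z)
    + (q - 1) * ((pfrak \<Theta> \<Theta>' t y - w^2) / (q - 1)^2 + (\<Theta> Pinf * \<Theta>' Pinf - 1) / (q - 1)^2 * pfrak \<Theta> \<Theta>' t y)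
      / (w * (1 + (q - 1) * y * Z))"
proof -
  define e p P u' where "e = q - 1" and "p = pfrak \<Theta> \<Theta>' t y" and "P = \<Theta> Pinf * \<Theta>' Pinf"
    and "u' = 1 + e * y * Z"
  have nz': "e \<noteq> 0" "w \<noteq> 0" "u' \<noteq> 0" using nz q u by (simp_all add: w_def e_def u'_def)
  have "n22 \<Theta> \<Theta>' y Z t q y = (\<Theta> Pinf * qz2 \<Theta> \<Theta>' y Z t q - w) / e"
    by (simp add: n22_def w_def e_def)
  also have "\<dots> = (P * p / (w * u') - w) / e"
    using qz_mult(3)[of y t \<Theta>' q Z \<Theta>] nz T' u by (simp add: w_def e_def u'_def P_def p_def)
  also have "\<dots> = - (w * (y * Z)) / u' + e * ((p - w^2) / e^2 + (P - 1) / e^2 * p) / (w * u')"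
    using nz' by (simp add: divide_simps) (unfold u'_def, algebra)
  finally show ?thesis by (simp add: e_def u'_def p_def P_def)
qed

text \<open>At 1 and \<open>t\<close> the trace term of \<open>n_det\<close> vanishes, and
  \<open>pfrak\<close> contains the product of \<open>\<Theta> i - 1\<close> and
  \<open>\<Theta>' i - 1\<close>. At 0 this product arises from \<open>rel\<close> together with the
  trace.\<close>

lemma n_det_special:
  fixes y :: "'a::field"
  assumes nz: "y \<noteq> 0" "y \<noteq> 1" "y \<noteq> t" "t \<noteq> 0" "t \<noteq> 1" and "\<Theta>' Pinf \<noteq> 0" "1 + (q - 1) * y * Z \<noteq> 0"
    and q: "q \<noteq> 1" and "l \<noteq> 0" and T: "\<Theta> Pinf \<noteq> \<Theta>' Pinf"
    and rel: "\<Theta> P0 * \<Theta>' P0 = \<Theta> Pinf * \<Theta>' Pinf * \<Theta> Pt * \<Theta>' Pt * \<Theta> P1 * \<Theta>' P1"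
  defines "D \<equiv> \<lambda>x. n11 \<Theta> \<Theta>' y Z t q x * n22 \<Theta> \<Theta>' y Z t q x - l * (x - y) * n21 \<Theta> \<Theta>' l y Z t q x"
    and "d \<equiv> \<lambda>i. (\<Theta> i - 1) * (\<Theta>' i - 1) / (q - 1)^2"
  shows "D 0 = t^2 * d P0"
    "D 1 = \<Theta> Pinf * \<Theta>' Pinf * ((1 - t * \<Theta> Pt) * (1 - t * \<Theta>' Pt)) * d P1"
    "D t = \<Theta> Pinf * \<Theta>' Pinf * ((t - \<Theta> P1) * (t - \<Theta>' P1)) * (t^2 * d Pt)"
proof -
  have D: "D x = (\<Theta> Pinf * \<Theta>' Pinf * pfrak \<Theta> \<Theta>' t x - ((x - 1) * (x - t))^2) / (q - 1)^2
    - (x - 1) * (x - t) * (n11 \<Theta> \<Theta>' y Z t q x + n22 \<Theta> \<Theta>' y Z t q x) / (q - 1)" for x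
    unfolding D_def using assms(1-9) by (rule n_det)
  show "D 1 = \<Theta> Pinf * \<Theta>' Pinf * ((1 - t * \<Theta> Pt) * (1 - t * \<Theta>' Pt)) * d P1"
  proof -
    have *: "\<Theta> Pinf * \<Theta>' Pinf * pfrak \<Theta> \<Theta>' t 1 =
        \<Theta> Pinf * \<Theta>' Pinf * ((1 - t * \<Theta> Pt) * (1 - t * \<Theta>' Pt)) * ((\<Theta> P1 - 1) * (\<Theta>' P1 - 1))"
      unfolding pfrak_def by algebra
    show ?thesis unfolding D d_def * by simp
  qed
  show "D t = \<Theta> Pinf * \<Theta>' Pinf * ((t - \<Theta> P1) * (t - \<Theta>' P1)) * (t^2 * d Pt)"
  proof -
    have *: "\<Theta> Pinf * \<Theta>' Pinf * pfrak \<Theta> \<Theta>' t t =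
        \<Theta> Pinf * \<Theta>' Pinf * ((t - \<Theta> P1) * (t - \<Theta>' P1)) * (t^2 * ((\<Theta> Pt - 1) * (\<Theta>' Pt - 1)))"
      unfolding pfrak_def by algebra
    show ?thesis unfolding D d_def * by simp
  qed
  have p0: "\<Theta> Pinf * \<Theta>' Pinf * pfrak \<Theta> \<Theta>' t 0 = t^2 * (\<Theta> P0 * \<Theta>' P0)"
    unfolding rel pfrak_def by algebra
  have tr: "n11 \<Theta> \<Theta>' y Z t q 0 + n22 \<Theta> \<Theta>' y Z t q 0 = t * (\<Theta> P0 + \<Theta>' P0 - 2) / (q - 1)"
    using nz T q by (rule n_trace_0)
  have "D 0 = (t^2 * (\<Theta> P0 * \<Theta>' P0) - t^2 - t * (t * (\<Theta> P0 + \<Theta>' P0 - 2))) / (q - 1)^2"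
    unfolding D p0 tr using q by (simp add: divide_simps power2_eq_square)
  also have "t^2 * (\<Theta> P0 * \<Theta>' P0) - t^2 - t * (t * (\<Theta> P0 + \<Theta>' P0 - 2)) = t^2 * ((\<Theta> P0 - 1) * (\<Theta>' P0 - 1))"
    by algebra
  finally show "D 0 = t^2 * d P0" by (simp add: d_def)
qed

lemma quadratic_n:
  fixes x :: "'a::field"
  shows "n11 \<Theta> \<Theta>' y Z t q x = (\<Theta>' Pinf - 1) / (q - 1) * x^2
      + (n11 \<Theta> \<Theta>' y Z t q 1 - (\<Theta>' Pinf - 1) / (q - 1) - n11 \<Theta> \<Theta>' y Z t q 0) * x + n11 \<Theta> \<Theta>' y Z t q 0"
    "n22 \<Theta> \<Theta>' y Z t q x = (\<Theta> Pinf - 1) / (q - 1) * x^2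
      + (n22 \<Theta> \<Theta>' y Z t q 1 - (\<Theta> Pinf - 1) / (q - 1) - n22 \<Theta> \<Theta>' y Z t q 0) * x + n22 \<Theta> \<Theta>' y Z t q 0"
    "n21 \<Theta> \<Theta>' l y Z t q x = 0 * x^2 +
      (n21 \<Theta> \<Theta>' l y Z t q 1 - 0 - n21 \<Theta> \<Theta>' l y Z t q 0) * x + n21 \<Theta> \<Theta>' l y Z t q 0"
  subgoal unfolding n11_def divide_inverse by algebra
  subgoal unfolding n22_def divide_inverse by algebra
  subgoal unfolding n21_def divide_inverse by algebra
  done

lemma quadratic_m:
  fixes x :: "'a::field_char_0"
  assumes "\<theta> Pinf \<noteq> 0"
  shows "m11 \<theta> y Z t x = - (\<theta> Pinf / 2) * x^2
      + (m11 \<theta> y Z t 1 - - (\<theta> Pinf / 2) - m11 \<theta> y Z t 0) * x + m11 \<theta> y Z t 0"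
    "m21 \<theta> l y Z t x = 0 * x^2 + (m21 \<theta> l y Z t 1 - 0 - m21 \<theta> l y Z t 0) * x + m21 \<theta> l y Z t 0"
  subgoal using assms unfolding m11_def by (simp add: divide_simps) (simp add: algebra_simps power2_eq_square)
  subgoal unfolding m21_def divide_inverse by algebra
  done

text \<open>The left side is the limit of the right side of \<open>n11_expansion_0\<close>.
  \<open>S i\<close> and \<open>P i\<close> stand for the limits of the second-order quotients of
  the sum and the product of \<open>\<Theta> i\<close> and \<open>\<Theta>' i\<close>. The relation
  \<open>rel\<close> makes them cancel, so that no second-order data survive.\<close>

lemma m11_0_limit:
  fixes y :: "'a::field_char_0" and \<theta> S :: "puncture \<Rightarrow> 'a"
  assumes nz: "y \<noteq> 0" "y \<noteq> 1" "y \<noteq> t" "\<theta> Pinf \<noteq> 0"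
  defines "P \<equiv> \<lambda>i. S i - (\<theta> i)^2 / 4"
  assumes rel: "P P0 = P Pinf + P Pt + P P1"
  defines "w \<equiv> (y - 1) * (y - t)"
  shows "(S Pinf - 2 * P Pinf) * (w - t) + w * (y * Z) * \<theta> Pinf + w * ((y * Z)^2 + P Pinf)
     + ((y - 1)^2 * (t * (t * P Pt - S Pt * y)) + (y - t)^2 * (P P1 - S P1 * y)) / w
     + y * (t * S Pt + S P1) - t * S P0 = m11 \<theta> y Z t 0 * \<theta> Pinf"
proof -
  define a where "a = da \<theta> y t"
  have nz': "y - 1 \<noteq> 0" "y - t \<noteq> 0" using nz by auto
  have S: "S i = P i + (\<theta> i)^2 / 4" for i by (simp add: P_def)
  have "((y - 1)^2 * (t * (t * P Pt - S Pt * y)) + (y - t)^2 * (P P1 - S P1 * y)) / w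
     = (y - 1) / (y - t) * (t * (t * P Pt - S Pt * y)) + (y - t) / (y - 1) * (P P1 - S P1 * y)"
    unfolding w_def using nz' by (simp add: divide_simps power2_eq_square)
  also have "\<dots> = - ((y - 1) * t * P Pt) - (y - t) * P P1
     - (y - 1) / (y - t) * t * y * (\<theta> Pt)^2 / 4 - (y - t) / (y - 1) * y * (\<theta> P1)^2 / 4"
    unfolding S using nz' by (simp add: divide_simps) (simp add: algebra_simps power2_eq_square)
  finally have r: "((y - 1)^2 * (t * (t * P Pt - S Pt * y)) + (y - t)^2 * (P P1 - S P1 * y)) / w = \<dots>" .
  have "y * a = t * (\<theta> P0)^2 - (t - 1) * (\<theta> P1)^2 * (y / (y - 1)) + t * (t - 1) * (\<theta> Pt)^2 * (y / (y - t))"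
  proof -
    have "y * (A / y - B / (y - 1) + C / (y - t)) = A - B * (y / (y - 1)) + C * (y / (y - t))" for A B C
      using nz(1) by (simp add: ring_distribs mult.commute)
    then show ?thesis unfolding a_def da_def .
  qed
  also have "(t - 1) * (\<theta> P1)^2 * (y / (y - 1)) = y * (\<theta> P1)^2 - (y - t) / (y - 1) * y * (\<theta> P1)^2"
    using nz' by (simp add: divide_simps) (simp add: algebra_simps)
  also have "t * (t - 1) * (\<theta> Pt)^2 * (y / (y - t)) = (y - 1) / (y - t) * t * y * (\<theta> Pt)^2 - t * y * (\<theta> Pt)^2"
    using nz' by (simp add: divide_simps) (simp add: algebra_simps)
  finally have a: "y * a = t * (\<theta> P0)^2 - (y * (\<theta> P1)^2 - (y - t) / (y - 1) * y * (\<theta> P1)^2)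
     + ((y - 1) / (y - t) * t * y * (\<theta> Pt)^2 - t * y * (\<theta> Pt)^2)" .
  \<comment> \<open>The terms with denominators \<open>y - t\<close> and \<open>y - 1\<close>, which
    occur equally on both sides.\<close>
  define A B where "A = (y - 1) / (y - t) * t * y * (\<theta> Pt)^2" and "B = (y - t) / (y - 1) * y * (\<theta> P1)^2"
  have m: "m11 \<theta> y Z t 0 * \<theta> Pinf = y / 4 * ((4 * Z^2 * y * w - a) + (\<theta> Pinf)^2 * (y - 1 - t)) + y * w * Z * \<theta> Pinf"
    unfolding m11_def w_def a_def[symmetric] using nz(4) by (simp add: divide_simps) (simp add: algebra_simps power2_eq_square)
  have "4 * (y / 4 * ((4 * Z^2 * y * w - a) + (\<theta> Pinf)^2 * (y - 1 - t)) + y * w * Z * \<theta> Pinf)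
     = 4 * Z^2 * y^2 * w - y * a + y * (\<theta> Pinf)^2 * (y - 1 - t) + 4 * (y * w * Z * \<theta> Pinf)"
  proof -
    have *: "4 * (y / 4 * E + G) = y * E + 4 * G" for E G by (simp add: ring_distribs)
    show ?thesis unfolding * by algebra
  qed
  also have "\<dots> = 4 * ((S Pinf - 2 * P Pinf) * (w - t) + w * (y * Z) * \<theta> Pinf + w * ((y * Z)^2 + P Pinf)
     + (- ((y - 1) * t * P Pt) - (y - t) * P P1 - A / 4 - B / 4)
     + y * (t * S Pt + S P1) - t * S P0)"
    unfolding S rel a A_def[symmetric] B_def[symmetric]
    by (simp add: w_def divide_simps) (simp add: algebra_simps power2_eq_square)
  finally have "4 * (m11 \<theta> y Z t 0 * \<theta> Pinf) = 4 * ((S Pinf - 2 * P Pinf) * (w - t) + w * (y * Z) * \<theta> Pinf + w * ((y * Z)^2 + P Pinf)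
     + (- ((y - 1) * t * P Pt) - (y - t) * P P1 - A / 4 - B / 4)
     + y * (t * S Pt + S P1) - t * S P0)"
    unfolding m .
  then have "m11 \<theta> y Z t 0 * \<theta> Pinf = (S Pinf - 2 * P Pinf) * (w - t) + w * (y * Z) * \<theta> Pinf + w * ((y * Z)^2 + P Pinf)
     + (- ((y - 1) * t * P Pt) - (y - t) * P P1 - A / 4 - B / 4)
     + y * (t * S Pt + S P1) - t * S P0"
    by (subst (asm) mult_cancel_left) simp
  then show ?thesis unfolding r A_def[symmetric] B_def[symmetric] by (rule sym)
qed

section \<open>Limits as \<open>q\<close> tends to 1\<close>

text \<open>The lower coefficients are recovered from \<open>f 1\<close> and \<open>f 0\<close>, so
  no existential quantifier is needed and only the leading coefficient is named.\<close>

definition quadratic :: "'a::field \<Rightarrow> ('a \<Rightarrow> 'a) \<Rightarrow> bool" where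
  "quadratic a f \<longleftrightarrow> (\<forall>x. f x = a * x^2 + (f 1 - a - f 0) * x + f 0)"

text \<open>Newton interpolation with the nodes \<open>x1\<close> and \<open>x2\<close>.\<close>

lemma quadratic_newton:
  fixes a :: "'a::field"
  assumes "quadratic a f" "x1 \<noteq> x2"
  shows "f x = a * (x - x1) * (x - x2) + (f x1 - f x2) / (x1 - x2) * (x - x1) + f x1"
proof -
  define b c where "b = f 1 - a - f 0" and "c = f 0"
  have f: "f x = a * x^2 + b * x + c" for x
    using assms(1) unfolding quadratic_def b_def c_def by blast
  have "(f x1 - f x2) / (x1 - x2) = a * (x1 + x2) + b"
  proof -
    have "f x1 - f x2 = (a * (x1 + x2) + b) * (x1 - x2)" unfolding f by algebra
    then show ?thesis using assms(2) by simp
  qed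
  then show ?thesis unfolding f by algebra
qed

text \<open>The leading coefficient is the second divided difference.\<close>

lemma quadratic_leading_coeff:
  fixes a :: "'a::field"
  assumes "quadratic a f" "x1 \<noteq> x2" "x1 \<noteq> x3" "x2 \<noteq> x3"
  shows "a = ((f x1 - f x2) / (x1 - x2) - (f x1 - f x3) / (x1 - x3)) / (x2 - x3)"
proof -
  define A where "A = (f x1 - f x2) / (x1 - x2)"
  have "f x1 - f x3 = (x1 - x3) * (a * (x3 - x2) + A)"
    unfolding quadratic_newton[OF assms(1,2), of x3] A_def[symmetric] by algebra
  then have "(f x1 - f x3) / (x1 - x3) = a * (x3 - x2) + A"
    using assms(3) by simp
  then have "A - (f x1 - f x3) / (x1 - x3) = a * (x2 - x3)" by (simp add: algebra_simps)
  then show ?thesis using assms(4) by (simp add: A_def)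
qed

lemma quadratic_uminus:
  fixes a :: "'a::field"
  assumes "quadratic a f"
  shows "quadratic (- a) (\<lambda>x. - f x)"
  unfolding quadratic_def
proof
  fix x
  have "f x = a * x^2 + (f 1 - a - f 0) * x + f 0"
    using assms unfolding quadratic_def by (rule spec)
  then show "- f x = - a * x^2 + (- f 1 - - a - - f 0) * x + - f 0" by algebra
qed

lemma quadratic_n_m:
  "quadratic ((\<Theta>' Pinf - 1) / (q - 1)) (n11 \<Theta> \<Theta>' y Z t q)"
  "quadratic ((\<Theta> Pinf - 1) / (q - 1)) (n22 \<Theta> \<Theta>' y Z t q)"
  "quadratic 0 (n21 \<Theta> \<Theta>' l y Z t q)"
  "quadratic 0 (m21 \<theta>' l y Z t)"
  subgoal unfolding quadratic_def by (intro allI quadratic_n)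
  subgoal unfolding quadratic_def by (intro allI quadratic_n)
  subgoal unfolding quadratic_def by (intro allI quadratic_n)
  subgoal unfolding quadratic_def m21_def divide_inverse by (intro allI) algebra
  done

lemma quadratic_m11:
  fixes y :: "'a::field_char_0"
  assumes "\<theta> Pinf \<noteq> 0"
  shows "quadratic (- (\<theta> Pinf / 2)) (m11 \<theta> y Z t)"
    and "quadratic (\<theta> Pinf / 2) (\<lambda>x. - m11 \<theta> y Z t x)"
proof -
  show *: "quadratic (- (\<theta> Pinf / 2)) (m11 \<theta> y Z t)"
    unfolding quadratic_def by (intro allI, rule quadratic_m(1)[where \<theta> = \<theta>], rule assms)
  show "quadratic (\<theta> Pinf / 2) (\<lambda>x. - m11 \<theta> y Z t x)"
    using quadratic_uminus[OF *] by (simp only: minus_minus)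
qed

text \<open>In the Newton form only the leading coefficient and the values at the two nodes depend
  on \<open>q\<close>.\<close>

lemma quadratic_tendsto:
  fixes f :: "'b \<Rightarrow> 'a::real_normed_field \<Rightarrow> 'a"
  assumes "\<And>q. quadratic (a q) (f q)" "quadratic A L" and "(a \<longlongrightarrow> A) F"
    "((\<lambda>q. f q x1) \<longlongrightarrow> L x1) F" "((\<lambda>q. f q x2) \<longlongrightarrow> L x2) F" and ne: "x1 \<noteq> x2"
  shows "((\<lambda>q. f q x) \<longlongrightarrow> L x) F"
  unfolding quadratic_newton[OF assms(1) ne, of _ x] quadratic_newton[OF assms(2) ne, of x]
  by (intro tendsto_intros assms) (use ne in simp)

lemma quadratic_leading_coeff_tendsto:
  fixes f :: "'b \<Rightarrow> 'a::real_normed_field \<Rightarrow> 'a"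
  assumes quad: "\<And>q. quadratic (a q) (f q)" "quadratic A L" and lim: "\<And>x. x \<in> X \<Longrightarrow> ((\<lambda>q. f q x) \<longlongrightarrow> L x) F"
    and X: "x1 \<in> X" "x2 \<in> X" "x3 \<in> X" and ne: "x1 \<noteq> x2" "x1 \<noteq> x3" "x2 \<noteq> x3"
  shows "(a \<longlongrightarrow> A) F"
  unfolding quadratic_leading_coeff[OF quad(1) ne] quadratic_leading_coeff[OF quad(2) ne]
  by (intro tendsto_intros lim X) (use ne in simp_all)

lemma tendsto_of_quotient_tendsto:
  fixes f :: "'a::real_normed_field \<Rightarrow> 'a"
  assumes "((\<lambda>q. (f q - c) / (q - 1)^k) \<longlongrightarrow> L) (at 1)" "k > 0"
  shows "(f \<longlongrightarrow> c) (at 1)"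
proof (rule Lim_transform_eventually)
  show "\<forall>\<^sub>F q in at 1. c + (q - 1)^k * ((f q - c) / (q - 1)^k) = f q"
    using eventually_neq_at_within[of 1 1 UNIV] by eventually_elim simp
  have "((\<lambda>q. c + (q - 1)^k * ((f q - c) / (q - 1)^k)) \<longlongrightarrow> c + (1 - 1)^k * L) (at 1)"
    by (intro tendsto_intros assms)
  then show "((\<lambda>q. c + (q - 1)^k * ((f q - c) / (q - 1)^k)) \<longlongrightarrow> c) (at 1)"
    using assms(2) by (simp add: zero_power)
qed

text \<open>Except at \<open>Pinf\<close>, the hypotheses involve \<open>T i\<close> and
  \<open>T' i\<close> only through their sum and product, so exchanging the two changes nothing. The
  limits of \<open>n11\<close> and \<open>n22\<close> are interpolated from 0 and \<open>y\<close>,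
  that of \<open>n21\<close> from 0 and 1.\<close>

lemma limits_of_expansions:
  fixes T T' :: "puncture \<Rightarrow> 'a::real_normed_field \<Rightarrow> 'a" and \<theta> S :: "puncture \<Rightarrow> 'a"
  assumes nz: "y \<noteq> 0" "y \<noteq> 1" "y \<noteq> t" "t \<noteq> 0" "t \<noteq> 1" and th: "\<theta> Pinf \<noteq> 0" and l: "l \<noteq> 0"
    and sum: "\<And>i. ((\<lambda>q. (T i q + T' i q - 2) / (q - 1)^2) \<longlongrightarrow> S i) (at 1)"
    and prod: "\<And>i. ((\<lambda>q. (T i q * T' i q - 1) / (q - 1)^2) \<longlongrightarrow> S i - (\<theta> i)^2 / 4) (at 1)"
    and inf: "((\<lambda>q. (T Pinf q - 1) / (q - 1)) \<longlongrightarrow> \<theta> Pinf / 2) (at 1)"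
    and inf': "((\<lambda>q. (T' Pinf q - 1) / (q - 1)) \<longlongrightarrow> - (\<theta> Pinf / 2)) (at 1)"
    and rel: "\<forall>\<^sub>F q in at 1. T P0 q * T' P0 q = T Pinf q * T' Pinf q * T Pt q * T' Pt q * T P1 q * T' P1 q"
  shows "((\<lambda>q. n11 (\<lambda>i. T i q) (\<lambda>i. T' i q) y Z t q x) \<longlongrightarrow> m11 \<theta> y Z t x) (at 1)" (is ?th1)
    and "((\<lambda>q. n22 (\<lambda>i. T i q) (\<lambda>i. T' i q) y Z t q x) \<longlongrightarrow> - m11 \<theta> y Z t x) (at 1)" (is ?th2)
    and "((\<lambda>q. n21 (\<lambda>i. T i q) (\<lambda>i. T' i q) l y Z t q x) \<longlongrightarrow> m21 \<theta> l y Z t x) (at 1)" (is ?th3)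
proof -
  define N11 N22 N21 where "N11 = (\<lambda>x q. n11 (\<lambda>i. T i q) (\<lambda>i. T' i q) y Z t q x)"
    and "N22 = (\<lambda>x q. n22 (\<lambda>i. T i q) (\<lambda>i. T' i q) y Z t q x)"
    and "N21 = (\<lambda>x q. n21 (\<lambda>i. T i q) (\<lambda>i. T' i q) l y Z t q x)"
  define P where "P i = S i - (\<theta> i)^2 / 4" for i
  define s p where "s = (\<lambda>i q. (T i q + T' i q - 2) / (q - 1)^2)"
    and "p = (\<lambda>i q. (T i q * T' i q - 1) / (q - 1)^2)"
  define \<eta> w where "\<eta> = (\<lambda>q. (T Pinf q - T' Pinf q) / (q - 1))" and "w = (y - 1) * (y - t)"
  define r where "r = (\<lambda>q. (pfrak (\<lambda>i. T i q) (\<lambda>i. T' i q) t y - w^2) / (q - 1)^2)"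
  define R where "R = (y - 1)^2 * (t * (t * P Pt - S Pt * y)) + (y - t)^2 * (P P1 - S P1 * y)"
  have w: "w \<noteq> 0" using nz by (simp add: w_def)
  have slim: "(s i \<longlongrightarrow> S i) (at 1)" and plim: "(p i \<longlongrightarrow> P i) (at 1)" for i
    using sum[of i] prod[of i] by (simp_all add: s_def p_def P_def)
  have q1: "\<forall>\<^sub>F q in at (1 :: 'a). q \<noteq> 1" by (simp add: eventually_neq_at_within)
  have T': "(T' Pinf \<longlongrightarrow> 1) (at 1)" and T: "(T Pinf \<longlongrightarrow> 1) (at 1)"
    using tendsto_of_quotient_tendsto[of "T' Pinf" 1 1] inf' tendsto_of_quotient_tendsto[of "T Pinf" 1 1] inf by auto
  have eta: "(\<eta> \<longlongrightarrow> \<theta> Pinf) (at 1)"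
  proof -
    have "((\<lambda>q. (T Pinf q - 1) / (q - 1) - (T' Pinf q - 1) / (q - 1)) \<longlongrightarrow> \<theta> Pinf / 2 - - (\<theta> Pinf / 2)) (at 1)"
      by (intro tendsto_diff inf inf')
    then show ?thesis by (simp add: \<eta>_def diff_divide_distrib[symmetric])
  qed
  have u: "((\<lambda>q. 1 + (q - 1) * y * Z) \<longlongrightarrow> 1) (at 1)"
  proof -
    have "((\<lambda>q. 1 + (q - 1) * y * Z) \<longlongrightarrow> 1 + (1 - 1) * y * Z) (at 1)" by (intro tendsto_intros)
    then show ?thesis by simp
  qed
  have T'0: "\<forall>\<^sub>F q in at 1. T' Pinf q \<noteq> 0" and u0: "\<forall>\<^sub>F q in at 1. 1 + (q - 1) * y * Z \<noteq> 0"
    and eta0: "\<forall>\<^sub>F q in at 1. \<eta> q \<noteq> 0"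
    by (rule tendsto_imp_eventually_ne[OF T' one_neq_zero] tendsto_imp_eventually_ne[OF u one_neq_zero]
        tendsto_imp_eventually_ne[OF eta th])+
  have TT': "\<forall>\<^sub>F q in at 1. T Pinf q \<noteq> T' Pinf q"
    using eta0 by eventually_elim (auto simp: \<eta>_def)
  have rlim: "(r \<longlongrightarrow> R) (at 1)"
  proof (rule Lim_transform_eventually)
    have "((\<lambda>q. (y - 1)^2 * (t * (t * p Pt q - s Pt q * y)) + (y - t)^2 * (p P1 q - s P1 q * y)
        + (q - 1)^2 * (t * (t * p Pt q - s Pt q * y)) * (p P1 q - s P1 q * y)) \<longlongrightarrow>
       (y - 1)^2 * (t * (t * P Pt - S Pt * y)) + (y - t)^2 * (P P1 - S P1 * y)
        + (1 - 1)^2 * (t * (t * P Pt - S Pt * y)) * (P P1 - S P1 * y)) (at 1)"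
      by (intro tendsto_intros slim plim)
    then show "((\<lambda>q. (y - 1)^2 * (t * (t * p Pt q - s Pt q * y)) + (y - t)^2 * (p P1 q - s P1 q * y)
        + (q - 1)^2 * (t * (t * p Pt q - s Pt q * y)) * (p P1 q - s P1 q * y)) \<longlongrightarrow> R) (at 1)"
      by (simp add: R_def)
    show "\<forall>\<^sub>F q in at 1. (y - 1)^2 * (t * (t * p Pt q - s Pt q * y)) + (y - t)^2 * (p P1 q - s P1 q * y)
        + (q - 1)^2 * (t * (t * p Pt q - s Pt q * y)) * (p P1 q - s P1 q * y) = r q"
      using q1 unfolding r_def w_def s_def p_def by eventually_elim (rule pfrak_second_order[symmetric])
  qed
  have pf: "((\<lambda>q. pfrak (\<lambda>i. T i q) (\<lambda>i. T' i q) t y) \<longlongrightarrow> w^2) (at 1)"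
    using tendsto_of_quotient_tendsto[OF rlim[unfolded r_def]] by simp
  \<comment> \<open>Each product is \<open>1 + (q - 1)^2 * p i q\<close>, and the relation among the
    products is compared at second order.\<close>
  have Prel: "P P0 = P Pinf + P Pt + P P1"
  proof (rule tendsto_unique[OF _ plim])
    have lim: "((\<lambda>q. p Pinf q + p Pt q + p P1 q + (q - 1)^2 * (p Pinf q * p Pt q + p Pinf q * p P1 q + p Pt q * p P1 q)
         + (q - 1)^4 * p Pinf q * p Pt q * p P1 q) \<longlongrightarrow>
       P Pinf + P Pt + P P1 + (1 - 1)^2 * (P Pinf * P Pt + P Pinf * P P1 + P Pt * P P1)
         + (1 - 1)^4 * P Pinf * P Pt * P P1) (at 1)"
      by (intro tendsto_intros plim)
    have "\<forall>\<^sub>F q in at 1. p Pinf q + p Pt q + p P1 q + (q - 1)^2 * (p Pinf q * p Pt q + p Pinf q * p P1 q + p Pt q * p P1 q)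
         + (q - 1)^4 * p Pinf q * p Pt q * p P1 q = p P0 q"
      using q1 rel
    proof eventually_elim
      case (elim q)
      have pp: "T i q * T' i q = 1 + (q - 1)^2 * p i q" for i
        using elim by (simp add: p_def)
      have "1 + (q - 1)^2 * p P0 q = (1 + (q - 1)^2 * p Pinf q) * (1 + (q - 1)^2 * p Pt q) * (1 + (q - 1)^2 * p P1 q)"
        using elim(2) unfolding pp[symmetric] by (simp add: mult_ac)
      also have "\<dots> = 1 + (q - 1)^2 * (p Pinf q + p Pt q + p P1 q
         + (q - 1)^2 * (p Pinf q * p Pt q + p Pinf q * p P1 q + p Pt q * p P1 q)
         + (q - 1)^4 * p Pinf q * p Pt q * p P1 q)" by algebra
      finally show ?case using elim by simp
    qed
    from Lim_transform_eventually[OF lim this]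
    show "(p P0 \<longlongrightarrow> P Pinf + P Pt + P P1) (at 1)" by simp
  qed simp
  \<comment> \<open>\<open>h\<close> is the right side of \<open>n11_expansion_0\<close>. Division
    by \<open>\<eta>\<close> is harmless because its limit \<open>\<theta> Pinf\<close> is
    nonzero.\<close>
  have N0: "(N11 0 \<longlongrightarrow> m11 \<theta> y Z t 0) (at 1)"
  proof -
    define h where "h q = (s Pinf q - 2 * p Pinf q) * (w - t) + w * (y * Z) * \<eta> q
      + T' Pinf q * w * ((y * Z)^2 + p Pinf q) / (1 + (q - 1) * y * Z)
      + T' Pinf q * (T Pinf q * T' Pinf q) * r q / (w * (1 + (q - 1) * y * Z))
      + T Pinf q * T' Pinf q * y * (t * s Pt q + s P1 q) - T' Pinf q * t * s P0 q" for q
    have "(h \<longlongrightarrow> (S Pinf - 2 * P Pinf) * (w - t) + w * (y * Z) * \<theta> Pinf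
      + 1 * w * ((y * Z)^2 + P Pinf) / 1 + 1 * (1 * 1) * R / (w * 1)
      + 1 * 1 * y * (t * S Pt + S P1) - 1 * t * S P0) (at 1)"
      unfolding h_def by (intro tendsto_intros slim plim eta rlim T T' u) (use w in simp_all)
    also have "(S Pinf - 2 * P Pinf) * (w - t) + w * (y * Z) * \<theta> Pinf
      + 1 * w * ((y * Z)^2 + P Pinf) / 1 + 1 * (1 * 1) * R / (w * 1)
      + 1 * 1 * y * (t * S Pt + S P1) - 1 * t * S P0 = m11 \<theta> y Z t 0 * \<theta> Pinf"
      using nz(1-3) th Prel unfolding mult_1_left mult_1_right div_by_1 P_def w_def R_def
      by (rule m11_0_limit[where y = y and t = t and \<theta> = \<theta> and S = S and Z = Z])
    finally have "((\<lambda>q. h q / \<eta> q) \<longlongrightarrow> m11 \<theta> y Z t 0 * \<theta> Pinf / \<theta> Pinf) (at 1)"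
      by (intro tendsto_divide eta th)
    moreover have "\<forall>\<^sub>F q in at 1. h q / \<eta> q = N11 0 q"
      using q1 T'0 u0 eta0 TT'
    proof eventually_elim
      case (elim q)
      have "N11 0 q * \<eta> q = h q"
        unfolding N11_def \<eta>_def h_def s_def p_def r_def w_def
        by (rule n11_expansion_0[where y = y and t = t and q = q and Z = Z and \<Theta> = "\<lambda>i. T i q" and \<Theta>' = "\<lambda>i. T' i q"]) (use nz elim in simp_all)
      then show ?case using elim by (simp add: field_simps)
    qed
    ultimately show ?thesis using th by (simp add: Lim_transform_eventually)
  qed
  have Ny: "(N11 y \<longlongrightarrow> m11 \<theta> y Z t y) (at 1)"
  proof (rule tendsto_eventually)
    show "\<forall>\<^sub>F q in at 1. N11 y q = m11 \<theta> y Z t y"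
      using q1 T'0 by eventually_elim (simp add: N11_def n11_at_y m11_def)
  qed
  have N11: "(N11 x \<longlongrightarrow> m11 \<theta> y Z t x) (at 1)" for x
    unfolding N11_def
    by (rule quadratic_tendsto[where ?x1.0 = 0 and ?x2.0 = y, OF quadratic_n_m(1) quadratic_m11(1)[where \<theta> = \<theta> and y = y and Z = Z and t = t, OF th] inf' N0[unfolded N11_def] Ny[unfolded N11_def]])
       (use th nz in auto)
  then show ?th1 by (simp add: N11_def)
  \<comment> \<open>The trace at 0 equals \<open>t * (q - 1) * s P0 q\<close> and therefore tends to
    0.\<close>
  have M0: "(N22 0 \<longlongrightarrow> - m11 \<theta> y Z t 0) (at 1)"
  proof (rule Lim_transform_eventually)
    have "((\<lambda>q. t * ((q - 1) * s P0 q) - N11 0 q) \<longlongrightarrow> t * ((1 - 1) * S P0) - m11 \<theta> y Z t 0) (at 1)"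
      by (intro tendsto_intros slim N0)
    then show "((\<lambda>q. t * ((q - 1) * s P0 q) - N11 0 q) \<longlongrightarrow> - m11 \<theta> y Z t 0) (at 1)" by simp
    show "\<forall>\<^sub>F q in at 1. t * ((q - 1) * s P0 q) - N11 0 q = N22 0 q"
      using q1 TT'
    proof eventually_elim
      case (elim q)
      have "N11 0 q + N22 0 q = t * (T P0 q + T' P0 q - 2) / (q - 1)"
        unfolding N11_def N22_def by (rule n_trace_0[where y = y and t = t and q = q and Z = Z and \<Theta> = "\<lambda>i. T i q" and \<Theta>' = "\<lambda>i. T' i q"]) (use nz elim in simp_all)
      also have "\<dots> = t * ((q - 1) * s P0 q)" by (simp add: s_def power2_eq_square)
      finally show ?case by (simp add: algebra_simps)
    qed
  qed
  have My: "(N22 y \<longlongrightarrow> - m11 \<theta> y Z t y) (at 1)"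
  proof (rule Lim_transform_eventually)
    let ?h = "\<lambda>q. - (w * (y * Z)) / (1 + (q - 1) * y * Z)
      + (q - 1) * (r q + p Pinf q * pfrak (\<lambda>i. T i q) (\<lambda>i. T' i q) t y) / (w * (1 + (q - 1) * y * Z))"
    have "(?h \<longlongrightarrow> - (w * (y * Z)) / 1 + (1 - 1) * (R + P Pinf * w^2) / (w * 1)) (at 1)"
      by (intro tendsto_intros plim rlim pf u) (use w in simp_all)
    then show "(?h \<longlongrightarrow> - m11 \<theta> y Z t y) (at 1)" by (simp add: m11_def w_def mult_ac)
    show "\<forall>\<^sub>F q in at 1. ?h q = N22 y q"
      using q1 T'0 u0 unfolding N22_def r_def p_def w_def
      by eventually_elim (rule n22_at_y[where \<Theta> = "\<lambda>i. T i q" and \<Theta>' = "\<lambda>i. T' i q" for q, symmetric], use nz in simp_all)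
  qed
  have N22: "(N22 x \<longlongrightarrow> - m11 \<theta> y Z t x) (at 1)" for x
    unfolding N22_def
    by (rule quadratic_tendsto[where ?x1.0 = 0 and ?x2.0 = y, OF quadratic_n_m(2) quadratic_m11(2)[where \<theta> = \<theta> and y = y and Z = Z and t = t, OF th] inf M0[unfolded N22_def] My[unfolded N22_def]])
       (use th nz in auto)
  then show ?th2 by (simp add: N22_def)
  define d where "d = (\<lambda>i q. (T i q - 1) * (T' i q - 1) / (q - 1)^2)"
  \<comment> \<open>\<open>(a - 1) * (b - 1)\<close> is \<open>a * b - 1\<close> minus
    \<open>a + b - 2\<close>, so the second-order coefficients \<open>S i\<close> cancel.\<close>
  have dlim: "(d i \<longlongrightarrow> - ((\<theta> i)^2 / 4)) (at 1)" for i
  proof -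
    have "((\<lambda>q. p i q - s i q) \<longlongrightarrow> P i - S i) (at 1)" by (intro tendsto_intros slim plim)
    moreover have "p i q - s i q = d i q" for q
      unfolding p_def s_def d_def diff_divide_distrib[symmetric] by (simp add: algebra_simps)
    ultimately show ?thesis by (simp add: P_def)
  qed
  have key: "\<forall>\<^sub>F q in at 1.
      N11 0 q * N22 0 q - l * (0 - y) * N21 0 q = t^2 * d P0 q \<and>
      N11 1 q * N22 1 q - l * (1 - y) * N21 1 q = T Pinf q * T' Pinf q * ((1 - t * T Pt q) * (1 - t * T' Pt q)) * d P1 q"
    using q1 T'0 u0 TT' rel
  proof eventually_elim
    case (elim q)
    show ?case
      unfolding N11_def N22_def N21_def d_def
      using nz elim l
        n_det_special(1,2)[where y = y and t = t and q = q and Z = Z and \<Theta> = "\<lambda>i. T i q" and \<Theta>' = "\<lambda>i. T' i q" and l = l]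
      by simp
  qed
  \<comment> \<open>The determinant equation at 0 is solved for \<open>n21\<close>, whose factor
    \<open>l * (0 - y)\<close> is nonzero.\<close>
  have O0: "(N21 0 \<longlongrightarrow> m21 \<theta> l y Z t 0) (at 1)"
  proof (rule Lim_transform_eventually)
    have "((\<lambda>q. (N11 0 q * N22 0 q - t^2 * d P0 q) / (l * (0 - y))) \<longlongrightarrow>
        (m11 \<theta> y Z t 0 * - m11 \<theta> y Z t 0 - t^2 * - ((\<theta> P0)^2 / 4)) / (l * (0 - y))) (at 1)"
      by (intro tendsto_intros N11 N22 dlim) (use l nz in simp)
    also have "(m11 \<theta> y Z t 0 * - m11 \<theta> y Z t 0 - t^2 * - ((\<theta> P0)^2 / 4)) / (l * (0 - y)) = m21 \<theta> l y Z t 0"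
      using m_det(1)[of y t \<theta> l Z] nz th l by (simp add: field_simps)
    finally show "((\<lambda>q. (N11 0 q * N22 0 q - t^2 * d P0 q) / (l * (0 - y))) \<longlongrightarrow> m21 \<theta> l y Z t 0) (at 1)" .
    show "\<forall>\<^sub>F q in at 1. (N11 0 q * N22 0 q - t^2 * d P0 q) / (l * (0 - y)) = N21 0 q"
      using key by eventually_elim (use l nz in \<open>simp add: field_simps\<close>)
  qed
  have O1: "(N21 1 \<longlongrightarrow> m21 \<theta> l y Z t 1) (at 1)"
  proof (rule Lim_transform_eventually)
    let ?g = "\<lambda>q. T Pinf q * T' Pinf q * ((1 - t * T Pt q) * (1 - t * T' Pt q))"
    \<comment> \<open>Away from \<open>Pinf\<close> the hypotheses control only sum and product, so
      the factor \<open>?g\<close> is expanded in these.\<close>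
    have "((\<lambda>q. T i q + T' i q) \<longlongrightarrow> 2) (at 1)" "((\<lambda>q. T i q * T' i q) \<longlongrightarrow> 1) (at 1)" for i
      using tendsto_of_quotient_tendsto[OF sum[of i]] tendsto_of_quotient_tendsto[OF prod[of i]] by simp_all
    then have "((\<lambda>q. T Pinf q * T' Pinf q * (1 - t * (T Pt q + T' Pt q) + t^2 * (T Pt q * T' Pt q))) \<longlongrightarrow>
        1 * 1 * (1 - t * 2 + t^2 * 1)) (at 1)"
      by (intro tendsto_intros T T')
    then have g: "(?g \<longlongrightarrow> (1 - t)^2) (at 1)"
      by (simp add: algebra_simps power2_eq_square)
    have "((\<lambda>q. (N11 1 q * N22 1 q - ?g q * d P1 q) / (l * (1 - y))) \<longlongrightarrow>
        (m11 \<theta> y Z t 1 * - m11 \<theta> y Z t 1 - (1 - t)^2 * - ((\<theta> P1)^2 / 4)) / (l * (1 - y))) (at 1)"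
      by (intro tendsto_intros N11 N22 dlim g) (use l nz in simp)
    also have "(m11 \<theta> y Z t 1 * - m11 \<theta> y Z t 1 - (1 - t)^2 * - ((\<theta> P1)^2 / 4)) / (l * (1 - y)) = m21 \<theta> l y Z t 1"
    proof -
      have "m11 \<theta> y Z t 1 * - m11 \<theta> y Z t 1 - (1 - t)^2 * - ((\<theta> P1)^2 / 4) = l * (1 - y) * m21 \<theta> l y Z t 1"
        using m_det(2)[of y t \<theta> l Z] nz th l by algebra
      then show ?thesis using nz l by simp
    qed
    finally show "((\<lambda>q. (N11 1 q * N22 1 q - ?g q * d P1 q) / (l * (1 - y))) \<longlongrightarrow> m21 \<theta> l y Z t 1) (at 1)" .
    show "\<forall>\<^sub>F q in at 1. (N11 1 q * N22 1 q - ?g q * d P1 q) / (l * (1 - y)) = N21 1 q"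
      using key
    proof eventually_elim
      case (elim q)
      then have "N11 1 q * N22 1 q - ?g q * d P1 q = l * (1 - y) * N21 1 q" by algebra
      then show ?case using nz l by simp
    qed
  qed
  show ?th3
    using quadratic_tendsto[OF quadratic_n_m(3) quadratic_n_m(4) tendsto_const O0[unfolded N21_def] O1[unfolded N21_def]]
    by simp
qed

section \<open>From the limits back to the expansions\<close>

text \<open>The leading terms cancel, so \<open>g\<close> has degree at most 3 in \<open>x\<close>.
  Its third difference over -1, 0, 1, 2 and its second difference over -1, 0, 1 isolate the
  coefficients of \<open>x^3\<close> and \<open>x^2\<close>.\<close>

lemma pfrak_cubic_difference:
  fixes \<Theta> \<Theta>' :: "puncture \<Rightarrow> 'a::field" and t :: 'a
  defines "g \<equiv> \<lambda>x. pfrak \<Theta> \<Theta>' t x - ((x - 1) * (x - t))^2"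
  shows "6 * (t * (\<Theta> Pt + \<Theta>' Pt - 2) + (\<Theta> P1 + \<Theta>' P1 - 2)) = g (- 1) - 3 * g 0 + 3 * g 1 - g 2"
    "2 * (t^2 * (\<Theta> Pt * \<Theta>' Pt - 1) + (\<Theta> P1 * \<Theta>' P1 - 1) + t * ((\<Theta> Pt + \<Theta>' Pt) * (\<Theta> P1 + \<Theta>' P1) - 4))
       = g 1 + g (- 1) - 2 * g 0"
  subgoal unfolding g_def pfrak_def by (simp add: algebra_simps power2_eq_square)
  subgoal unfolding g_def pfrak_def by (simp add: algebra_simps power2_eq_square)
  done

text \<open>The last four limits combine the parameters at \<open>P1\<close> and \<open>Pt\<close>.
  A single \<open>t\<close> does not separate them here; \<open>expansions_two_values\<close> does
  so with a second value.\<close>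

lemma expansions_of_limits:
  fixes T T' :: "puncture \<Rightarrow> 'a::real_normed_field \<Rightarrow> 'a" and \<theta> :: "puncture \<Rightarrow> 'a"
  assumes nz: "y \<noteq> 0" "y \<noteq> 1" "y \<noteq> t" "t \<noteq> 0" "t \<noteq> 1" and th: "\<theta> Pinf \<noteq> 0" and l: "l \<noteq> 0"
    and rel: "\<forall>\<^sub>F q in at 1. T P0 q * T' P0 q = T Pinf q * T' Pinf q * T Pt q * T' Pt q * T P1 q * T' P1 q"
    and lim11: "\<And>x. x \<in> X \<Longrightarrow> ((\<lambda>q. n11 (\<lambda>i. T i q) (\<lambda>i. T' i q) y Z t q x) \<longlongrightarrow> m11 \<theta> y Z t x) (at 1)"
    and lim22: "\<And>x. x \<in> X \<Longrightarrow> ((\<lambda>q. n22 (\<lambda>i. T i q) (\<lambda>i. T' i q) y Z t q x) \<longlongrightarrow> - m11 \<theta> y Z t x) (at 1)"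
    and lim21: "\<And>x. x \<in> X \<Longrightarrow> ((\<lambda>q. n21 (\<lambda>i. T i q) (\<lambda>i. T' i q) l y Z t q x) \<longlongrightarrow> m21 \<theta> l y Z t x) (at 1)"
    and X: "x1 \<in> X" "x2 \<in> X" "x3 \<in> X" and ne: "x1 \<noteq> x2" "x1 \<noteq> x3" "x2 \<noteq> x3"
  defines "d \<equiv> \<lambda>i q. (T i q - 1) * (T' i q - 1) / (q - 1)^2"
    and "\<sigma> \<equiv> \<lambda>i q. T i q + T' i q - 2"
  shows "((\<lambda>q. (T Pinf q - 1) / (q - 1)) \<longlongrightarrow> \<theta> Pinf / 2) (at 1)"
    "((\<lambda>q. (T' Pinf q - 1) / (q - 1)) \<longlongrightarrow> - (\<theta> Pinf / 2)) (at 1)"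
    "((\<lambda>q. \<sigma> P0 q / (q - 1)) \<longlongrightarrow> 0) (at 1)"
    "(d P0 \<longlongrightarrow> - ((\<theta> P0)^2 / 4)) (at 1)"
    "((\<lambda>q. (1 - t * T Pt q) * (1 - t * T' Pt q) * d P1 q) \<longlongrightarrow> (1 - t)^2 * (- ((\<theta> P1)^2 / 4))) (at 1)"
    "((\<lambda>q. (t - T P1 q) * (t - T' P1 q) * d Pt q) \<longlongrightarrow> (t - 1)^2 * (- ((\<theta> Pt)^2 / 4))) (at 1)"
    "((\<lambda>q. (t * \<sigma> Pt q + \<sigma> P1 q) / (q - 1)) \<longlongrightarrow> 0) (at 1)"
    "((\<lambda>q. t^2 * (T Pt q * T' Pt q - 1) + (T P1 q * T' P1 q - 1)
        + t * ((T Pt q + T' Pt q) * (T P1 q + T' P1 q) - 4)) \<longlongrightarrow> 0) (at 1)"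
proof -
  define N11 N22 N21 where "N11 = (\<lambda>x q. n11 (\<lambda>i. T i q) (\<lambda>i. T' i q) y Z t q x)"
    and "N22 = (\<lambda>x q. n22 (\<lambda>i. T i q) (\<lambda>i. T' i q) y Z t q x)"
    and "N21 = (\<lambda>x q. n21 (\<lambda>i. T i q) (\<lambda>i. T' i q) l y Z t q x)"
  define p where "p = (\<lambda>x q. pfrak (\<lambda>i. T i q) (\<lambda>i. T' i q) t x)"
  define P where "P = (\<lambda>q. T Pinf q * T' Pinf q)"
  have q1: "\<forall>\<^sub>F q in at (1 :: 'a). q \<noteq> 1" by (simp add: eventually_neq_at_within)
  note quad_m = quadratic_m11[where \<theta> = \<theta> and y = y and Z = Z and t = t, OF th]
  show inf: "((\<lambda>q. (T Pinf q - 1) / (q - 1)) \<longlongrightarrow> \<theta> Pinf / 2) (at 1)"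
    by (rule quadratic_leading_coeff_tendsto[OF quadratic_n_m(2) quad_m(2) lim22 X ne])
  show inf': "((\<lambda>q. (T' Pinf q - 1) / (q - 1)) \<longlongrightarrow> - (\<theta> Pinf / 2)) (at 1)"
    by (rule quadratic_leading_coeff_tendsto[OF quadratic_n_m(1) quad_m(1) lim11 X ne])
  \<comment> \<open>With the leading coefficients known, two points of \<open>X\<close> give the
    limit at every \<open>x\<close>, in particular at the poles 0, 1, \<open>t\<close>.\<close>
  have N11: "(N11 x \<longlongrightarrow> m11 \<theta> y Z t x) (at 1)" for x
    unfolding N11_def
    by (rule quadratic_tendsto[OF quadratic_n_m(1) quad_m(1) inf' lim11[OF X(1)] lim11[OF X(2)] ne(1)])
  have N22: "(N22 x \<longlongrightarrow> - m11 \<theta> y Z t x) (at 1)" for x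
    unfolding N22_def
    by (rule quadratic_tendsto[OF quadratic_n_m(2) quad_m(2) inf lim22[OF X(1)] lim22[OF X(2)] ne(1)])
  have N21: "(N21 x \<longlongrightarrow> m21 \<theta> l y Z t x) (at 1)" for x
    unfolding N21_def
    by (rule quadratic_tendsto[OF quadratic_n_m(3) quadratic_n_m(4) tendsto_const lim21[OF X(1)] lim21[OF X(2)] ne(1)])
  have T': "(T' Pinf \<longlongrightarrow> 1) (at 1)" and T: "(T Pinf \<longlongrightarrow> 1) (at 1)"
    using tendsto_of_quotient_tendsto[of "T' Pinf" 1 1] inf' tendsto_of_quotient_tendsto[of "T Pinf" 1 1] inf by auto
  have Plim: "(P \<longlongrightarrow> 1) (at 1)"
    using tendsto_mult[OF T T'] by (simp add: P_def)
  have "((\<lambda>q. (T Pinf q - 1) / (q - 1) - (T' Pinf q - 1) / (q - 1)) \<longlongrightarrow> \<theta> Pinf / 2 - - (\<theta> Pinf / 2)) (at 1)"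
    by (intro tendsto_diff inf inf')
  then have eta: "((\<lambda>q. (T Pinf q - T' Pinf q) / (q - 1)) \<longlongrightarrow> \<theta> Pinf) (at 1)"
    by (simp add: diff_divide_distrib[symmetric])
  have TT': "\<forall>\<^sub>F q in at 1. T Pinf q \<noteq> T' Pinf q"
    using tendsto_imp_eventually_ne[OF eta th] by eventually_elim auto
  have u: "((\<lambda>q. 1 + (q - 1) * y * Z) \<longlongrightarrow> 1) (at 1)"
  proof -
    have "((\<lambda>q. 1 + (q - 1) * y * Z) \<longlongrightarrow> 1 + (1 - 1) * y * Z) (at 1)" by (intro tendsto_intros)
    then show ?thesis by simp
  qed
  have T'0: "\<forall>\<^sub>F q in at 1. T' Pinf q \<noteq> 0" and u0: "\<forall>\<^sub>F q in at 1. 1 + (q - 1) * y * Z \<noteq> 0"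
    and P0: "\<forall>\<^sub>F q in at 1. P q \<noteq> 0"
    by (rule tendsto_imp_eventually_ne[OF T' one_neq_zero] tendsto_imp_eventually_ne[OF u one_neq_zero]
        tendsto_imp_eventually_ne[OF Plim one_neq_zero])+
  show "((\<lambda>q. \<sigma> P0 q / (q - 1)) \<longlongrightarrow> 0) (at 1)"
  proof (rule Lim_transform_eventually)
    have "((\<lambda>q. (N11 0 q + N22 0 q) / t) \<longlongrightarrow> (m11 \<theta> y Z t 0 + - m11 \<theta> y Z t 0) / t) (at 1)"
      by (intro tendsto_intros N11 N22) (use nz in simp)
    then show "((\<lambda>q. (N11 0 q + N22 0 q) / t) \<longlongrightarrow> 0) (at 1)" by simp
    show "\<forall>\<^sub>F q in at 1. (N11 0 q + N22 0 q) / t = \<sigma> P0 q / (q - 1)"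
      using q1 TT'
    proof eventually_elim
      case (elim q)
      have "N11 0 q + N22 0 q = t * (T P0 q + T' P0 q - 2) / (q - 1)"
        unfolding N11_def N22_def
        by (rule n_trace_0[where y = y and t = t and q = q and Z = Z and \<Theta> = "\<lambda>i. T i q" and \<Theta>' = "\<lambda>i. T' i q"])
           (use nz elim in simp_all)
      then show ?case using nz by (simp add: \<sigma>_def)
    qed
  qed
  define D where "D = (\<lambda>x q. N11 x q * N22 x q - l * (x - y) * N21 x q)"
  have D: "(D x \<longlongrightarrow> - (m11 \<theta> y Z t x * m11 \<theta> y Z t x + l * (x - y) * m21 \<theta> l y Z t x)) (at 1)" for x
  proof -
    have "(D x \<longlongrightarrow> m11 \<theta> y Z t x * - m11 \<theta> y Z t x - l * (x - y) * m21 \<theta> l y Z t x) (at 1)"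
      unfolding D_def by (intro tendsto_intros N11 N22 N21)
    then show ?thesis by simp
  qed
  have key: "\<forall>\<^sub>F q in at 1. D 0 q = t^2 * d P0 q \<and>
      D 1 q = P q * ((1 - t * T Pt q) * (1 - t * T' Pt q)) * d P1 q \<and>
      D t q = P q * ((t - T P1 q) * (t - T' P1 q)) * (t^2 * d Pt q)"
    using q1 T'0 u0 TT' rel
  proof eventually_elim
    case (elim q)
    show ?case
      unfolding D_def N11_def N22_def N21_def d_def P_def using nz elim l
        n_det_special[where y = y and t = t and q = q and Z = Z and \<Theta> = "\<lambda>i. T i q" and \<Theta>' = "\<lambda>i. T' i q" and l = l]
      by simp
  qed
  have mdet: "m11 \<theta> y Z t 0 * m11 \<theta> y Z t 0 + l * (0 - y) * m21 \<theta> l y Z t 0 = t^2 * (\<theta> P0)^2 / 4"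
    "m11 \<theta> y Z t 1 * m11 \<theta> y Z t 1 + l * (1 - y) * m21 \<theta> l y Z t 1 = (1 - t)^2 * (\<theta> P1)^2 / 4"
    "m11 \<theta> y Z t t * m11 \<theta> y Z t t + l * (t - y) * m21 \<theta> l y Z t t = t^2 * (t - 1)^2 * (\<theta> Pt)^2 / 4"
    using m_det[where y = y and t = t and \<theta> = \<theta> and l = l and Z = Z] nz th l by blast+
  show "(d P0 \<longlongrightarrow> - ((\<theta> P0)^2 / 4)) (at 1)"
  proof (rule Lim_transform_eventually)
    have "((\<lambda>q. D 0 q / t^2) \<longlongrightarrow> - (t^2 * (\<theta> P0)^2 / 4) / t^2) (at 1)"
      unfolding mdet(1)[symmetric] by (intro tendsto_divide D tendsto_const) (use nz in simp)
    then show "((\<lambda>q. D 0 q / t^2) \<longlongrightarrow> - ((\<theta> P0)^2 / 4)) (at 1)" using nz by simp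
    show "\<forall>\<^sub>F q in at 1. D 0 q / t^2 = d P0 q"
      using key by eventually_elim (use nz in simp)
  qed
  show "((\<lambda>q. (1 - t * T Pt q) * (1 - t * T' Pt q) * d P1 q) \<longlongrightarrow> (1 - t)^2 * (- ((\<theta> P1)^2 / 4))) (at 1)"
  proof (rule Lim_transform_eventually)
    have "((\<lambda>q. D 1 q / P q) \<longlongrightarrow> - ((1 - t)^2 * (\<theta> P1)^2 / 4) / 1) (at 1)"
      unfolding mdet(2)[symmetric] by (intro tendsto_divide D Plim) simp
    then show "((\<lambda>q. D 1 q / P q) \<longlongrightarrow> (1 - t)^2 * (- ((\<theta> P1)^2 / 4))) (at 1)" by simp
    show "\<forall>\<^sub>F q in at 1. D 1 q / P q = (1 - t * T Pt q) * (1 - t * T' Pt q) * d P1 q"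
      using key P0 by eventually_elim simp
  qed
  show "((\<lambda>q. (t - T P1 q) * (t - T' P1 q) * d Pt q) \<longlongrightarrow> (t - 1)^2 * (- ((\<theta> Pt)^2 / 4))) (at 1)"
  proof (rule Lim_transform_eventually)
    have "((\<lambda>q. D t q / (P q * t^2)) \<longlongrightarrow> - (t^2 * (t - 1)^2 * (\<theta> Pt)^2 / 4) / (1 * t^2)) (at 1)"
      unfolding mdet(3)[symmetric] by (intro tendsto_divide tendsto_mult D Plim tendsto_const) (use nz in simp)
    then show "((\<lambda>q. D t q / (P q * t^2)) \<longlongrightarrow> (t - 1)^2 * (- ((\<theta> Pt)^2 / 4))) (at 1)" using nz by simp
    show "\<forall>\<^sub>F q in at 1. D t q / (P q * t^2) = (t - T P1 q) * (t - T' P1 q) * d Pt q"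
      using key P0 by eventually_elim (use nz in simp)
  qed
  define g where "g = (\<lambda>x q. p x q - ((x - 1) * (x - t))^2)"
  \<comment> \<open>\<open>n_det\<close> is read as a formula for \<open>pfrak\<close>. The trace
    tends to 0 and \<open>P q - 1\<close> is of smaller order than \<open>q - 1\<close>, so the
    deviation of \<open>pfrak\<close> from \<open>((x - 1) * (x - t))^2\<close> is also of smaller
    order than \<open>q - 1\<close>.\<close>
  have glim: "((\<lambda>q. g x q / (q - 1)) \<longlongrightarrow> 0) (at 1)" for x
  proof (rule Lim_transform_eventually)
    define W where "W = (x - 1) * (x - t)"
    let ?h = "\<lambda>q. ((q - 1) * D x q + W * (N11 x q + N22 x q)
      - W^2 * ((T Pinf q - 1) / (q - 1) + (T' Pinf q - 1) / (q - 1)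
          + (q - 1) * ((T Pinf q - 1) / (q - 1) * ((T' Pinf q - 1) / (q - 1))))) / P q"
    have "(?h \<longlongrightarrow> ((1 - 1) * - (m11 \<theta> y Z t x * m11 \<theta> y Z t x + l * (x - y) * m21 \<theta> l y Z t x)
       + W * (m11 \<theta> y Z t x + - m11 \<theta> y Z t x)
      - W^2 * (\<theta> Pinf / 2 + - (\<theta> Pinf / 2) + (1 - 1) * (\<theta> Pinf / 2 * - (\<theta> Pinf / 2)))) / 1) (at 1)"
      by (intro tendsto_intros D N11 N22 inf inf' Plim) simp
    then show "(?h \<longlongrightarrow> 0) (at 1)" by simp
    show "\<forall>\<^sub>F q in at 1. ?h q = g x q / (q - 1)"
      using q1 T'0 u0 P0
    proof eventually_elim
      case (elim q)
      have "D x q = (P q * p x q - W^2) / (q - 1)^2 - W * (N11 x q + N22 x q) / (q - 1)"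
        unfolding D_def N11_def N22_def N21_def p_def P_def W_def
        by (rule n_det[where y = y and t = t and q = q and Z = Z and \<Theta> = "\<lambda>i. T i q" and \<Theta>' = "\<lambda>i. T' i q" and l = l])
           (use nz elim l in simp_all)
      then have 1: "(q - 1) * D x q + W * (N11 x q + N22 x q) = (P q * p x q - W^2) / (q - 1)"
      proof -
        have "e * (A / e^2 - B / e) + B = A / e" if "e \<noteq> 0" for e A B :: 'a
          using that by (simp add: right_diff_distrib power2_eq_square)
        then show ?thesis using elim(1) \<open>D x q = _\<close> by simp
      qed
      have 2: "(T Pinf q - 1) / (q - 1) + (T' Pinf q - 1) / (q - 1)
          + (q - 1) * ((T Pinf q - 1) / (q - 1) * ((T' Pinf q - 1) / (q - 1))) = (P q - 1) / (q - 1)"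
      proof -
        have "a / e + b / e + e * (a / e * (b / e)) = (a + b + a * b) / e" if "e \<noteq> 0" for a b e :: 'a
          using that by (simp add: add_divide_distrib)
        then have "(T Pinf q - 1) / (q - 1) + (T' Pinf q - 1) / (q - 1)
          + (q - 1) * ((T Pinf q - 1) / (q - 1) * ((T' Pinf q - 1) / (q - 1)))
          = (T Pinf q - 1 + (T' Pinf q - 1) + (T Pinf q - 1) * (T' Pinf q - 1)) / (q - 1)"
          using elim(1) by simp
        also have "T Pinf q - 1 + (T' Pinf q - 1) + (T Pinf q - 1) * (T' Pinf q - 1) = P q - 1"
          unfolding P_def by algebra
        finally show ?thesis .
      qed
      have "?h q = ((P q * p x q - W^2) / (q - 1) - W^2 * ((P q - 1) / (q - 1))) / P q"
        unfolding 1 2 ..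
      also have "\<dots> = (P q * (p x q - W^2)) / (q - 1) / P q"
        by (simp add: diff_divide_distrib[symmetric] algebra_simps)
      also have "\<dots> = g x q / (q - 1)" using elim by (simp add: g_def W_def)
      finally show ?case .
    qed
  qed
  show "((\<lambda>q. (t * \<sigma> Pt q + \<sigma> P1 q) / (q - 1)) \<longlongrightarrow> 0) (at 1)"
  proof -
    have "((\<lambda>q. (g (- 1) q / (q - 1) - 3 * (g 0 q / (q - 1)) + 3 * (g 1 q / (q - 1)) - g 2 q / (q - 1)) / 6) \<longlongrightarrow>
        (0 - 3 * 0 + 3 * 0 - 0) / 6) (at 1)"
      by (intro tendsto_intros glim) simp
    moreover have "(g (- 1) q / (q - 1) - 3 * (g 0 q / (q - 1)) + 3 * (g 1 q / (q - 1)) - g 2 q / (q - 1)) / 6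
        = (t * \<sigma> Pt q + \<sigma> P1 q) / (q - 1)" for q
    proof -
      have "6 * (t * \<sigma> Pt q + \<sigma> P1 q) = g (- 1) q - 3 * g 0 q + 3 * g 1 q - g 2 q"
        unfolding \<sigma>_def g_def p_def by (rule pfrak_cubic_difference)
      then have "t * \<sigma> Pt q + \<sigma> P1 q = (g (- 1) q - 3 * g 0 q + 3 * g 1 q - g 2 q) / 6"
        by (metis nonzero_mult_div_cancel_left zero_neq_numeral)
      moreover have "(a / e - 3 * (b / e) + 3 * (c / e) - d / e) / 6 = (a - 3 * b + 3 * c - d) / 6 / e" for a b c d e :: 'a
        by (simp add: diff_divide_distrib add_divide_distrib mult.commute)
      ultimately show ?thesis by (simp only:)
    qed
    ultimately have "((\<lambda>q. (t * \<sigma> Pt q + \<sigma> P1 q) / (q - 1)) \<longlongrightarrow> (0 - 3 * 0 + 3 * 0 - 0) / 6) (at 1)"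
      by (simp only:)
    then show ?thesis by simp
  qed
  have g0: "(g x \<longlongrightarrow> 0) (at 1)" for x
    using tendsto_of_quotient_tendsto[of "g x" 0 1 0] glim[of x] by simp
  show "((\<lambda>q. t^2 * (T Pt q * T' Pt q - 1) + (T P1 q * T' P1 q - 1)
        + t * ((T Pt q + T' Pt q) * (T P1 q + T' P1 q) - 4)) \<longlongrightarrow> 0) (at 1)"
  proof -
    have "((\<lambda>q. (g 1 q + g (- 1) q - 2 * g 0 q) / 2) \<longlongrightarrow> (0 + 0 - 2 * 0) / 2) (at 1)"
      by (intro tendsto_intros g0) simp
    moreover have "(g 1 q + g (- 1) q - 2 * g 0 q) / 2 = t^2 * (T Pt q * T' Pt q - 1) + (T P1 q * T' P1 q - 1)
        + t * ((T Pt q + T' Pt q) * (T P1 q + T' P1 q) - 4)" for q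
    proof -
      have "2 * (t^2 * (T Pt q * T' Pt q - 1) + (T P1 q * T' P1 q - 1)
        + t * ((T Pt q + T' Pt q) * (T P1 q + T' P1 q) - 4)) = g 1 q + g (- 1) q - 2 * g 0 q"
        unfolding g_def p_def by (rule pfrak_cubic_difference)
      then show ?thesis by (metis nonzero_mult_div_cancel_left zero_neq_numeral)
    qed
    ultimately have "((\<lambda>q. t^2 * (T Pt q * T' Pt q - 1) + (T P1 q * T' P1 q - 1)
        + t * ((T Pt q + T' Pt q) * (T P1 q + T' P1 q) - 4)) \<longlongrightarrow> (0 + 0 - 2 * 0) / 2) (at 1)"
      by (simp only:)
    then show ?thesis by simp
  qed
qed

lemma tendsto_divide_const_iff:
  fixes f :: "'b \<Rightarrow> 'a::real_normed_field"
  assumes "c \<noteq> 0"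
  shows "((\<lambda>q. f q / c) \<longlongrightarrow> L / c) F \<longleftrightarrow> (f \<longlongrightarrow> L) F"
proof
  assume "((\<lambda>q. f q / c) \<longlongrightarrow> L / c) F"
  then have "((\<lambda>q. f q / c * c) \<longlongrightarrow> L / c * c) F" by (rule tendsto_mult_right)
  then show "(f \<longlongrightarrow> L) F" using assms by simp
next
  assume "(f \<longlongrightarrow> L) F"
  then show "((\<lambda>q. f q / c) \<longlongrightarrow> L / c) F" by (intro tendsto_divide tendsto_const assms)
qed

text \<open>The entry \<open>(1,2)\<close> equals its limit for all \<open>q \<noteq> 1\<close> and
  imposes nothing. In the others the denominator is nonzero and does not depend on
  \<open>q\<close>.\<close>

lemma Afrak_tilde_tendsto_iff:
  fixes T T' :: "puncture \<Rightarrow> 'a::real_normed_field \<Rightarrow> 'a"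
  assumes x: "x \<noteq> 0" "x \<noteq> 1" "x \<noteq> t" "x \<noteq> y" and th: "\<theta> Pinf \<noteq> 0"
  shows "(\<forall>i j. ((\<lambda>q. Afrak_tilde (\<lambda>i. T i q) (\<lambda>i. T' i q) l y Z t q x $ i $ j) \<longlongrightarrow> Amat \<theta> l y Z t x $ i $ j) (at 1))
    \<longleftrightarrow> ((\<lambda>q. n11 (\<lambda>i. T i q) (\<lambda>i. T' i q) y Z t q x) \<longlongrightarrow> m11 \<theta> y Z t x) (at 1) \<and>
       ((\<lambda>q. n22 (\<lambda>i. T i q) (\<lambda>i. T' i q) y Z t q x) \<longlongrightarrow> - m11 \<theta> y Z t x) (at 1) \<and>
       ((\<lambda>q. n21 (\<lambda>i. T i q) (\<lambda>i. T' i q) l y Z t q x) \<longlongrightarrow> m21 \<theta> l y Z t x) (at 1)"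
proof -
  have q1: "\<forall>\<^sub>F q in at (1 :: 'a). q \<noteq> 1" by (simp add: eventually_neq_at_within)
  have c: "x * (x - 1) * (x - t) \<noteq> 0" using x by simp
  let ?A = "\<lambda>q. Afrak_tilde (\<lambda>i. T i q) (\<lambda>i. T' i q) l y Z t q x"
  have e11: "((\<lambda>q. ?A q $ 1 $ 1) \<longlongrightarrow> L) (at 1) \<longleftrightarrow> ((\<lambda>q. n11 (\<lambda>i. T i q) (\<lambda>i. T' i q) y Z t q x / (x * (x - 1) * (x - t))) \<longlongrightarrow> L) (at 1)" for L
    by (rule tendsto_cong) (use q1 in eventually_elim, use x in \<open>simp add: Afrak_tilde_entries\<close>)
  have e12: "((\<lambda>q. ?A q $ 1 $ 2) \<longlongrightarrow> L) (at 1) \<longleftrightarrow> ((\<lambda>q :: 'a. l * (x - y) / (x * (x - 1) * (x - t))) \<longlongrightarrow> L) (at 1)" for L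
    by (rule tendsto_cong) (use q1 in eventually_elim, use x in \<open>simp add: Afrak_tilde_entries\<close>)
  have e21: "((\<lambda>q. ?A q $ 2 $ 1) \<longlongrightarrow> L) (at 1) \<longleftrightarrow> ((\<lambda>q. n21 (\<lambda>i. T i q) (\<lambda>i. T' i q) l y Z t q x / (x * (x - 1) * (x - t))) \<longlongrightarrow> L) (at 1)" for L
    by (rule tendsto_cong) (use q1 in eventually_elim, use x in \<open>simp add: Afrak_tilde_entries\<close>)
  have e22: "((\<lambda>q. ?A q $ 2 $ 2) \<longlongrightarrow> L) (at 1) \<longleftrightarrow> ((\<lambda>q. n22 (\<lambda>i. T i q) (\<lambda>i. T' i q) y Z t q x / (x * (x - 1) * (x - t))) \<longlongrightarrow> L) (at 1)" for L
    by (rule tendsto_cong) (use q1 in eventually_elim, use x in \<open>simp add: Afrak_tilde_entries\<close>)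
  show ?thesis
    unfolding forall_2 Amat_entries[OF x(1,2,3,4), where \<theta> = \<theta>, OF th] e11 e12 e21 e22 tendsto_divide_const_iff[OF c]
    by (simp only: tendsto_const simp_thms conj_commute conj_left_commute)
qed

text \<open>The sums enter affinely in \<open>t\<close> and, once they are known, the products enter
  affinely in \<open>t^2\<close>; this explains \<open>t1 \<noteq> t2\<close> and
  \<open>t1 \<noteq> - t2\<close>. The remaining condition permits division by
  \<open>(1 - t1)^2\<close>.\<close>

lemma expansions_two_values:
  fixes T T' :: "puncture \<Rightarrow> 'a::real_normed_field \<Rightarrow> 'a" and \<theta> :: "puncture \<Rightarrow> 'a"
  defines "d \<equiv> \<lambda>i q. (T i q - 1) * (T' i q - 1) / (q - 1)^2"
    and "\<sigma> \<equiv> \<lambda>i q. T i q + T' i q - 2"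
  assumes t: "t1 \<noteq> 1" "t1 \<noteq> t2" "t1 \<noteq> - t2"
    and a: "\<And>t. t \<in> {t1, t2} \<Longrightarrow> ((\<lambda>q. (1 - t * T Pt q) * (1 - t * T' Pt q) * d P1 q) \<longlongrightarrow> (1 - t)^2 * (- ((\<theta> P1)^2 / 4))) (at 1)"
    and b: "\<And>t. t \<in> {t1, t2} \<Longrightarrow> ((\<lambda>q. (t - T P1 q) * (t - T' P1 q) * d Pt q) \<longlongrightarrow> (t - 1)^2 * (- ((\<theta> Pt)^2 / 4))) (at 1)"
    and c: "\<And>t. t \<in> {t1, t2} \<Longrightarrow> ((\<lambda>q. (t * \<sigma> Pt q + \<sigma> P1 q) / (q - 1)) \<longlongrightarrow> 0) (at 1)"
    and e: "\<And>t. t \<in> {t1, t2} \<Longrightarrow> ((\<lambda>q. t^2 * (T Pt q * T' Pt q - 1) + (T P1 q * T' P1 q - 1)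
        + t * ((T Pt q + T' Pt q) * (T P1 q + T' P1 q) - 4)) \<longlongrightarrow> 0) (at 1)"
  shows "((\<lambda>q. \<sigma> Pt q / (q - 1)) \<longlongrightarrow> 0) (at 1)" "((\<lambda>q. \<sigma> P1 q / (q - 1)) \<longlongrightarrow> 0) (at 1)"
    "(d Pt \<longlongrightarrow> - ((\<theta> Pt)^2 / 4)) (at 1)" "(d P1 \<longlongrightarrow> - ((\<theta> P1)^2 / 4)) (at 1)"
proof -
  \<comment> \<open>Two linear equations with different slopes determine both functions.\<close>
  have affine: "(f \<longlongrightarrow> 0) (at 1) \<and> (g \<longlongrightarrow> 0) (at 1)"
    if "r1 \<noteq> r2" "((\<lambda>q. r1 * f q + g q) \<longlongrightarrow> 0) (at 1)" "((\<lambda>q. r2 * f q + g q) \<longlongrightarrow> 0) (at 1)"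
    for r1 r2 :: 'a and f g :: "'a \<Rightarrow> 'a"
  proof -
    have "((\<lambda>q. ((r1 * f q + g q) - (r2 * f q + g q)) / (r1 - r2)) \<longlongrightarrow> (0 - 0) / (r1 - r2)) (at 1)"
      by (intro tendsto_intros that(2,3)) (use that(1) in simp)
    moreover have "((r1 * f q + g q) - (r2 * f q + g q)) / (r1 - r2) = f q" for q
    proof -
      have "(r1 * f q + g q) - (r2 * f q + g q) = (r1 - r2) * f q" by algebra
      then show ?thesis using that(1) by simp
    qed
    ultimately have f: "(f \<longlongrightarrow> 0) (at 1)" by simp
    have "((\<lambda>q. (r1 * f q + g q) - r1 * f q) \<longlongrightarrow> 0 - r1 * 0) (at 1)"
      by (intro tendsto_intros f that(2))
    then show ?thesis using f by simp
  qed
  have q1: "\<forall>\<^sub>F q in at (1 :: 'a). q \<noteq> 1" by (simp add: eventually_neq_at_within)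
  have "((\<lambda>q. \<sigma> Pt q / (q - 1)) \<longlongrightarrow> 0) (at 1) \<and> ((\<lambda>q. \<sigma> P1 q / (q - 1)) \<longlongrightarrow> 0) (at 1)"
    using affine[OF t(2), of "\<lambda>q. \<sigma> Pt q / (q - 1)" "\<lambda>q. \<sigma> P1 q / (q - 1)"] c[of t1] c[of t2]
    by (simp add: add_divide_distrib)
  then show st: "((\<lambda>q. \<sigma> Pt q / (q - 1)) \<longlongrightarrow> 0) (at 1)" and s1: "((\<lambda>q. \<sigma> P1 q / (q - 1)) \<longlongrightarrow> 0) (at 1)"
    by auto
  have st': "((\<lambda>q. T Pt q + T' Pt q) \<longlongrightarrow> 2) (at 1)" and s1': "((\<lambda>q. T P1 q + T' P1 q) \<longlongrightarrow> 2) (at 1)"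
    using tendsto_of_quotient_tendsto[of "\<lambda>q. T Pt q + T' Pt q" 2 1 0]
      tendsto_of_quotient_tendsto[of "\<lambda>q. T P1 q + T' P1 q" 2 1 0] st s1 by (simp_all add: \<sigma>_def)
  \<comment> \<open>Both sums tend to 2, so the mixed term tends to \<open>t * (2 * 2 - 4)\<close>,
    which is 0.\<close>
  have pp: "((\<lambda>q. t^2 * (T Pt q * T' Pt q - 1) + (T P1 q * T' P1 q - 1)) \<longlongrightarrow> 0) (at 1)" if "t \<in> {t1, t2}" for t
  proof -
    have "((\<lambda>q. t^2 * (T Pt q * T' Pt q - 1) + (T P1 q * T' P1 q - 1)
        + t * ((T Pt q + T' Pt q) * (T P1 q + T' P1 q) - 4) - t * ((T Pt q + T' Pt q) * (T P1 q + T' P1 q) - 4))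
        \<longlongrightarrow> 0 - t * (2 * 2 - 4)) (at 1)"
      by (intro tendsto_intros st' s1' e that)
    then show ?thesis by simp
  qed
  have "t1^2 \<noteq> t2^2" using t by (simp add: power2_eq_iff)
  from affine[OF this pp[of t1] pp[of t2]]
  have "((\<lambda>q. T Pt q * T' Pt q - 1) \<longlongrightarrow> 0) (at 1) \<and> ((\<lambda>q. T P1 q * T' P1 q - 1) \<longlongrightarrow> 0) (at 1)" by simp
  then have pt: "((\<lambda>q. T Pt q * T' Pt q) \<longlongrightarrow> 1) (at 1)" and p1: "((\<lambda>q. T P1 q * T' P1 q) \<longlongrightarrow> 1) (at 1)"
    by (auto simp: LIM_zero_iff)
  have quot: "(f \<longlongrightarrow> L) (at 1)" if "(g \<longlongrightarrow> (1 - t1)^2) (at 1)" "((\<lambda>q. g q * f q) \<longlongrightarrow> (1 - t1)^2 * L) (at 1)"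
    for f g :: "'a \<Rightarrow> 'a" and L
  proof (rule Lim_transform_eventually)
    have 0: "(1 - t1)^2 \<noteq> 0" using t by simp
    then have "((\<lambda>q. g q * f q / g q) \<longlongrightarrow> (1 - t1)^2 * L / (1 - t1)^2) (at 1)"
      by (intro tendsto_divide that)
    then show "((\<lambda>q. g q * f q / g q) \<longlongrightarrow> L) (at 1)" using 0 by simp
    show "\<forall>\<^sub>F q in at 1. g q * f q / g q = f q"
      using tendsto_imp_eventually_ne[OF that(1) 0] by eventually_elim simp
  qed
  show "(d P1 \<longlongrightarrow> - ((\<theta> P1)^2 / 4)) (at 1)"
  proof (rule quot)
    have "((\<lambda>q. 1 - t1 * (T Pt q + T' Pt q) + t1^2 * (T Pt q * T' Pt q)) \<longlongrightarrow> 1 - t1 * 2 + t1^2 * 1) (at 1)"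
      by (intro tendsto_intros st' pt)
    then show "((\<lambda>q. (1 - t1 * T Pt q) * (1 - t1 * T' Pt q)) \<longlongrightarrow> (1 - t1)^2) (at 1)"
      by (simp add: algebra_simps power2_eq_square)
    show "((\<lambda>q. (1 - t1 * T Pt q) * (1 - t1 * T' Pt q) * d P1 q) \<longlongrightarrow> (1 - t1)^2 * - ((\<theta> P1)^2 / 4)) (at 1)"
      by (rule a) simp
  qed
  show "(d Pt \<longlongrightarrow> - ((\<theta> Pt)^2 / 4)) (at 1)"
  proof (rule quot)
    have "((\<lambda>q. t1^2 - t1 * (T P1 q + T' P1 q) + (T P1 q * T' P1 q)) \<longlongrightarrow> t1^2 - t1 * 2 + 1) (at 1)"
      by (intro tendsto_intros s1' p1)
    then show "((\<lambda>q. (t1 - T P1 q) * (t1 - T' P1 q)) \<longlongrightarrow> (1 - t1)^2) (at 1)"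
      by (simp add: algebra_simps power2_eq_square)
    have "(1 - t1)^2 = (t1 - 1)^2" by algebra
    then show "((\<lambda>q. (t1 - T P1 q) * (t1 - T' P1 q) * d Pt q) \<longlongrightarrow> (1 - t1)^2 * - ((\<theta> Pt)^2 / 4)) (at 1)"
      using b[of t1] by simp
  qed
qed

text \<open>For \<open>u = a q - 1\<close> and \<open>v = b q - 1\<close> this is the identity
  \<open>(u - v)^2 = (u + v)^2 - 4 * u * v\<close>, in which \<open>u + v\<close> is negligible
  against \<open>q - 1\<close>.\<close>

lemma difference_square_tendsto:
  fixes a b :: "'a::real_normed_field \<Rightarrow> 'a"
  assumes "((\<lambda>q. (a q + b q - 2) / (q - 1)) \<longlongrightarrow> 0) (at 1)"
    and "((\<lambda>q. (a q - 1) * (b q - 1) / (q - 1)^2) \<longlongrightarrow> - (c^2 / 4)) (at 1)"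
  shows "((\<lambda>q. ((a q - b q) / (q - 1))^2) \<longlongrightarrow> c^2) (at 1)"
proof -
  have "((\<lambda>q. ((a q + b q - 2) / (q - 1))^2 - 4 * ((a q - 1) * (b q - 1) / (q - 1)^2)) \<longlongrightarrow> 0^2 - 4 * - (c^2 / 4)) (at 1)"
    by (intro tendsto_intros assms)
  moreover have "((a q + b q - 2) / (q - 1))^2 - 4 * ((a q - 1) * (b q - 1) / (q - 1)^2) = ((a q - b q) / (q - 1))^2" for q
  proof -
    have "(a q - b q)^2 = (a q + b q - 2)^2 - 4 * ((a q - 1) * (b q - 1))" by algebra
    moreover have "(A / e)^2 - 4 * (B / e^2) = (A^2 - 4 * B) / e^2" for A B e :: 'a
      by (simp add: power_divide diff_divide_distrib)
    ultimately show ?thesis by (simp only: power_divide)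
  qed
  ultimately show ?thesis by simp
qed

lemma half_sum_tendsto:
  fixes a b :: "'a::real_normed_field \<Rightarrow> 'a"
  assumes "((\<lambda>q. (a q + b q - 2) / (q - 1)) \<longlongrightarrow> 0) (at 1)"
    and "((\<lambda>q. (a q - b q) / (q - 1)) \<longlongrightarrow> c) (at 1)"
  shows "((\<lambda>q. (a q - 1) / (q - 1)) \<longlongrightarrow> c / 2) (at 1)" "((\<lambda>q. (b q - 1) / (q - 1)) \<longlongrightarrow> - (c / 2)) (at 1)"
proof -
  have "((\<lambda>q. ((a q + b q - 2) / (q - 1) + (a q - b q) / (q - 1)) / 2) \<longlongrightarrow> (0 + c) / 2) (at 1)"
    by (intro tendsto_intros assms) simp
  moreover have "((a q + b q - 2) / (q - 1) + (a q - b q) / (q - 1)) / 2 = (a q - 1) / (q - 1)" for q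
  proof -
    have "a q + b q - 2 + (a q - b q) = 2 * (a q - 1)" by algebra
    moreover have "2 * A / e / 2 = A / e" for A e :: 'a by simp
    ultimately show ?thesis unfolding add_divide_distrib[symmetric] by (simp only:)
  qed
  ultimately show "((\<lambda>q. (a q - 1) / (q - 1)) \<longlongrightarrow> c / 2) (at 1)" by simp
  have "((\<lambda>q. ((a q + b q - 2) / (q - 1) - (a q - b q) / (q - 1)) / 2) \<longlongrightarrow> (0 - c) / 2) (at 1)"
    by (intro tendsto_intros assms) simp
  moreover have "((a q + b q - 2) / (q - 1) - (a q - b q) / (q - 1)) / 2 = (b q - 1) / (q - 1)" for q
  proof -
    have "a q + b q - 2 - (a q - b q) = 2 * (b q - 1)" by algebra
    moreover have "2 * A / e / 2 = A / e" for A e :: 'a by simp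
    ultimately show ?thesis unfolding diff_divide_distrib[symmetric] by (simp only:)
  qed
  ultimately show "((\<lambda>q. (b q - 1) / (q - 1)) \<longlongrightarrow> - (c / 2)) (at 1)" by simp
qed

text \<open>The first-order terms \<open>c\<close> and \<open>- c\<close> cancel in the sum; in the
  product they leave \<open>- c^2\<close> at second order.\<close>

lemma second_order_sum_prod:
  fixes a b :: "'a::real_normed_field \<Rightarrow> 'a"
  assumes "((\<lambda>q. (a q - 1 - (q - 1) * c) / (q - 1)^2) \<longlongrightarrow> k) (at 1)"
    and "((\<lambda>q. (b q - 1 - (q - 1) * (- c)) / (q - 1)^2) \<longlongrightarrow> k') (at 1)"
  shows "((\<lambda>q. (a q + b q - 2) / (q - 1)^2) \<longlongrightarrow> k + k') (at 1)"
    and "((\<lambda>q. (a q * b q - 1) / (q - 1)^2) \<longlongrightarrow> k + k' - c^2) (at 1)"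
proof -
  define u v where "u = (\<lambda>q. (a q - 1 - (q - 1) * c) / (q - 1)^2)" and "v = (\<lambda>q. (b q - 1 - (q - 1) * (- c)) / (q - 1)^2)"
  have q1: "\<forall>\<^sub>F q in at (1 :: 'a). q \<noteq> 1" by (simp add: eventually_neq_at_within)
  have uv: "(u \<longlongrightarrow> k) (at 1)" "(v \<longlongrightarrow> k') (at 1)" using assms by (simp_all add: u_def v_def)
  have ab: "\<forall>\<^sub>F q in at 1. a q = 1 + (q - 1) * c + (q - 1)^2 * u q \<and> b q = 1 - (q - 1) * c + (q - 1)^2 * v q"
    using q1 by eventually_elim (simp add: u_def v_def)
  show "((\<lambda>q. (a q + b q - 2) / (q - 1)^2) \<longlongrightarrow> k + k') (at 1)"
  proof (rule Lim_transform_eventually[OF tendsto_add[OF uv]])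
    show "\<forall>\<^sub>F q in at 1. u q + v q = (a q + b q - 2) / (q - 1)^2"
      using q1
    proof eventually_elim
      case (elim q)
      have "a q + b q - 2 = (a q - 1 - (q - 1) * c) + (b q - 1 - (q - 1) * (- c))" by algebra
      then show ?case unfolding u_def v_def add_divide_distrib[symmetric] by (simp only:)
    qed
  qed
  show "((\<lambda>q. (a q * b q - 1) / (q - 1)^2) \<longlongrightarrow> k + k' - c^2) (at 1)"
  proof (rule Lim_transform_eventually)
    have "((\<lambda>q. u q + v q - c^2 + (q - 1) * c * (v q - u q) + (q - 1)^2 * u q * v q) \<longlongrightarrow>
      k + k' - c^2 + (1 - 1) * c * (k' - k) + (1 - 1)^2 * k * k') (at 1)"
      by (intro tendsto_intros uv)
    then show "((\<lambda>q. u q + v q - c^2 + (q - 1) * c * (v q - u q) + (q - 1)^2 * u q * v q) \<longlongrightarrow> k + k' - c^2) (at 1)"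
      by simp
    show "\<forall>\<^sub>F q in at 1. u q + v q - c^2 + (q - 1) * c * (v q - u q) + (q - 1)^2 * u q * v q = (a q * b q - 1) / (q - 1)^2"
      using q1 ab
    proof eventually_elim
      case (elim q)
      then have "a q * b q - 1 = (1 + (q - 1) * c + (q - 1)^2 * u q) * (1 - (q - 1) * c + (q - 1)^2 * v q) - 1" by simp
      also have "\<dots> = (q - 1)^2 * (u q + v q - c^2 + (q - 1) * c * (v q - u q) + (q - 1)^2 * u q * v q)" by algebra
      finally show ?case using elim(1) by simp
    qed
  qed
qed

section \<open>Specialisation of the variables\<close>

context generic_eval
begin

context
  fixes \<Theta> \<Theta>' :: "puncture \<Rightarrow> 'r fract" and l y Z t q x :: "'r fract"
    and T T' :: "puncture \<Rightarrow> 'w \<Rightarrow> complex" and l' y' Z' t' q' x' :: "'w \<Rightarrow> complex"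
  assumes rep: "\<And>i. represents (\<Theta> i) (T i)" "\<And>i. represents (\<Theta>' i) (T' i)"
    "represents l l'" "represents y y'" "represents Z Z'" "represents t t'" "represents q q'" "represents x x'"
begin

lemma represents_pfrak: "represents u u' \<Longrightarrow> represents (pfrak \<Theta> \<Theta>' t u) (\<lambda>w. pfrak (\<lambda>i. T i w) (\<lambda>i. T' i w) (t' w) (u' w))"
  unfolding pfrak_def by (intro represents_arith rep)

lemma represents_qz1: "represents (qz1 \<Theta>' y Z t q) (\<lambda>w. qz1 (\<lambda>i. T' i w) (y' w) (Z' w) (t' w) (q' w))"
  unfolding qz1_def by (intro represents_arith rep)

lemma represents_qz2: "represents (qz2 \<Theta> \<Theta>' y Z t q) (\<lambda>w. qz2 (\<lambda>i. T i w) (\<lambda>i. T' i w) (y' w) (Z' w) (t' w) (q' w))"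
  unfolding qz2_def by (intro represents_arith represents_pfrak represents_qz1 rep)

lemma represents_qsum: "represents (qsum \<Theta> \<Theta>' y t) (\<lambda>w. qsum (\<lambda>i. T i w) (\<lambda>i. T' i w) (y' w) (t' w))"
  unfolding qsum_def by (intro represents_arith represents_pfrak rep)

lemma represents_qalpha: "represents (qalpha \<Theta> \<Theta>' y Z t q)
    (\<lambda>w. qalpha (\<lambda>i. T i w) (\<lambda>i. T' i w) (y' w) (Z' w) (t' w) (q' w))"
  unfolding qalpha_def by (intro represents_arith represents_qz1 represents_qz2 represents_qsum rep)

lemma represents_qbeta: "represents (qbeta \<Theta> \<Theta>' y Z t q)
    (\<lambda>w. qbeta (\<lambda>i. T i w) (\<lambda>i. T' i w) (y' w) (Z' w) (t' w) (q' w))"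
  unfolding qbeta_def by (intro represents_arith represents_qalpha represents_qsum rep)

lemma represents_qgamma: "represents (qgamma \<Theta> \<Theta>' y Z t q)
    (\<lambda>w. qgamma (\<lambda>i. T i w) (\<lambda>i. T' i w) (y' w) (Z' w) (t' w) (q' w))"
  unfolding qgamma_def
  by (intro represents_arith represents_qz1 represents_qz2 represents_qalpha represents_qbeta represents_pfrak rep)

lemma represents_qdelta: "represents (qdelta \<Theta> \<Theta>' y Z t q)
    (\<lambda>w. qdelta (\<lambda>i. T i w) (\<lambda>i. T' i w) (y' w) (Z' w) (t' w) (q' w))"
  unfolding qdelta_def
  by (intro represents_arith represents_qz1 represents_qz2 represents_qalpha represents_qbeta represents_pfrak rep)

text \<open>The definition is the same over every field and uses field operations only, so generic
  evaluation commutes with it and no denominator has to be inspected.\<close>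

lemma represents_Afrak_tilde: "represents (Afrak_tilde \<Theta> \<Theta>' l y Z t q x $ i $ j)
    (\<lambda>w. Afrak_tilde (\<lambda>i. T i w) (\<lambda>i. T' i w) (l' w) (y' w) (Z' w) (t' w) (q' w) (x' w) $ i $ j)"
proof -
  have ne: "((1 :: 2) = 2) = False" "((2 :: 2) = 1) = False" by simp_all
  note intros = represents_arith represents_qz1 represents_qz2 represents_qalpha represents_qbeta
    represents_qgamma represents_qdelta rep
  have "\<forall>i j. represents (Afrak_tilde \<Theta> \<Theta>' l y Z t q x $ i $ j)
    (\<lambda>w. Afrak_tilde (\<lambda>i. T i w) (\<lambda>i. T' i w) (l' w) (y' w) (Z' w) (t' w) (q' w) (x' w) $ i $ j)"
    unfolding forall_2 Afrak_tilde_def Afrak_def mat_def vec_lambda_beta vector_minus_component vector_2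
      simp_thms(6) ne if_True if_False
    by (intro conjI intros)
  then show ?thesis by blast
qed

end

context
  fixes \<theta> :: "puncture \<Rightarrow> 'r fract" and l y Z t x :: "'r fract"
    and \<theta>' :: "puncture \<Rightarrow> 'w \<Rightarrow> complex" and l' y' Z' t' x' :: "'w \<Rightarrow> complex"
  assumes rep: "\<And>i. represents (\<theta> i) (\<theta>' i)"
    "represents l l'" "represents y y'" "represents Z Z'" "represents t t'" "represents x x'"
begin

lemma represents_da: "represents (da \<theta> y t) (\<lambda>w. da (\<lambda>i. \<theta>' i w) (y' w) (t' w))"
  unfolding da_def by (intro represents_arith rep)

lemma represents_dc0: "represents (dc0 \<theta> y Z t) (\<lambda>w. dc0 (\<lambda>i. \<theta>' i w) (y' w) (Z' w) (t' w))"
  unfolding dc0_def by (intro represents_arith represents_da rep)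

lemma represents_dc1: "represents (dc1 \<theta> y Z t) (\<lambda>w. dc1 (\<lambda>i. \<theta>' i w) (y' w) (Z' w) (t' w))"
  unfolding dc1_def by (intro represents_arith represents_da rep)

lemma represents_A11: "represents (A11 \<theta> y Z t x) (\<lambda>w. A11 (\<lambda>i. \<theta>' i w) (y' w) (Z' w) (t' w) (x' w))"
  unfolding A11_def by (intro represents_arith represents_da rep)

lemma represents_Amat: "represents (Amat \<theta> l y Z t x $ i $ j)
    (\<lambda>w. Amat (\<lambda>i. \<theta>' i w) (l' w) (y' w) (Z' w) (t' w) (x' w) $ i $ j)"
proof -
  have "\<forall>i j. represents (Amat \<theta> l y Z t x $ i $ j)
    (\<lambda>w. Amat (\<lambda>i. \<theta>' i w) (l' w) (y' w) (Z' w) (t' w) (x' w) $ i $ j)"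
    unfolding forall_2 Amat_def vector_2
    by (intro conjI represents_arith represents_A11 represents_dc0 represents_dc1 rep)
  then show ?thesis by blast
qed

end

end

section \<open>Rational functions of \<open>q\<close> near 1\<close>

lemma generic_eval_q: "generic_eval (\<lambda>c (p :: complex poly). poly p c) (at 1)"
  by (rule generic_eval_poly, rule eventually_poly_nonzero)

lemma eval_ratfun_eq_eval_frac: "eval_ratfun f z = eval_frac (\<lambda>p. poly p z) f"
  by (simp add: eval_ratfun_def eval_frac_def)

interpretation genq: generic_eval "\<lambda>c (p :: complex poly). poly p c" "at 1"
  by (rule generic_eval_q)

lemma represents_eval_ratfun: "genq.represents f (\<lambda>q. eval_ratfun f q)"
  unfolding eval_ratfun_eq_eval_frac by (rule genq.represents_eval)

lemma represents_q_minus_1: "genq.represents (to_fract [:- 1, 1:]) (\<lambda>q. q - 1)"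
  using genq.represents_to_fract[of "[:- 1, 1:]"] by simp

text \<open>\<open>\<phi>\<close> may be any function that agrees with \<open>f\<close> near 1.
  Coprimality enters the later arguments only through the absence of a common zero at 1.\<close>

lemma represented_coprime_quotient:
  assumes "genq.represents f \<phi>"
  obtains n d where "\<forall>\<^sub>F q in at 1. poly d q \<noteq> 0 \<and> \<phi> q * poly d q = poly n q"
    "\<not> (poly n 1 = 0 \<and> poly d 1 = 0)"
proof
  define n d where "n = fst (quot_of_fract f)" and "d = snd (quot_of_fract f)"
  have "d \<noteq> 0" by (simp add: d_def)
  then have "\<forall>\<^sub>F q in at 1. poly d q \<noteq> 0" by (rule eventually_poly_nonzero)
  moreover have "\<forall>\<^sub>F q in at 1. poly n q / poly d q = \<phi> q"
    using assms unfolding genq.represents_def eval_frac_def n_def d_def .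
  ultimately show "\<forall>\<^sub>F q in at 1. poly d q \<noteq> 0 \<and> \<phi> q * poly d q = poly n q"
    by eventually_elim (metis nonzero_divide_eq_eq)
  show "\<not> (poly n 1 = 0 \<and> poly d 1 = 0)"
  proof
    assume "poly n 1 = 0 \<and> poly d 1 = 0"
    then have "[:- 1, 1:] dvd n" "[:- 1, 1:] dvd d" by (simp_all add: poly_eq_0_iff_dvd)
    then have "is_unit [:- 1, 1 :: complex:]"
      using coprime_quot_of_fract[of f] unfolding n_def d_def by (meson coprime_common_divisor)
    then show False by (simp add: is_unit_poly_iff)
  qed
qed

lemma poly_tendsto_at: "(poly p \<longlongrightarrow> poly p a) (at (a :: complex))"
  by (intro tendsto_intros)

text \<open>Convergence of the square excludes a pole, so \<open>\<phi>\<close> itself has a limit,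
  whose square is \<open>c^2\<close>. For an arbitrary function the sign could keep
  changing.\<close>

lemma ratfun_limit_of_square:
  assumes "genq.represents f \<phi>" and lim: "((\<lambda>q. (\<phi> q)^2) \<longlongrightarrow> c^2) (at 1)"
  shows "(\<phi> \<longlongrightarrow> c) (at 1) \<or> (\<phi> \<longlongrightarrow> - c) (at 1)"
proof -
  obtain n d where nd: "\<forall>\<^sub>F q in at 1. poly d q \<noteq> 0 \<and> \<phi> q * poly d q = poly n q"
    and cop: "\<not> (poly n 1 = 0 \<and> poly d 1 = 0)"
    using represented_coprime_quotient[OF assms(1)] by metis
  have sq: "(poly n 1)^2 = c^2 * (poly d 1)^2"
  proof (rule tendsto_unique)
    show "((\<lambda>q. (poly n q)^2) \<longlongrightarrow> (poly n 1)^2) (at 1)" by (intro tendsto_intros)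
    have "((\<lambda>q. (\<phi> q)^2 * (poly d q)^2) \<longlongrightarrow> c^2 * (poly d 1)^2) (at 1)" by (intro tendsto_intros lim)
    then show "((\<lambda>q. (poly n q)^2) \<longlongrightarrow> c^2 * (poly d 1)^2) (at 1)"
      by (rule Lim_transform_eventually) (use nd in eventually_elim, metis power_mult_distrib)
  qed simp
  \<comment> \<open>If \<open>poly d 1\<close> were 0, then \<open>sq\<close> would make
    \<open>poly n 1\<close> vanish as well.\<close>
  have d1: "poly d 1 \<noteq> 0" using sq cop by auto
  have "(poly n 1 / poly d 1)^2 = c^2"
    using sq d1 by (simp only: power_divide) (metis nonzero_mult_div_cancel_right power_not_zero)
  moreover have "(\<phi> \<longlongrightarrow> poly n 1 / poly d 1) (at 1)"
  proof (rule Lim_transform_eventually)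
    show "((\<lambda>q. poly n q / poly d q) \<longlongrightarrow> poly n 1 / poly d 1) (at 1)"
      by (intro tendsto_divide poly_tendsto_at d1)
    show "\<forall>\<^sub>F q in at 1. poly n q / poly d q = \<phi> q"
      using nd by eventually_elim (metis nonzero_eq_divide_eq)
  qed
  ultimately show ?thesis by (metis power2_eq_iff)
qed

text \<open>A numerator that vanishes at 1 is divisible by \<open>q - 1\<close>, and the denominator
  does not vanish there.\<close>

lemma ratfun_zero_quotient_tendsto:
  assumes "genq.represents f \<phi>" and lim: "(\<phi> \<longlongrightarrow> 0) (at 1)"
  obtains L where "((\<lambda>q. \<phi> q / (q - 1)) \<longlongrightarrow> L) (at 1)"
proof -
  obtain n d where nd: "\<forall>\<^sub>F q in at 1. poly d q \<noteq> 0 \<and> \<phi> q * poly d q = poly n q"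
    and cop: "\<not> (poly n 1 = 0 \<and> poly d 1 = 0)"
    using represented_coprime_quotient[OF assms(1)] by metis
  have n1: "poly n 1 = 0 * poly d 1"
  proof (rule tendsto_unique)
    show "(poly n \<longlongrightarrow> poly n 1) (at 1)" by (rule poly_tendsto_at)
    have "((\<lambda>q. \<phi> q * poly d q) \<longlongrightarrow> 0 * poly d 1) (at 1)" by (intro tendsto_intros lim)
    then show "(poly n \<longlongrightarrow> 0 * poly d 1) (at 1)"
      by (rule Lim_transform_eventually) (use nd in eventually_elim, metis)
  qed simp
  then have d1: "poly d 1 \<noteq> 0" using cop by auto
  from n1 obtain m where m: "n = [:- 1, 1:] * m"
    by (auto simp: poly_eq_0_iff_dvd elim: dvdE)
  have q1: "\<forall>\<^sub>F q in at (1 :: complex). q \<noteq> 1" by (simp add: eventually_neq_at_within)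
  have "((\<lambda>q. \<phi> q / (q - 1)) \<longlongrightarrow> poly m 1 / poly d 1) (at 1)"
  proof (rule Lim_transform_eventually)
    show "((\<lambda>q. poly m q / poly d q) \<longlongrightarrow> poly m 1 / poly d 1) (at 1)"
      by (intro tendsto_divide poly_tendsto_at d1)
    show "\<forall>\<^sub>F q in at 1. poly m q / poly d q = \<phi> q / (q - 1)"
      using nd q1
    proof eventually_elim
      case (elim q)
      then have "poly m q * (q - 1) = \<phi> q * poly d q" by (simp add: m algebra_simps)
      moreover have "q - 1 \<noteq> 0" using elim by simp
      ultimately show ?case using elim by (metis frac_eq_eq)
    qed
  qed
  then show thesis by (rule that)
qed

text \<open>The first-order remainder divided by \<open>q - 1\<close> is again rational, so if it
  tends to 0 it is even of order \<open>q - 1\<close>. Hence an error \<open>o(q - 1)\<close> is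
  already \<open>O((q - 1)^2)\<close>, and a second-order coefficient exists.\<close>

lemma ratfun_expansion_iff:
  fixes c :: complex
  shows "(\<lambda>q. eval_ratfun f q - (1 + (q - 1) * c)) \<in> O[at 1](\<lambda>q. (q - 1)^2)
    \<longleftrightarrow> ((\<lambda>q. (eval_ratfun f q - 1) / (q - 1)) \<longlongrightarrow> c) (at 1)" (is "?A \<longleftrightarrow> ?B")
    and "((\<lambda>q. (eval_ratfun f q - 1) / (q - 1)) \<longlongrightarrow> c) (at 1) \<Longrightarrow>
      \<exists>k. ((\<lambda>q. (eval_ratfun f q - 1 - (q - 1) * c) / (q - 1)^2) \<longlongrightarrow> k) (at 1)" (is "_ \<Longrightarrow> ?C")
proof -
  have q1: "\<forall>\<^sub>F q in at (1 :: complex). q \<noteq> 1" by (simp add: eventually_neq_at_within)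
  define h where "h = (\<lambda>q. (eval_ratfun f q - 1 - (q - 1) * c) / (q - 1))"
  have h: "\<forall>\<^sub>F q in at 1. h q = (eval_ratfun f q - 1) / (q - 1) - c"
    using q1 by eventually_elim (simp add: h_def diff_divide_distrib)
  show C: ?C if ?B
  proof -
    have "((\<lambda>q. (eval_ratfun f q - 1) / (q - 1) - c) \<longlongrightarrow> c - c) (at 1)" by (intro tendsto_intros that)
    then have h0: "(h \<longlongrightarrow> 0) (at 1)"
      by (subst tendsto_cong[OF h]) simp
    have "genq.represents ((f - 1 - to_fract [:- 1, 1:] * to_fract [:c:]) / to_fract [:- 1, 1:]) h"
      unfolding h_def
      by (intro genq.represents_arith represents_eval_ratfun represents_q_minus_1)
         (use genq.represents_to_fract[of "[:c:]"] in simp)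
    from ratfun_zero_quotient_tendsto[OF this h0] obtain L where "((\<lambda>q. h q / (q - 1)) \<longlongrightarrow> L) (at 1)" .
    then show ?thesis by (auto simp: h_def power2_eq_square)
  qed
  show "?A \<longleftrightarrow> ?B"
  proof
    assume ?A
    also have "(\<lambda>q::complex. (q - 1)^2) \<in> o[at 1](\<lambda>q. q - 1)"
    proof (rule smalloI_tendsto)
      have "((\<lambda>q::complex. q - 1) \<longlongrightarrow> 1 - 1) (at 1)" by (intro tendsto_intros)
      moreover have "\<forall>\<^sub>F q in at (1::complex). q - 1 = (q - 1)^2 / (q - 1)"
        using q1 by eventually_elim (simp add: power2_eq_square)
      ultimately show "((\<lambda>q::complex. (q - 1)^2 / (q - 1)) \<longlongrightarrow> 0) (at 1)"
        by (simp add: Lim_transform_eventually)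
      show "\<forall>\<^sub>F q in at (1::complex). q - 1 \<noteq> 0" using q1 by eventually_elim simp
    qed
    finally have "((\<lambda>q. (eval_ratfun f q - (1 + (q - 1) * c)) / (q - 1)) \<longlongrightarrow> 0) (at 1)"
      by (rule smalloD_tendsto)
    then have "(h \<longlongrightarrow> 0) (at 1)" by (simp add: h_def diff_diff_eq)
    then have "((\<lambda>q. (eval_ratfun f q - 1) / (q - 1) - c) \<longlongrightarrow> 0) (at 1)"
      by (subst (asm) tendsto_cong[OF h])
    then show ?B by (simp only: LIM_zero_iff)
  next
    assume ?B
    from C[OF this] obtain k where "((\<lambda>q. (eval_ratfun f q - (1 + (q - 1) * c)) / (q - 1)^2) \<longlongrightarrow> k) (at 1)"
      by (auto simp: diff_diff_eq)
    then show ?A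
      by (rule bigoI_tendsto) (use q1 in eventually_elim, simp)
  qed
qed

section \<open>Specialising the five variables\<close>

type_synonym point5 = "(((complex \<times> complex) \<times> complex) \<times> complex) \<times> complex"

text \<open>The polynomial ring is nested with \<open>x\<close> innermost, so \<open>x\<close> is
  also the innermost coordinate of a point.\<close>

definition eval5 :: "point5 \<Rightarrow> R5 \<Rightarrow> complex" where
  "eval5 = eval_outer (eval_outer (eval_outer (eval_outer (\<lambda>x p. poly p x))))"

text \<open>
  The innermost variable is quantified first: then finitely many good values of \<open>x\<close> share their good values
  of the other variables, and cofinitely many \<open>t\<close> remain available once these are chosen.
\<close>

definition generic5 :: "point5 filter" where
  "generic5 = nested (nested (nested (nested cofinite cofinite) cofinite) cofinite) cofinite"

lemma eventually_generic5:
  "eventually P generic5 \<longleftrightarrow> (\<forall>\<^sub>F x in cofinite. \<forall>\<^sub>F l in cofinite. \<forall>\<^sub>F y in cofinite. \<forall>\<^sub>F Z in cofinite. \<forall>\<^sub>F t in cofinite.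
     P ((((x, l), y), Z), t))"
  by (simp add: generic5_def eventually_nested)

lemma cofinite_complex_neq_bot: "(cofinite :: complex filter) \<noteq> bot"
  by (simp add: infinite_UNIV_char_0)

lemma generic5_neq_bot: "generic5 \<noteq> bot"
  unfolding generic5_def by (intro nested_neq_bot cofinite_complex_neq_bot)

lemma generic_eval5: "generic_eval eval5 generic5"
  unfolding eval5_def generic5_def
  by (intro generic_eval_outer generic_eval_poly eventually_poly_nonzero(1))

lemma eval5_variables [simp]:
  "eval5 ((((x, l), y), Z), t) x5 = x" "eval5 ((((x, l), y), Z), t) l5 = l" "eval5 ((((x, l), y), Z), t) y5 = y"
  "eval5 ((((x, l), y), Z), t) Z5 = Z" "eval5 ((((x, l), y), Z), t) t5 = t" "eval5 v (const5 c) = c"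
  by (auto simp: eval5_def x5_def l5_def y5_def Z5_def t5_def const5_def map_poly_pCons split: prod.splits)

interpretation gen5: generic_eval eval5 generic5
  by (rule generic_eval5)

interpretation gen6: generic_eval "eval_outer eval5" "nested generic5 (at 1)"
  by (intro generic_eval_outer generic_eval5 eventually_poly_nonzero(2))

lemma represents_emb6: "gen6.represents (emb6 p) (\<lambda>w. eval5 (fst w) p)"
  using gen6.represents_to_fract[of "[:p:]"] by (simp add: emb6_def map_poly_pCons case_prod_beta)

lemma represents_q6: "gen6.represents q6 snd"
  using gen6.represents_to_fract[of "[:0, 1:]"] by (simp add: q6_def map_poly_pCons case_prod_beta)

lemma eval_outer_const5: "poly (map_poly (eval5 v) (map_poly const5 p)) c = poly p c"
proof -
  have "map_poly (eval5 v) (map_poly const5 p) = p"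
  proof (intro poly_eqI)
    have "const5 0 = 0" by (simp add: const5_def)
    then show "coeff (map_poly (eval5 v) (map_poly const5 p)) n = coeff p n" for n
      by (simp add: coeff_map_poly)
  qed
  then show ?thesis by simp
qed

lemma represents_of_ratfun_q: "gen6.represents (of_ratfun_q f) (\<lambda>w. eval_ratfun f (snd w))"
proof -
  define d where "d = snd (quot_of_fract f)"
  have "map_poly const5 d \<noteq> 0"
  proof
    assume "map_poly const5 d = 0"
    \<comment> \<open>Any point would do in place of \<open>undefined\<close>, as the value does not
      depend on it.\<close>
    then have "poly d c = 0" for c using eval_outer_const5[of undefined d c] by simp
    then show False using poly_all_0_iff_0[of d] by (simp add: d_def)
  qed
  from gen6.represents_quotient[OF this, of "map_poly const5 (fst (quot_of_fract f))"]
  show ?thesis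
    by (simp add: of_ratfun_q_def eval_ratfun_def d_def case_prod_beta eval_outer_const5)
qed

abbreviation x_coord where "x_coord v \<equiv> fst (fst (fst (fst v)))"
abbreviation l_coord where "l_coord v \<equiv> snd (fst (fst (fst v)))"
abbreviation y_coord where "y_coord v \<equiv> snd (fst (fst v))"
abbreviation Z_coord where "Z_coord v \<equiv> snd (fst v)"
abbreviation t_coord where "t_coord v \<equiv> snd v"

lemma eval5_coords:
  "eval5 v x5 = x_coord v" "eval5 v l5 = l_coord v" "eval5 v y5 = y_coord v" "eval5 v Z5 = Z_coord v" "eval5 v t5 = t_coord v"
  by (cases v rule: prod.exhaust; auto split: prod.splits)+

text \<open>\<open>restriction_iff_generic_limit\<close> is applied entry by entry, and the four
  generic conditions are merged. The variable \<open>q\<close> tends to 1 with all others fixed, so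
  the neighbourhood of 1 may depend on the point.\<close>

lemma condition_iff_generic_limits:
  "(\<not> polar_component [:-1, 1:] (Afrak_tilde_gen \<Theta> \<Theta>') \<and>
      (\<chi> i j. restrict_q1 (Afrak_tilde_gen \<Theta> \<Theta>' $ i $ j)) = Amat_gen \<theta>)
   \<longleftrightarrow> (\<forall>\<^sub>F x in cofinite. \<forall>\<^sub>F l in cofinite. \<forall>\<^sub>F y in cofinite. \<forall>\<^sub>F Z in cofinite. \<forall>\<^sub>F t in cofinite.
      \<forall>i j. ((\<lambda>q. Afrak_tilde (\<lambda>i. eval_ratfun (\<Theta> i) q) (\<lambda>i. eval_ratfun (\<Theta>' i) q) l y Z t q x $ i $ j)
          \<longlongrightarrow> Amat \<theta> l y Z t x $ i $ j) (at 1))"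
    (is "?L \<longleftrightarrow> ?R")
proof -
  let ?A = "Afrak_tilde_gen \<Theta> \<Theta>'" and ?B = "Amat_gen \<theta>"
  let ?a = "\<lambda>v q. Afrak_tilde (\<lambda>i. eval_ratfun (\<Theta> i) q) (\<lambda>i. eval_ratfun (\<Theta>' i) q)
      (l_coord v) (y_coord v) (Z_coord v) (t_coord v) q (x_coord v)"
  let ?b = "\<lambda>v. Amat \<theta> (l_coord v) (y_coord v) (Z_coord v) (t_coord v) (x_coord v)"
  have "gen6.represents (?A $ i $ j) (\<lambda>w. ?a (fst w) (snd w) $ i $ j)" for i j
    unfolding Afrak_tilde_gen_def eval5_coords[symmetric]
    by (intro gen6.represents_Afrak_tilde represents_emb6 represents_q6 represents_of_ratfun_q)
  then have A: "\<forall>\<^sub>F v in generic5. \<forall>\<^sub>F q in at 1. eval_frac (eval_outer eval5 (v, q)) (?A $ i $ j) = ?a v q $ i $ j" for i j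
    unfolding gen6.represents_def eventually_nested by simp
  have "gen5.represents (?B $ i $ j) (\<lambda>v. ?b v $ i $ j)" for i j
    unfolding Amat_gen_def eval5_coords[symmetric]
    by (intro gen5.represents_Amat gen5.represents_to_fract)
       (use gen5.represents_to_fract[of "const5 _"] in simp)
  then have B: "\<forall>\<^sub>F v in generic5. eval_frac (eval5 v) (?B $ i $ j) = ?b v $ i $ j" for i j
    unfolding gen5.represents_def .
  have "?L \<longleftrightarrow> (\<forall>i j. \<not> [:- 1, 1:] dvd snd (quot_of_fract (?A $ i $ j)) \<and>
      to_fract (poly (fst (quot_of_fract (?A $ i $ j))) 1) / to_fract (poly (snd (quot_of_fract (?A $ i $ j))) 1) = ?B $ i $ j)"
    unfolding polar_component_def vec_eq_iff vec_lambda_beta restrict_q1_def by blast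
  also have "\<dots> \<longleftrightarrow> (\<forall>i j. \<forall>\<^sub>F v in generic5.
      ((\<lambda>q. eval_frac (eval_outer eval5 (v, q)) (?A $ i $ j)) \<longlongrightarrow> eval_frac (eval5 v) (?B $ i $ j)) (at 1))"
    unfolding restriction_iff_generic_limit[OF generic_eval5 generic5_neq_bot] ..
  also have "\<dots> \<longleftrightarrow> (\<forall>i j. \<forall>\<^sub>F v in generic5. ((\<lambda>q. ?a v q $ i $ j) \<longlongrightarrow> ?b v $ i $ j) (at 1))"
  proof (intro iff_allI eventually_subst)
    fix i j :: 2
    show "\<forall>\<^sub>F v in generic5. ((\<lambda>q. eval_frac (eval_outer eval5 (v, q)) (?A $ i $ j)) \<longlongrightarrow> eval_frac (eval5 v) (?B $ i $ j)) (at 1)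
        = ((\<lambda>q. ?a v q $ i $ j) \<longlongrightarrow> ?b v $ i $ j) (at 1)"
      using A[of i j] B[of i j]
    proof eventually_elim
      case (elim v)
      show ?case unfolding elim(2) by (rule tendsto_cong[OF elim(1)])
    qed
  qed
  also have "\<dots> \<longleftrightarrow> (\<forall>\<^sub>F v in generic5. \<forall>i j. ((\<lambda>q. ?a v q $ i $ j) \<longlongrightarrow> ?b v $ i $ j) (at 1))"
    unfolding forall_2 eventually_conj_iff ..
  also have "\<dots> \<longleftrightarrow> ?R"
    unfolding eventually_generic5 by simp
  finally show ?thesis .
qed

section \<open>Choice of generic values and the equivalence with the expansions\<close>

lemma cofinite_avoid:
  assumes "finite A" "\<And>z. z \<notin> A \<Longrightarrow> P z"
  shows "\<forall>\<^sub>F z in cofinite. P z"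
  using finite_subset[OF _ assms(1), of "{z. \<not> P z}"] assms(2) by (auto simp: eventually_cofinite)

lemma cofinite_obtain:
  fixes P :: "complex \<Rightarrow> bool"
  assumes "\<forall>\<^sub>F z in cofinite. P z" "finite A"
  obtains z where "P z" "z \<notin> A"
proof -
  have "\<forall>\<^sub>F z in cofinite. P z \<and> z \<notin> A"
    using assms(1) cofinite_avoid[OF assms(2), of "\<lambda>z. z \<notin> A"] by (auto intro: eventually_conj)
  then show thesis using eventually_happens[of _ cofinite] cofinite_complex_neq_bot that by blast
qed

text \<open>\<open>S\<close> collects the indices at which \<open>\<Theta>\<close> and
  \<open>\<Theta>'\<close> exchange roles. The expansions appear as first-order limits, which
  suffices by \<open>ratfun_expansion_iff\<close>.\<close>

lemma generic_limits_iff_expansions: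
  fixes \<theta> :: "puncture \<Rightarrow> complex" and \<Theta> \<Theta>' :: "puncture \<Rightarrow> complex poly fract"
  assumes th: "\<theta> Pinf \<noteq> 0"
    and rel: "\<Theta> P0 * \<Theta>' P0 = \<Theta> Pinf * \<Theta>' Pinf * \<Theta> Pt * \<Theta>' Pt * \<Theta> P1 * \<Theta>' P1"
  defines "E \<equiv> \<lambda>f c. ((\<lambda>q. (eval_ratfun f q - 1) / (q - 1)) \<longlongrightarrow> c) (at 1)"
  shows "(\<forall>\<^sub>F x in cofinite. \<forall>\<^sub>F l in cofinite. \<forall>\<^sub>F y in cofinite. \<forall>\<^sub>F Z in cofinite. \<forall>\<^sub>F t in cofinite.
      \<forall>i j. ((\<lambda>q. Afrak_tilde (\<lambda>i. eval_ratfun (\<Theta> i) q) (\<lambda>i. eval_ratfun (\<Theta>' i) q) l y Z t q x $ i $ j)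
          \<longlongrightarrow> Amat \<theta> l y Z t x $ i $ j) (at 1))
   \<longleftrightarrow> (\<exists>S \<subseteq> {P0, P1, Pt}. \<forall>i. E (if i \<in> S then \<Theta>' i else \<Theta> i) (\<theta> i / 2) \<and> E (if i \<in> S then \<Theta> i else \<Theta>' i) (- (\<theta> i / 2)))"
    (is "?L \<longleftrightarrow> ?R")
proof -
  define T T' where "T = (\<lambda>i. eval_ratfun (\<Theta> i))" and "T' = (\<lambda>i. eval_ratfun (\<Theta>' i))"
  have rel': "\<forall>\<^sub>F q in at 1. T P0 q * T' P0 q = T Pinf q * T' Pinf q * T Pt q * T' Pt q * T P1 q * T' P1 q"
  proof -
    have "genq.represents (\<Theta> P0 * \<Theta>' P0) (\<lambda>q. T P0 q * T' P0 q)"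
      unfolding T_def T'_def by (intro genq.represents_mult represents_eval_ratfun)
    moreover have "genq.represents (\<Theta> P0 * \<Theta>' P0) (\<lambda>q. T Pinf q * T' Pinf q * T Pt q * T' Pt q * T P1 q * T' P1 q)"
      unfolding T_def T'_def rel by (intro genq.represents_mult represents_eval_ratfun)
    ultimately show ?thesis unfolding genq.represents_def by eventually_elim simp
  qed
  show ?thesis
  proof
    assume ?R
    then obtain S where S: "S \<subseteq> {P0, P1, Pt}"
      and E: "\<And>i. E (if i \<in> S then \<Theta>' i else \<Theta> i) (\<theta> i / 2)" "\<And>i. E (if i \<in> S then \<Theta> i else \<Theta>' i) (- (\<theta> i / 2))"
      by blast
    have Pinf: "Pinf \<notin> S" using S by auto
    \<comment> \<open>Sum and product are not affected by the exchange, so one statement covers the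
      indices inside and outside \<open>S\<close>.\<close>
    have ex_s: "\<exists>s. ((\<lambda>q. (T i q + T' i q - 2) / (q - 1)^2) \<longlongrightarrow> s) (at 1) \<and>
        ((\<lambda>q. (T i q * T' i q - 1) / (q - 1)^2) \<longlongrightarrow> s - (\<theta> i)^2 / 4) (at 1)" for i
    proof -
      define f f' where "f = (if i \<in> S then \<Theta>' i else \<Theta> i)" and "f' = (if i \<in> S then \<Theta> i else \<Theta>' i)"
      have "E f (\<theta> i / 2)" "E f' (- (\<theta> i / 2))" unfolding f_def f'_def by (rule E)+
      note ratfun_expansion_iff(2)[OF this(1)[unfolded E_def]] ratfun_expansion_iff(2)[OF this(2)[unfolded E_def]]
      then obtain k k' where
        k: "((\<lambda>q. (eval_ratfun f q - 1 - (q - 1) * (\<theta> i / 2)) / (q - 1)^2) \<longlongrightarrow> k) (at 1)"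
        and k': "((\<lambda>q. (eval_ratfun f' q - 1 - (q - 1) * (- (\<theta> i / 2))) / (q - 1)^2) \<longlongrightarrow> k') (at 1)"
        by blast
      from second_order_sum_prod[OF k k']
      have "((\<lambda>q. (eval_ratfun f q + eval_ratfun f' q - 2) / (q - 1)^2) \<longlongrightarrow> k + k') (at 1)"
        "((\<lambda>q. (eval_ratfun f q * eval_ratfun f' q - 1) / (q - 1)^2) \<longlongrightarrow> k + k' - (\<theta> i / 2)^2) (at 1)" .
      moreover have "eval_ratfun f q + eval_ratfun f' q = T i q + T' i q"
        "eval_ratfun f q * eval_ratfun f' q = T i q * T' i q" for q
        by (simp_all add: f_def f'_def T_def T'_def)
      moreover have "(\<theta> i / 2)^2 = (\<theta> i)^2 / 4" by (simp add: power_divide)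
      ultimately show ?thesis by (intro exI[of _ "k + k'"]) (simp only:)
    qed
    from choice[OF allI[OF ex_s]] obtain s where s': "\<forall>i. ((\<lambda>q. (T i q + T' i q - 2) / (q - 1)^2) \<longlongrightarrow> s i) (at 1) \<and>
        ((\<lambda>q. (T i q * T' i q - 1) / (q - 1)^2) \<longlongrightarrow> s i - (\<theta> i)^2 / 4) (at 1)"
      by (rule exE)
    note s = s'[rule_format, THEN conjunct1] s'[rule_format, THEN conjunct2]
    have inf: "((\<lambda>q. (T Pinf q - 1) / (q - 1)) \<longlongrightarrow> \<theta> Pinf / 2) (at 1)"
      "((\<lambda>q. (T' Pinf q - 1) / (q - 1)) \<longlongrightarrow> - (\<theta> Pinf / 2)) (at 1)"
      using E[of Pinf] Pinf by (simp_all only: E_def T_def T'_def if_False)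
    have lims: "\<forall>i j. ((\<lambda>q. Afrak_tilde (\<lambda>i. T i q) (\<lambda>i. T' i q) l y Z t q x $ i $ j)
          \<longlongrightarrow> Amat \<theta> l y Z t x $ i $ j) (at 1)"
      if "x \<notin> {0, 1}" "l \<notin> {0}" "y \<notin> {0, 1, x}" "t \<notin> {0, 1, x, y}" for x l y Z t
    proof -
      have x: "x \<noteq> 0" "x \<noteq> 1" "x \<noteq> t" "x \<noteq> y" and y: "y \<noteq> 0" "y \<noteq> 1" "y \<noteq> t" "t \<noteq> 0" "t \<noteq> 1" and l: "l \<noteq> 0"
        using that by auto
      note lim = limits_of_expansions[where T = T and T' = T' and \<theta> = \<theta> and S = s, OF y th l s inf rel']
      show ?thesis
        unfolding Afrak_tilde_tendsto_iff[where \<theta> = \<theta> and T = T and T' = T', OF x th] by (intro conjI lim)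
    qed
    show ?L
      apply (rule cofinite_avoid[of "{0, 1}"], simp)
      subgoal for x
        apply (rule cofinite_avoid[of "{0}"], simp)
        subgoal for l
          apply (rule cofinite_avoid[of "{0, 1, x}"], simp)
          subgoal for y
            apply (rule always_eventually, rule allI)
            subgoal for Z
              apply (rule cofinite_avoid[of "{0, 1, x, y}"], simp)
              using lims[unfolded T_def T'_def] by blast
            done
          done
        done
      done
  next
    assume ?L
    define Q where "Q = (\<lambda>x l y Z t. \<forall>i j. ((\<lambda>q. Afrak_tilde (\<lambda>i. T i q) (\<lambda>i. T' i q) l y Z t q x $ i $ j)
          \<longlongrightarrow> Amat \<theta> l y Z t x $ i $ j) (at 1))"
    have x: "\<forall>\<^sub>F x in cofinite. \<forall>\<^sub>F l in cofinite. \<forall>\<^sub>F y in cofinite. \<forall>\<^sub>F Z in cofinite. \<forall>\<^sub>F t in cofinite. Q x l y Z t"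
      using \<open>?L\<close> unfolding Q_def T_def T'_def .
    \<comment> \<open>Three values of \<open>x\<close> are needed to recover a quadratic. They are
      fixed first; afterwards values of the remaining variables are chosen that are good for all
      three.\<close>
    obtain x1 where x1: "\<forall>\<^sub>F l in cofinite. \<forall>\<^sub>F y in cofinite. \<forall>\<^sub>F Z in cofinite. \<forall>\<^sub>F t in cofinite. Q x1 l y Z t" "x1 \<notin> {0, 1}"
      using cofinite_obtain[OF x, of "{0, 1}"] by auto
    obtain x2 where x2: "\<forall>\<^sub>F l in cofinite. \<forall>\<^sub>F y in cofinite. \<forall>\<^sub>F Z in cofinite. \<forall>\<^sub>F t in cofinite. Q x2 l y Z t" "x2 \<notin> {0, 1, x1}"
      using cofinite_obtain[OF x, of "{0, 1, x1}"] by auto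
    obtain x3 where x3: "\<forall>\<^sub>F l in cofinite. \<forall>\<^sub>F y in cofinite. \<forall>\<^sub>F Z in cofinite. \<forall>\<^sub>F t in cofinite. Q x3 l y Z t" "x3 \<notin> {0, 1, x1, x2}"
      using cofinite_obtain[OF x, of "{0, 1, x1, x2}"] by auto
    define X where "X = {x1, x2, x3}"
    have l: "\<forall>\<^sub>F l in cofinite. \<forall>\<^sub>F y in cofinite. \<forall>\<^sub>F Z in cofinite. \<forall>\<^sub>F t in cofinite. \<forall>x\<in>X. Q x l y Z t"
      unfolding X_def using x1(1) x2(1) x3(1) by (simp add: eventually_conj_iff)
    obtain l where y: "\<forall>\<^sub>F y in cofinite. \<forall>\<^sub>F Z in cofinite. \<forall>\<^sub>F t in cofinite. \<forall>x\<in>X. Q x l y Z t" and l: "l \<notin> {0}"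
      using cofinite_obtain[OF l, of "{0}"] by auto
    obtain y where Z: "\<forall>\<^sub>F Z in cofinite. \<forall>\<^sub>F t in cofinite. \<forall>x\<in>X. Q x l y Z t" and y: "y \<notin> {0, 1} \<union> X"
      using cofinite_obtain[OF y, of "{0, 1} \<union> X"] by (auto simp: X_def)
    obtain Z where t: "\<forall>\<^sub>F t in cofinite. \<forall>x\<in>X. Q x l y Z t"
      using cofinite_obtain[OF Z, of "{}"] by auto
    obtain t1 where t1: "\<forall>x\<in>X. Q x l y Z t1" "t1 \<notin> {0, 1, y} \<union> X"
      using cofinite_obtain[OF t, of "{0, 1, y} \<union> X"] by (auto simp: X_def)
    \<comment> \<open>\<open>- t1\<close> is avoided so that \<open>t1^2\<close> and
      \<open>t2^2\<close> differ.\<close>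
    obtain t2 where t2: "\<forall>x\<in>X. Q x l y Z t2" "t2 \<notin> {0, 1, y, t1, - t1} \<union> X"
      using cofinite_obtain[OF t, of "{0, 1, y, t1, - t1} \<union> X"] by (auto simp: X_def)
    have X: "x1 \<in> X" "x2 \<in> X" "x3 \<in> X" "x1 \<noteq> x2" "x1 \<noteq> x3" "x2 \<noteq> x3"
      using x1(2) x2(2) x3(2) by (auto simp: X_def)
    have exps: "y \<noteq> 0" "y \<noteq> 1" "y \<noteq> t" "t \<noteq> 0" "t \<noteq> 1" "l \<noteq> 0"
      "\<And>x. x \<in> X \<Longrightarrow> ((\<lambda>q. n11 (\<lambda>i. T i q) (\<lambda>i. T' i q) y Z t q x) \<longlongrightarrow> m11 \<theta> y Z t x) (at 1)"
      "\<And>x. x \<in> X \<Longrightarrow> ((\<lambda>q. n22 (\<lambda>i. T i q) (\<lambda>i. T' i q) y Z t q x) \<longlongrightarrow> - m11 \<theta> y Z t x) (at 1)"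
      "\<And>x. x \<in> X \<Longrightarrow> ((\<lambda>q. n21 (\<lambda>i. T i q) (\<lambda>i. T' i q) l y Z t q x) \<longlongrightarrow> m21 \<theta> l y Z t x) (at 1)"
      if "t \<in> {t1, t2}" for t
    proof -
      show "y \<noteq> 0" "y \<noteq> 1" "y \<noteq> t" "t \<noteq> 0" "t \<noteq> 1" "l \<noteq> 0" using that y t1(2) t2(2) l by auto
      fix x assume "x \<in> X"
      then have x: "x \<noteq> 0" "x \<noteq> 1" "x \<noteq> t" "x \<noteq> y" and "Q x l y Z t"
        using that y t1 t2 x1(2) x2(2) x3(2) by (auto simp: X_def)
      then show "((\<lambda>q. n11 (\<lambda>i. T i q) (\<lambda>i. T' i q) y Z t q x) \<longlongrightarrow> m11 \<theta> y Z t x) (at 1)"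
        "((\<lambda>q. n22 (\<lambda>i. T i q) (\<lambda>i. T' i q) y Z t q x) \<longlongrightarrow> - m11 \<theta> y Z t x) (at 1)"
        "((\<lambda>q. n21 (\<lambda>i. T i q) (\<lambda>i. T' i q) l y Z t q x) \<longlongrightarrow> m21 \<theta> l y Z t x) (at 1)"
        unfolding Q_def Afrak_tilde_tendsto_iff[where \<theta> = \<theta> and T = T and T' = T', OF x th] by blast+
    qed
    note expand = expansions_of_limits[where T = T and T' = T' and \<theta> = \<theta> and X = X and l = l and y = y and Z = Z,
        OF exps(1,2,3,4,5) th exps(6) rel' exps(7,8,9) X]
    have in1: "t1 \<in> {t1, t2}" by simp
    have ex: "((\<lambda>q. (T Pinf q - 1) / (q - 1)) \<longlongrightarrow> \<theta> Pinf / 2) (at 1)"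
      "((\<lambda>q. (T' Pinf q - 1) / (q - 1)) \<longlongrightarrow> - (\<theta> Pinf / 2)) (at 1)"
      "((\<lambda>q. (T P0 q + T' P0 q - 2) / (q - 1)) \<longlongrightarrow> 0) (at 1)"
      "((\<lambda>q. (T P0 q - 1) * (T' P0 q - 1) / (q - 1)^2) \<longlongrightarrow> - ((\<theta> P0)^2 / 4)) (at 1)"
      by (rule expand(1) expand(2) expand(3) expand(4); (rule in1 | assumption))+
    have t12: "t1 \<noteq> 1" "t1 \<noteq> t2" "t1 \<noteq> - t2" using t1(2) t2(2) by auto
    have two: "((\<lambda>q. (T Pt q + T' Pt q - 2) / (q - 1)) \<longlongrightarrow> 0) (at 1)" "((\<lambda>q. (T P1 q + T' P1 q - 2) / (q - 1)) \<longlongrightarrow> 0) (at 1)"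
      "((\<lambda>q. (T Pt q - 1) * (T' Pt q - 1) / (q - 1)^2) \<longlongrightarrow> - ((\<theta> Pt)^2 / 4)) (at 1)"
      "((\<lambda>q. (T P1 q - 1) * (T' P1 q - 1) / (q - 1)^2) \<longlongrightarrow> - ((\<theta> P1)^2 / 4)) (at 1)"
      by (rule expansions_two_values[where T = T and T' = T' and \<theta> = \<theta>, OF t12]; 
          (rule expand(5) expand(6) expand(7) expand(8); assumption))+
    have sum_prod: "((\<lambda>q. (T i q + T' i q - 2) / (q - 1)) \<longlongrightarrow> 0) (at 1) \<and>
       ((\<lambda>q. (T i q - 1) * (T' i q - 1) / (q - 1)^2) \<longlongrightarrow> - ((\<theta> i)^2 / 4)) (at 1)" if "i \<in> {P0, P1, Pt}" for i
      using that ex(3,4) two by auto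
    \<comment> \<open>The quotient of \<open>\<Theta> i - \<Theta>' i\<close> by
      \<open>q - 1\<close> is rational and its square tends to the square of
      \<open>\<theta> i\<close>; the sign is decided separately for each \<open>i\<close>.\<close>
    have cases: "E (\<Theta> i) (\<theta> i / 2) \<and> E (\<Theta>' i) (- (\<theta> i / 2)) \<or> E (\<Theta>' i) (\<theta> i / 2) \<and> E (\<Theta> i) (- (\<theta> i / 2))"
      if "i \<in> {P0, P1, Pt}" for i
    proof -
      note sp = sum_prod[OF that, THEN conjunct1] sum_prod[OF that, THEN conjunct2]
      have "genq.represents ((\<Theta> i - \<Theta>' i) / to_fract [:- 1, 1:]) (\<lambda>q. (T i q - T' i q) / (q - 1))"
        unfolding T_def T'_def by (intro genq.represents_arith represents_eval_ratfun represents_q_minus_1)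
      from ratfun_limit_of_square[OF this difference_square_tendsto[OF sp]]
      show ?thesis
      proof
        assume "((\<lambda>q. (T i q - T' i q) / (q - 1)) \<longlongrightarrow> \<theta> i) (at 1)"
        from half_sum_tendsto[OF sp(1) this] show ?thesis by (simp add: E_def T_def T'_def)
      next
        assume "((\<lambda>q. (T i q - T' i q) / (q - 1)) \<longlongrightarrow> - \<theta> i) (at 1)"
        from half_sum_tendsto[OF sp(1) this] show ?thesis by (simp add: E_def T_def T'_def)
      qed
    qed
    \<comment> \<open>Where the first alternative fails, \<open>cases\<close> supplies the second.
      An index for which both hold, as may happen for \<open>\<theta> i = 0\<close>, stays
      outside.\<close>
    define S where "S = {i \<in> {P0, P1, Pt}. \<not> (E (\<Theta> i) (\<theta> i / 2) \<and> E (\<Theta>' i) (- (\<theta> i / 2)))}"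
    have "E (if i \<in> S then \<Theta>' i else \<Theta> i) (\<theta> i / 2) \<and> E (if i \<in> S then \<Theta> i else \<Theta>' i) (- (\<theta> i / 2))" for i
    proof (cases "i = Pinf")
      case True
      then have "i \<notin> S" by (simp add: S_def)
      then show ?thesis using ex(1,2) by (simp add: True E_def T_def T'_def)
    next
      case False
      then have "i \<in> {P0, P1, Pt}" by (cases i) auto
      then show ?thesis using cases[of i] by (auto simp: S_def)
    qed
    moreover have "S \<subseteq> {P0, P1, Pt}" by (auto simp: S_def)
    ultimately show ?R by blast
  qed
qed

theorem proposition1p11:
  fixes \<theta> :: "puncture \<Rightarrow> complex"
    and \<Theta> \<Theta>' :: "puncture \<Rightarrow> complex poly fract"
  assumes "\<theta> Pinf \<noteq> 0"
    and "\<Theta> Pinf \<noteq> \<Theta>' Pinf"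
    and "\<Theta> P0 * \<Theta>' P0 = \<Theta> Pinf * \<Theta>' Pinf * \<Theta> Pt * \<Theta>' Pt * \<Theta> P1 * \<Theta>' P1"
  shows "(\<not> polar_component [:-1, 1:] (Afrak_tilde_gen \<Theta> \<Theta>') \<and>
          (\<chi> i j. restrict_q1 (Afrak_tilde_gen \<Theta> \<Theta>' $ i $ j)) = Amat_gen \<theta>)
     \<longleftrightarrow>
     (\<exists>S \<subseteq> {P0, P1, Pt}. \<forall>i.
        (\<lambda>q. eval_ratfun (if i \<in> S then \<Theta>' i else \<Theta> i) q - (1 + (q - 1) * (\<theta> i / 2)))
          \<in> O[at 1](\<lambda>q. (q - 1)^2) \<and>
        (\<lambda>q. eval_ratfun (if i \<in> S then \<Theta> i else \<Theta>' i) q - (1 - (q - 1) * (\<theta> i / 2)))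
          \<in> O[at 1](\<lambda>q. (q - 1)^2))"
proof -
  \<comment> \<open>The lower sign is the same expansion with first-order coefficient
    \<open>- c\<close>.\<close>
  have minus: "(\<lambda>q. eval_ratfun f q - (1 - (q - 1) * c)) \<in> O[at 1](\<lambda>q. (q - 1)^2)
    \<longleftrightarrow> ((\<lambda>q. (eval_ratfun f q - 1) / (q - 1)) \<longlongrightarrow> - c) (at 1)" for f and c :: complex
    using ratfun_expansion_iff(1)[of f "- c"] by simp
  show ?thesis
    unfolding condition_iff_generic_limits generic_limits_iff_expansions[where \<theta> = \<theta> and \<Theta> = \<Theta> and \<Theta>' = \<Theta>', OF assms(1,3)] ratfun_expansion_iff(1) minus ..
qed

end
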